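(* Let $J_0$ be the standard almost complex structure on $S^6\subset\operatorname{Im}\mathbb O$, and let $u:\mathbb{CP}^1\to(S^6,J_0)$ be an immersed pseudoholomorphic sphere. Then the following are equivalent: (i) $u$ is totally geodesic with respect to the round metric; (ii) the holomorphic normal bundle $N_u$ satisfies $N_u\cong\mathcal O(-1)\oplus\mathcal O(-1)$.
   Context: $S^6$ is the unit sphere in the imaginary octonions $\operatorname{Im}\mathbb O$, and $(J_0)_x(v)=x\times v$ for $x\in S^6$, $v\in T_xS^6=x^\perp$, where $\times$ is the octonionic cross product. Let $j$ be the complex structure of $\mathbb{CP}^1$. A smooth map $u$ is pseudoholomorphic if $\bar\partial_{J_0}u:=\frac12(\mathrm du+J_0\circ\mathrm du\circ j)=0$. Its linearized operator $D_u:C^\infty(u^*TS^6)\to\Omega^{0,1}(u^*TS^6)$ is the linearization of $\bar\partial_{J_0}$ at $u$: for any connection $\nabla$ on $TS^6$ with $\nabla J_0=0$ and torsion $T$, and $U=\mathrm du(Y)$, $$D_u\xi(Y)=\tfrac12\bigl(\nabla_Y\xi+J_0\nabla_{jY}\xi\bigr)+\tfrac12\bigl(T(\xi,U)+J_0T(\xi,J_0U)\bigr).$$ For $u$ immersed, $N_u:=u^*TS^6/\mathrm du(T\mathbb{CP}^1)$ with quotient map $\pi_N$; the normal operator $D_u^N$ is characterized by $D_u^N\pi_N=(\mathrm{id}\otimes\pi_N)D_u$, and $\bar\partial_u^N$ denotes its complex-linear part, a complex-linear Cauchy--Riemann operator on $N_u$. The holomorphic structure on $N_u$ is the one defined by $\bar\partial_u^N$.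 *)

theory Defs
  imports "HOL-Analysis.Analysis"
begin

section \<open>Octonions and the nearly Kaehler six-sphere\<close>

type_synonym quat = "real \<times> (real^3)"
type_synonym oct = "quat \<times> quat"

text \<open>Imaginary octonions are the octonions \<open>((0, v), q)\<close>; we drop the zero real part, so that
  they form a seven-dimensional Euclidean space whose inner product is the octonionic one.\<close>

type_synonym imoct = "(real^3) \<times> quat"

definition quat_mult :: "quat \<Rightarrow> quat \<Rightarrow> quat" where
  "quat_mult p q = (fst p * fst q - snd p \<bullet> snd q,
     fst p *\<^sub>R snd q + fst q *\<^sub>R snd p + cross3 (snd p) (snd q))"

definition quat_cnj :: "quat \<Rightarrow> quat" where
  "quat_cnj p = (fst p, - snd p)"

text \<open>Cayley--Dickson: \<open>(a, b) (c, d) = (a c - d* b, d a + b c*)\<close>.\<close>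

definition oct_mult :: "oct \<Rightarrow> oct \<Rightarrow> oct" where
  "oct_mult x y =
     (quat_mult (fst x) (fst y) - quat_mult (quat_cnj (snd y)) (snd x),
      quat_mult (snd y) (fst x) + quat_mult (snd x) (quat_cnj (fst y)))"

definition oct_of_im :: "imoct \<Rightarrow> oct" where
  "oct_of_im x = ((0, fst x), snd x)"

definition oct_Im :: "oct \<Rightarrow> imoct" where
  "oct_Im x = (snd (fst x), snd x)"

definition oct_cross :: "imoct \<Rightarrow> imoct \<Rightarrow> imoct" where
  "oct_cross x y = oct_Im (oct_mult (oct_of_im x) (oct_of_im y))"

definition S6 :: "imoct set" where
  "S6 = sphere 0 1"

definition TS6 :: "imoct \<Rightarrow> imoct set" where
  "TS6 x = {v. v \<bullet> x = 0}"

definition J0 :: "imoct \<Rightarrow> imoct \<Rightarrow> imoct" where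
  "J0 x v = oct_cross x v"

text \<open>Orthogonal projection of the ambient space onto \<open>TS6 x\<close>, for \<open>x \<in> S6\<close>.\<close>

definition tproj :: "imoct \<Rightarrow> imoct \<Rightarrow> imoct" where
  "tproj x a = a - (a \<bullet> x) *\<^sub>R x"


section \<open>Smooth maps\<close>

text \<open>Meant for open \<open>S\<close>: all iterated directional derivatives up to the given order exist and
  are continuous on \<open>S\<close>.\<close>

primrec Ck_on :: "nat \<Rightarrow> 'a::real_normed_vector set \<Rightarrow> ('a \<Rightarrow> 'b::real_normed_vector) \<Rightarrow> bool" where
  "Ck_on 0 S f \<longleftrightarrow> continuous_on S f"
| "Ck_on (Suc k) S f \<longleftrightarrow> (\<forall>x\<in>S. f differentiable (at x)) \<and>
     (\<forall>v. Ck_on k S (\<lambda>x. frechet_derivative f (at x) v))"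

definition smooth_on :: "'a::real_normed_vector set \<Rightarrow> ('a \<Rightarrow> 'b::real_normed_vector) \<Rightarrow> bool" where
  "smooth_on S f \<longleftrightarrow> (\<forall>k. Ck_on k S f)"

text \<open>Functions and vector fields on \<open>S6\<close> are represented by functions on all of \<open>imoct\<close>, of which
  only the values on \<open>S6\<close> matter. To differentiate them they are first extended to
  \<open>- {0}\<close> along the radial retraction \<open>sgn\<close>, where \<open>sgn y = y /\<^sub>R norm y\<close>.\<close>

definition smooth_S6 :: "(imoct \<Rightarrow> 'b::real_normed_vector) \<Rightarrow> bool" where
  "smooth_S6 f \<longleftrightarrow> smooth_on (- {0}) (\<lambda>y. f (sgn y))"

definition dS6 :: "(imoct \<Rightarrow> 'b::real_normed_vector) \<Rightarrow> imoct \<Rightarrow> imoct \<Rightarrow> 'b" where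
  "dS6 f x v = frechet_derivative (\<lambda>y. f (sgn y)) (at x) v"

definition vector_field :: "(imoct \<Rightarrow> imoct) \<Rightarrow> bool" where
  "vector_field X \<longleftrightarrow> smooth_S6 X \<and> (\<forall>x\<in>S6. X x \<in> TS6 x)"


section \<open>Connections on the tangent bundle of the six-sphere\<close>

text \<open>\<open>nabla X x v\<close> is the covariant derivative at \<open>x\<close> of the vector field \<open>X\<close> in the direction
  \<open>v \<in> TS6 x\<close>.\<close>

type_synonym connection = "(imoct \<Rightarrow> imoct) \<Rightarrow> imoct \<Rightarrow> imoct \<Rightarrow> imoct"

definition is_connection :: "connection \<Rightarrow> bool" where
  "is_connection nabla \<longleftrightarrow>
     (\<forall>X V. vector_field X \<longrightarrow> vector_field V \<longrightarrow> vector_field (\<lambda>x. nabla X x (V x))) \<and>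
     (\<forall>X. vector_field X \<longrightarrow> (\<forall>x\<in>S6. \<forall>v\<in>TS6 x. nabla X x v \<in> TS6 x)) \<and>
     (\<forall>X. vector_field X \<longrightarrow> (\<forall>x\<in>S6. \<forall>v\<in>TS6 x. \<forall>w\<in>TS6 x. \<forall>a b.
        nabla X x (a *\<^sub>R v + b *\<^sub>R w) = a *\<^sub>R nabla X x v + b *\<^sub>R nabla X x w)) \<and>
     (\<forall>X Y. vector_field X \<longrightarrow> vector_field Y \<longrightarrow> (\<forall>x\<in>S6. \<forall>v\<in>TS6 x.
        nabla (\<lambda>y. X y + Y y) x v = nabla X x v + nabla Y x v)) \<and>
     (\<forall>(f :: imoct \<Rightarrow> real) X. smooth_S6 f \<longrightarrow> vector_field X \<longrightarrow> (\<forall>x\<in>S6. \<forall>v\<in>TS6 x.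
        nabla (\<lambda>y. f y *\<^sub>R X y) x v = dS6 f x v *\<^sub>R X x + f x *\<^sub>R nabla X x v))"

definition preserves_J0 :: "connection \<Rightarrow> bool" where
  "preserves_J0 nabla \<longleftrightarrow> (\<forall>X. vector_field X \<longrightarrow> (\<forall>x\<in>S6. \<forall>v\<in>TS6 x.
     nabla (\<lambda>y. J0 y (X y)) x v = J0 x (nabla X x v)))"

definition lie_bracket :: "(imoct \<Rightarrow> imoct) \<Rightarrow> (imoct \<Rightarrow> imoct) \<Rightarrow> imoct \<Rightarrow> imoct" where
  "lie_bracket X Y x = dS6 Y x (X x) - dS6 X x (Y x)"

text \<open>The torsion at \<open>x\<close> of \<open>a, b \<in> TS6 x\<close>, computed with the vector fields \<open>y \<mapsto> tproj y a\<close> and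
  \<open>y \<mapsto> tproj y b\<close>, which extend \<open>a\<close> and \<open>b\<close>; by tensoriality the choice is immaterial.\<close>

definition torsion :: "connection \<Rightarrow> imoct \<Rightarrow> imoct \<Rightarrow> imoct \<Rightarrow> imoct" where
  "torsion nabla x a b = nabla (\<lambda>y. tproj y b) x a - nabla (\<lambda>y. tproj y a) x b
     - lie_bracket (\<lambda>y. tproj y a) (\<lambda>y. tproj y b) x"


section \<open>The complex projective line\<close>

text \<open>Points are the lines in \<open>\<complex>\<^sup>2\<close>, so \<open>Rep_CP1 p\<close> is the fibre at \<open>p\<close> of the tautological
  bundle \<open>\<O>(-1)\<close>.\<close>

typedef CP1 = "{L :: (complex^2) set. \<exists>v. v \<noteq> 0 \<and> L = vec.span {v}}"
proof -
  have "(1 :: complex^2) \<noteq> 0" by simp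
  then show ?thesis by blast
qed

definition line :: "complex^2 \<Rightarrow> CP1" where
  "line v = Abs_CP1 (vec.span {v})"

text \<open>The two affine charts (as parametrizations). The complex structure and the smooth structure
  of \<open>CP1\<close> are the ones they define; the transition map is \<open>z \<mapsto> 1 / z\<close>.\<close>

definition CP1_charts :: "(complex \<Rightarrow> CP1) set" where
  "CP1_charts = {\<lambda>z. line (vector [1, z]), \<lambda>z. line (vector [z, 1])}"

definition smooth_CP1 :: "(CP1 \<Rightarrow> 'b::real_normed_vector) \<Rightarrow> bool" where
  "smooth_CP1 f \<longleftrightarrow> (\<forall>\<phi>\<in>CP1_charts. smooth_on UNIV (\<lambda>z. f (\<phi> z)))"

text \<open>A tangent vector of \<open>CP1\<close> is given by a chart \<open>\<phi>\<close>, a point \<open>z\<close> and \<open>Y :: complex\<close>; it stands for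
  \<open>d\<phi>\<^sub>z(Y)\<close>, and \<open>j\<close> acts by \<open>Y \<mapsto> \<i> * Y\<close>. Below, all one-forms on \<open>CP1\<close> take arguments \<open>\<phi> z Y\<close>.\<close>

definition dCP1 :: "(CP1 \<Rightarrow> 'b::real_normed_vector) \<Rightarrow> (complex \<Rightarrow> CP1) \<Rightarrow> complex \<Rightarrow> complex \<Rightarrow> 'b" where
  "dCP1 f \<phi> z Y = frechet_derivative (\<lambda>w. f (\<phi> w)) (at z) Y"


section \<open>Immersed pseudoholomorphic spheres\<close>

definition smooth_map_S6 :: "(CP1 \<Rightarrow> imoct) \<Rightarrow> bool" where
  "smooth_map_S6 u \<longleftrightarrow> (\<forall>p. u p \<in> S6) \<and> smooth_CP1 u"

definition dbar_J0 :: "(CP1 \<Rightarrow> imoct) \<Rightarrow> (complex \<Rightarrow> CP1) \<Rightarrow> complex \<Rightarrow> complex \<Rightarrow> imoct" where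
  "dbar_J0 u \<phi> z Y = (1/2) *\<^sub>R (dCP1 u \<phi> z Y + J0 (u (\<phi> z)) (dCP1 u \<phi> z (\<i> * Y)))"

definition pseudoholomorphic :: "(CP1 \<Rightarrow> imoct) \<Rightarrow> bool" where
  "pseudoholomorphic u \<longleftrightarrow> smooth_map_S6 u \<and> (\<forall>\<phi>\<in>CP1_charts. \<forall>z Y. dbar_J0 u \<phi> z Y = 0)"

definition immersed :: "(CP1 \<Rightarrow> imoct) \<Rightarrow> bool" where
  "immersed u \<longleftrightarrow> (\<forall>\<phi>\<in>CP1_charts. \<forall>z. inj (dCP1 u \<phi> z))"

text \<open>The subspace \<open>du(T\<^sub>pCP1)\<close> of \<open>TS6 (u p)\<close>.\<close>

definition tangent_image :: "(CP1 \<Rightarrow> imoct) \<Rightarrow> CP1 \<Rightarrow> imoct set" where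
  "tangent_image u p = {dCP1 u \<phi> z Y |\<phi> z Y. \<phi> \<in> CP1_charts \<and> \<phi> z = p}"

text \<open>The Levi-Civita connection of the round metric, pulled back by \<open>u\<close>, is \<open>tproj\<close> of the
  derivative. The second fundamental form at \<open>\<phi> z\<close> of \<open>Y, Z\<close> is the component of
  \<open>\<nabla>\<^sub>Y (du(Z))\<close> orthogonal to \<open>du(TCP1)\<close>, where \<open>Z\<close> is extended to a constant field in the
  chart \<open>\<phi>\<close>; the closest point of a linear subspace is the orthogonal projection.\<close>

definition second_fundamental_form ::
    "(CP1 \<Rightarrow> imoct) \<Rightarrow> (complex \<Rightarrow> CP1) \<Rightarrow> complex \<Rightarrow> complex \<Rightarrow> complex \<Rightarrow> imoct" where
  "second_fundamental_form u \<phi> z Y Z =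
     (let a = tproj (u (\<phi> z)) (frechet_derivative (\<lambda>w. dCP1 u \<phi> w Z) (at z) Y)
      in a - closest_point (tangent_image u (\<phi> z)) a)"

definition totally_geodesic :: "(CP1 \<Rightarrow> imoct) \<Rightarrow> bool" where
  "totally_geodesic u \<longleftrightarrow>
     (\<forall>\<phi>\<in>CP1_charts. \<forall>z Y Z. second_fundamental_form u \<phi> z Y Z = 0)"


section \<open>The linearized operator\<close>

definition pullback_section :: "(CP1 \<Rightarrow> imoct) \<Rightarrow> (CP1 \<Rightarrow> imoct) \<Rightarrow> bool" where
  "pullback_section u \<xi> \<longleftrightarrow> smooth_CP1 \<xi> \<and> (\<forall>p. \<xi> p \<in> TS6 (u p))"

text \<open>The pulled back connection on \<open>u\<^sup>*TS6\<close>. A section \<open>\<xi>\<close> satisfies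
  \<open>\<xi> p = (\<Sum>b\<in>Basis. (\<xi> p \<bullet> b) *\<^sub>R tproj (u p) b)\<close>; apply the Leibniz rule and
  \<open>\<nabla>\<^sub>Y (X \<circ> u) = (\<nabla>\<^bsub>du(Y)\<^esub> X) \<circ> u\<close> for the vector fields \<open>y \<mapsto> tproj y b\<close>.\<close>

definition pullback_connection ::
    "connection \<Rightarrow> (CP1 \<Rightarrow> imoct) \<Rightarrow> (CP1 \<Rightarrow> imoct) \<Rightarrow> (complex \<Rightarrow> CP1) \<Rightarrow> complex \<Rightarrow> complex \<Rightarrow> imoct" where
  "pullback_connection nabla u \<xi> \<phi> z Y =
     (\<Sum>b\<in>Basis. dCP1 (\<lambda>p. \<xi> p \<bullet> b) \<phi> z Y *\<^sub>R tproj (u (\<phi> z)) b +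
        (\<xi> (\<phi> z) \<bullet> b) *\<^sub>R nabla (\<lambda>y. tproj y b) (u (\<phi> z)) (dCP1 u \<phi> z Y))"

definition D_op ::
    "connection \<Rightarrow> (CP1 \<Rightarrow> imoct) \<Rightarrow> (CP1 \<Rightarrow> imoct) \<Rightarrow> (complex \<Rightarrow> CP1) \<Rightarrow> complex \<Rightarrow> complex \<Rightarrow> imoct" where
  "D_op nabla u \<xi> \<phi> z Y =
     (let x = u (\<phi> z); U = dCP1 u \<phi> z Y in
       (1/2) *\<^sub>R (pullback_connection nabla u \<xi> \<phi> z Y
                 + J0 x (pullback_connection nabla u \<xi> \<phi> z (\<i> * Y)))
     + (1/2) *\<^sub>R (torsion nabla x (\<xi> (\<phi> z)) U + J0 x (torsion nabla x (\<xi> (\<phi> z)) (J0 x U))))"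


section \<open>The normal bundle and its holomorphic structure\<close>

text \<open>The fibres of \<open>N\<^sub>u = u\<^sup>*TS6 / du(TCP1)\<close> are the genuine quotients, with cosets as elements.\<close>

definition quot_proj :: "(CP1 \<Rightarrow> imoct) \<Rightarrow> CP1 \<Rightarrow> imoct \<Rightarrow> imoct set" where
  "quot_proj u p v = {v + w |w. w \<in> tangent_image u p}"

definition normal_fibre :: "(CP1 \<Rightarrow> imoct) \<Rightarrow> CP1 \<Rightarrow> imoct set set" where
  "normal_fibre u p = quot_proj u p ` TS6 (u p)"

definition normal_add :: "imoct set \<Rightarrow> imoct set \<Rightarrow> imoct set" where
  "normal_add A B = {a + b |a b. a \<in> A \<and> b \<in> B}"

text \<open>Complex scalars act by \<open>\<i> [a] = [J0 a]\<close>. Adding \<open>tangent_image u p\<close> matters only for \<open>c = 0\<close>.\<close>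

definition normal_scale :: "(CP1 \<Rightarrow> imoct) \<Rightarrow> CP1 \<Rightarrow> complex \<Rightarrow> imoct set \<Rightarrow> imoct set" where
  "normal_scale u p c A =
     {Re c *\<^sub>R a + Im c *\<^sub>R J0 (u p) a + w |a w. a \<in> A \<and> w \<in> tangent_image u p}"

type_synonym normal_sec = "CP1 \<Rightarrow> imoct set"

definition is_lift :: "(CP1 \<Rightarrow> imoct) \<Rightarrow> normal_sec \<Rightarrow> (CP1 \<Rightarrow> imoct) \<Rightarrow> bool" where
  "is_lift u s \<xi> \<longleftrightarrow> pullback_section u \<xi> \<and> (\<forall>p. s p = quot_proj u p (\<xi> p))"

definition normal_section :: "(CP1 \<Rightarrow> imoct) \<Rightarrow> normal_sec \<Rightarrow> bool" where
  "normal_section u s \<longleftrightarrow> (\<exists>\<xi>. is_lift u s \<xi>)"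

text \<open>\<open>D\<^sup>N \<pi> = (id \<otimes> \<pi>) D\<close>. For pseudoholomorphic \<open>u\<close> the operator \<open>D\<close> maps sections of \<open>du(TCP1)\<close> to
  forms with values in \<open>du(TCP1)\<close>, so the result does not depend on the lift chosen.\<close>

definition DN_op ::
    "connection \<Rightarrow> (CP1 \<Rightarrow> imoct) \<Rightarrow> normal_sec \<Rightarrow> (complex \<Rightarrow> CP1) \<Rightarrow> complex \<Rightarrow> complex \<Rightarrow> imoct set" where
  "DN_op nabla u s \<phi> z Y = quot_proj u (\<phi> z) (D_op nabla u (SOME \<xi>. is_lift u s \<xi>) \<phi> z Y)"

text \<open>The complex-linear part \<open>s \<mapsto> (D\<^sup>N s - J0 D\<^sup>N (J0 s)) / 2\<close>.\<close>

definition dbar_N ::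
    "connection \<Rightarrow> (CP1 \<Rightarrow> imoct) \<Rightarrow> normal_sec \<Rightarrow> (complex \<Rightarrow> CP1) \<Rightarrow> complex \<Rightarrow> complex \<Rightarrow> imoct set" where
  "dbar_N nabla u s \<phi> z Y =
     normal_scale u (\<phi> z) (1/2)
       (normal_add (DN_op nabla u s \<phi> z Y)
          (normal_scale u (\<phi> z) (- \<i>)
             (DN_op nabla u (\<lambda>p. normal_scale u p \<i> (s p)) \<phi> z Y)))"


section \<open>The bundle \<open>\<O>(-1) \<oplus> \<O>(-1)\<close>\<close>

definition taut2_fibre :: "CP1 \<Rightarrow> ((complex^2) \<times> (complex^2)) set" where
  "taut2_fibre p = Rep_CP1 p \<times> Rep_CP1 p"

definition cscale2 :: "complex \<Rightarrow> (complex^2) \<times> (complex^2) \<Rightarrow> (complex^2) \<times> (complex^2)" where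
  "cscale2 c a = (c *s fst a, c *s snd a)"

text \<open>The Cauchy--Riemann operator of \<open>\<O>(-1) \<oplus> \<O>(-1)\<close> as a holomorphic subbundle of the
  trivial bundle with fibre \<open>\<complex>\<^sup>2 \<oplus> \<complex>\<^sup>2\<close>.\<close>

definition dbar_taut2 ::
    "(CP1 \<Rightarrow> (complex^2) \<times> (complex^2)) \<Rightarrow> (complex \<Rightarrow> CP1) \<Rightarrow> complex \<Rightarrow> complex
       \<Rightarrow> (complex^2) \<times> (complex^2)" where
  "dbar_taut2 F \<phi> z Y = (1/2) *\<^sub>R (dCP1 F \<phi> z Y + cscale2 \<i> (dCP1 F \<phi> z (\<i> * Y)))"

text \<open>\<open>\<Phi>\<close> is an isomorphism of smooth complex vector bundles from \<open>N\<^sub>u\<close> to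
  \<open>\<O>(-1) \<oplus> \<O>(-1)\<close> which intertwines the Cauchy--Riemann operators, hence an isomorphism of
  holomorphic vector bundles.\<close>

definition holomorphic_iso ::
    "connection \<Rightarrow> (CP1 \<Rightarrow> imoct) \<Rightarrow> (CP1 \<Rightarrow> imoct set \<Rightarrow> (complex^2) \<times> (complex^2)) \<Rightarrow> bool" where
  "holomorphic_iso nabla u \<Phi> \<longleftrightarrow>
     (\<forall>p. bij_betw (\<Phi> p) (normal_fibre u p) (taut2_fibre p)) \<and>
     (\<forall>p. \<forall>A\<in>normal_fibre u p. \<forall>B\<in>normal_fibre u p.
        \<Phi> p (normal_add A B) = \<Phi> p A + \<Phi> p B) \<and>
     (\<forall>p. \<forall>A\<in>normal_fibre u p. \<forall>c.
        \<Phi> p (normal_scale u p c A) = cscale2 c (\<Phi> p A)) \<and>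
     (\<forall>s. normal_section u s \<longrightarrow> smooth_CP1 (\<lambda>p. \<Phi> p (s p))) \<and>
     (\<forall>s. normal_section u s \<longrightarrow> (\<forall>\<phi>\<in>CP1_charts. \<forall>z Y.
        \<Phi> (\<phi> z) (dbar_N nabla u s \<phi> z Y) = dbar_taut2 (\<lambda>p. \<Phi> p (s p)) \<phi> z Y))"

definition normal_bundle_iso_taut2 :: "connection \<Rightarrow> (CP1 \<Rightarrow> imoct) \<Rightarrow> bool" where
  "normal_bundle_iso_taut2 nabla u \<longleftrightarrow> (\<exists>\<Phi>. holomorphic_iso nabla u \<Phi>)"

end

theory Submission
  imports Defs "HOL-Complex_Analysis.Complex_Analysis"
begin

text \<open>
  For any connection with \<open>\<nabla>J\<^sub>0 = 0\<close> the operator \<open>D\<close> is the same, and its complex-linear part on the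
  normal bundle is represented by
  \<open>1/2 (d\<xi>(Y) + u \<times> d\<xi>(jY) - u \<times> (du(Y) \<times> \<xi>))\<close> up to components along \<open>u\<close>.

  The second fundamental form along the holomorphic vector field \<open>d/dz\<close> of the sphere is a holomorphic
  section of \<open>N\<^sub>u\<close> vanishing at infinity. If \<open>N\<^sub>u\<close> embeds holomorphically into a trivial bundle, as
  \<open>\<O>(-1) \<oplus> \<O>(-1)\<close> does, Liouville's theorem shows that this section is zero.

  Conversely, if \<open>u\<close> is totally geodesic, then \<open>G = (u\<^sub>s + \<i> u\<^sub>t) / |u\<^sub>s|\<^sup>2\<close> is holomorphic and grows
  quadratically, so \<open>G(z) = A + z B + z\<^sup>2 C\<close> with values in the null cone of a complexified associative
  three-space \<open>V\<close>. The normal space at \<open>z\<close> is the kernel of the Clifford multiplication by \<open>G(z)\<close> on the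
  complexification of the orthogonal complement of \<open>V\<close>. Since \<open>C\<^sup>2 = 0\<close>, we have
  \<open>G(z) C = (A + z B) C\<close>, so pairing with \<open>B C b\<close> and \<open>- A C b\<close> maps the normal space at \<open>z\<close> to the line
  spanned by \<open>(1, z)\<close>; two suitable vectors \<open>b\<close> give the isomorphism with \<open>\<O>(-1) \<oplus> \<O>(-1)\<close>.
\<close>

section \<open>The cross product\<close>

text \<open>That the second fundamental form is holomorphic hinges on a sign. The term
  \<open>u \<times> (du(Y) \<times> \<xi>)\<close> of \<open>2 D\<close> is complex antilinear in
  \<open>\<xi>\<close>, so it drops out of the complex-linear part; but \<open>J\<^sub>0\<close>
  varies along \<open>u\<close>, and the complex-linear part of the derivative terms brings the same
  expression back with the opposite sign. The Cauchy-Riemann equation differentiated twice seems to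
  give \<open>u_ss\<close> the wrong sign, until \<open>u_s \<times> u_st\<close> is eliminated
  through \<open>u_s \<times> u_t = |u_s|^2 u\<close>; then both signs agree modulo tangent vectors.

  In the converse, \<open>V\<close> is the same at all points of the sphere. So
  \<open>N\<^sub>u\<close> is, as a real bundle, the constant space \<open>W\<close> orthogonal to
  \<open>V\<close>, with the varying complex structure \<open>u(p) \<times>\<close>, and
  \<open>n - i u(p) \<times> n\<close> embeds it into the trivial bundle with fibre the
  complexification of \<open>W\<close>. The same sign makes this embedding holomorphic. What remains
  is nondegeneracy of the pairings, which comes down to \<open>A . C\<close> being nonzero; there
  Liouville's theorem enters a further time.\<close>

notation oct_cross (infixl "\<otimes>" 75)

lemma imoct_eqI:
  fixes x y :: imoct
  assumes "fst x = fst y" "fst (snd x) = fst (snd y)" "snd (snd x) = snd (snd y)"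
  shows "x = y"
  using assms by (simp add: prod_eq_iff)

lemmas oct_cross_unfold = oct_cross_def oct_Im_def oct_mult_def oct_of_im_def quat_mult_def
  quat_cnj_def

lemma oct_cross_coords:
  "x \<otimes> y =
     (cross3 (fst x) (fst y) + fst (snd x) *\<^sub>R snd (snd y) - fst (snd y) *\<^sub>R snd (snd x)
        + cross3 (snd (snd y)) (snd (snd x)),
      - (snd (snd y) \<bullet> fst x) + snd (snd x) \<bullet> fst y,
      fst (snd y) *\<^sub>R fst x + cross3 (snd (snd y)) (fst x)
        - fst (snd x) *\<^sub>R fst y - cross3 (snd (snd x)) (fst y))"
  by (simp add: oct_cross_unfold algebra_simps)

lemma oct_cross_add_left: "(x + x') \<otimes> y = x \<otimes> y + x' \<otimes> y"
  by (simp add: oct_cross_coords inner_simps scaleR_add_left scaleR_add_right cross_add_left cross_add_right)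

lemma oct_cross_skew: "x \<otimes> y = - (y \<otimes> x)"
  using cross_skew[of "fst x" "fst y"] cross_skew[of "snd (snd x)" "snd (snd y)"]
  by (simp add: oct_cross_coords inner_commute algebra_simps)

lemma oct_cross_scaleR_left: "(c *\<^sub>R x) \<otimes> y = c *\<^sub>R (x \<otimes> y)"
  by (simp add: oct_cross_coords cross_mult_left cross_mult_right algebra_simps)

lemma oct_cross_triple: "(x \<otimes> y) \<bullet> z = - ((x \<otimes> z) \<bullet> y)"
  by (simp add: oct_cross_coords inner_prod_def cross3_simps)

text \<open>Beyond bilinearity, skewness and \<open>oct_cross_triple\<close>, this is the only fact
  about octonions that the sequel uses: it gives \<open>J0\<close> its square and, polarized, the
  Clifford relation. In coordinates it consists of seven polynomial identities.\<close>

lemma oct_cross_cross_self: "x \<otimes> (x \<otimes> y) = (x \<bullet> y) *\<^sub>R x - (x \<bullet> x) *\<^sub>R y"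
proof -
  obtain p a q where x: "x = (p, a, q)" by (cases x) auto
  obtain r b s where y: "y = (r, b, s)" by (cases y) auto
  have e: "cross3 v w $ 1 = v$2 * w$3 - v$3 * w$2" "cross3 v w $ 2 = v$3 * w$1 - v$1 * w$3"
    "cross3 v w $ 3 = v$1 * w$2 - v$2 * w$1" for v w
    by (simp_all add: cross_components)
  have i: "v \<bullet> w = v$1 * w$1 + v$2 * w$2 + v$3 * w$3" for v w :: "real^3"
    by (simp add: inner_vec_def sum_3)
  show ?thesis
    unfolding x y
  proof (rule imoct_eqI, goal_cases)
    case 1
    show ?case
      unfolding vec_eq_iff forall_3 oct_cross_coords inner_prod_def fst_conv snd_conv fst_diff snd_diff
        fst_scaleR snd_scaleR i e vector_add_component vector_minus_component vector_scaleR_component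
        real_scaleR_def inner_real_def
      by (intro conjI; algebra)
  next
    case 2
    show ?case
      unfolding vec_eq_iff forall_3 oct_cross_coords inner_prod_def fst_conv snd_conv fst_diff snd_diff
        fst_scaleR snd_scaleR i e vector_add_component vector_minus_component vector_scaleR_component
        real_scaleR_def inner_real_def
      by algebra
  next
    case 3
    show ?case
      unfolding vec_eq_iff forall_3 oct_cross_coords inner_prod_def fst_conv snd_conv fst_diff snd_diff
        fst_scaleR snd_scaleR i e vector_add_component vector_minus_component vector_scaleR_component
        real_scaleR_def inner_real_def
      by (intro conjI; algebra)
  qed
qed

lemma oct_cross_add_right: "x \<otimes> (y + y') = x \<otimes> y + x \<otimes> y'"
  by (metis oct_cross_add_left oct_cross_skew minus_add_distrib)

lemma oct_cross_scaleR_right: "x \<otimes> (c *\<^sub>R y) = c *\<^sub>R (x \<otimes> y)"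
  by (metis oct_cross_scaleR_left oct_cross_skew scaleR_minus_right)

lemma bounded_bilinear_oct_cross: "bounded_bilinear (\<otimes>)"
  by (simp add: bilinear_conv_bounded_bilinear[symmetric] bilinear_def linear_iff
      oct_cross_add_left oct_cross_add_right oct_cross_scaleR_left oct_cross_scaleR_right)

interpretation oct_cross: bounded_bilinear "(\<otimes>)"
  by (rule bounded_bilinear_oct_cross)

lemmas oct_cross_simps = oct_cross_add_left oct_cross_add_right oct_cross_scaleR_left
  oct_cross_scaleR_right oct_cross.minus_left oct_cross.minus_right oct_cross.diff_left
  oct_cross.diff_right oct_cross.zero_left oct_cross.zero_right

lemma oct_cross_self [simp]: "x \<otimes> x = 0"
  using oct_cross_skew[of x x] by (metis equation_minus_iff scaleR_half_double
      add.right_inverse scaleR_zero_right)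

lemma inner_oct_cross_self [simp]:
  "(x \<otimes> y) \<bullet> x = 0" "(x \<otimes> y) \<bullet> y = 0" "x \<bullet> (x \<otimes> y) = 0" "y \<bullet> (x \<otimes> y) = 0"
proof -
  show a: "(x \<otimes> y) \<bullet> x = 0" for x y
    using oct_cross_triple[of x y x] by simp
  show b: "(x \<otimes> y) \<bullet> y = 0" for x y
    using a[of y x] oct_cross_skew[of x y] by simp
  show "x \<bullet> (x \<otimes> y) = 0" "y \<bullet> (x \<otimes> y) = 0"
    using a b by (simp_all add: inner_commute)
qed

text \<open>Polarization of \<open>oct_cross_cross_self\<close>. For \<open>z\<close> orthogonal to
  \<open>x\<close> and \<open>y\<close> only the last term survives, so cross multiplication acts
  there as a Clifford action.\<close>

lemma oct_cross_clifford:
  "x \<otimes> (y \<otimes> z) + y \<otimes> (x \<otimes> z) = (x \<bullet> z) *\<^sub>R y + (y \<bullet> z) *\<^sub>R x - (2 * (x \<bullet> y)) *\<^sub>R z"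
  using oct_cross_cross_self[of "x + y" z] oct_cross_cross_self[of x z] oct_cross_cross_self[of y z]
  by (simp add: oct_cross_simps inner_simps algebra_simps inner_commute)

text \<open>Multiplication by \<open>x\<close> anticommutes with the cross product, up to multiples of \<open>x\<close>: this is the
  complex antilinearity of the torsion of the canonical connection.\<close>

lemma oct_cross_antilinear:
  assumes "x \<bullet> a = 0" "x \<bullet> b = 0"
  shows "(x \<otimes> a) \<otimes> b = - (x \<otimes> (a \<otimes> b)) - (a \<bullet> b) *\<^sub>R x"
    "a \<otimes> (x \<otimes> b) = - (x \<otimes> (a \<otimes> b)) + (a \<bullet> b) *\<^sub>R x"
proof -
  have 1: "a \<otimes> (x \<otimes> b) = - (x \<otimes> (a \<otimes> b)) + (a \<bullet> b) *\<^sub>R x"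
    if "x \<bullet> a = 0" "x \<bullet> b = 0" for a b
    using oct_cross_clifford[of a x b] that by (simp add: inner_commute algebra_simps)
  show "a \<otimes> (x \<otimes> b) = - (x \<otimes> (a \<otimes> b)) + (a \<bullet> b) *\<^sub>R x"
    by (rule 1 [OF assms])
  show "(x \<otimes> a) \<otimes> b = - (x \<otimes> (a \<otimes> b)) - (a \<bullet> b) *\<^sub>R x"
    using 1[of b a] assms oct_cross_skew[of "x \<otimes> a" b] oct_cross_skew[of a b]
    by (simp add: inner_commute oct_cross_simps)
qed

lemma oct_cross_unit:
  assumes "x \<bullet> x = 1" "x \<bullet> v = 0"
  shows "x \<otimes> (x \<otimes> v) = - v" "(x \<otimes> v) \<otimes> x = v"
  using oct_cross_cross_self[of x v] assms oct_cross_skew[of "x \<otimes> v" x] by simp_all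

lemma tproj_linear: "linear (tproj x)"
  by (simp add: linear_iff tproj_def inner_simps algebra_simps)

lemma tproj_eq [simp]: "v \<bullet> x = 0 \<Longrightarrow> tproj x v = v"
  by (simp add: tproj_def)

lemma oct_cross_tproj [simp]: "x \<otimes> tproj x v = x \<otimes> v"
  by (simp add: tproj_def oct_cross_simps)

lemma tproj_inner [simp]: "x \<bullet> x = 1 \<Longrightarrow> tproj x v \<bullet> x = 0"
  by (simp add: tproj_def inner_simps)

lemma S6_iff: "x \<in> S6 \<longleftrightarrow> x \<bullet> x = 1"
  by (simp add: S6_def norm_eq_1)

section \<open>Smooth maps\<close>

lemma has_derivative_frechet:
  "f differentiable (at x) \<Longrightarrow> (f has_derivative frechet_derivative f (at x)) (at x)"
  by (simp add: frechet_derivative_works)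

lemma frechet_derivativeI:
  "(f has_derivative f') (at x) \<Longrightarrow> frechet_derivative f (at x) v = f' v"
  using frechet_derivative_at by metis

lemma Ck_on_cong:
  assumes "open S" "\<And>x. x \<in> S \<Longrightarrow> f x = g x"
  shows "Ck_on k S f \<longleftrightarrow> Ck_on k S g"
  using assms(2)
proof (induction k arbitrary: f g)
  case 0
  then show ?case by (simp cong: continuous_on_cong)
next
  case (Suc k)
  have *: "Ck_on (Suc k) S g" if fg: "\<And>x. x \<in> S \<Longrightarrow> f x = g x" and f: "Ck_on (Suc k) S f"
    for f g :: "'a \<Rightarrow> 'b"
  proof -
    have diff: "g differentiable (at x)" and eq: "frechet_derivative f (at x) = frechet_derivative g (at x)"
      if "x \<in> S" for x
    proof -
      have fx: "f differentiable (at x)" using f that by simp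
      then show "g differentiable (at x)"
        by (meson assms(1) differentiable_def fg has_derivative_transform_within_open that)
      show "frechet_derivative f (at x) = frechet_derivative g (at x)"
        by (rule frechet_derivative_transform_within_open [OF fx assms(1) that fg])
    qed
    have "Ck_on k S (\<lambda>x. frechet_derivative g (at x) v)" for v
      using Suc.IH[of "\<lambda>x. frechet_derivative f (at x) v" "\<lambda>x. frechet_derivative g (at x) v"] eq f
      by simp
    with diff show ?thesis by simp
  qed
  show ?case
    using *[of f g] *[of g f] Suc.prems by metis
qed

lemma Ck_on_transform:
  assumes "open S" "Ck_on k S f" "\<And>x. x \<in> S \<Longrightarrow> g x = f x"
  shows "Ck_on k S g"
  using Ck_on_cong[of S f g k] assms by simp

lemma Ck_on_SucD: "Ck_on (Suc k) S f \<Longrightarrow> Ck_on k S f"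
proof (induction k arbitrary: f)
  case 0
  then show ?case
    by (auto intro!: continuous_at_imp_continuous_on simp: differentiable_imp_continuous_within)
next
  case (Suc k)
  then show ?case by (metis Ck_on.simps(2))
qed

lemma Ck_on_const: "Ck_on k S (\<lambda>x. c)"
  by (induction k arbitrary: c) auto

lemma Ck_on_add:
  assumes "open S" "Ck_on k S f" "Ck_on k S g"
  shows "Ck_on k S (\<lambda>x. f x + g x)"
  using assms(2,3)
proof (induction k arbitrary: f g)
  case 0
  then show ?case by (auto intro: continuous_on_add)
next
  case (Suc k)
  have "Ck_on k S (\<lambda>x. frechet_derivative (\<lambda>x. f x + g x) (at x) v)" for v
  proof -
    have "Ck_on k S (\<lambda>x. frechet_derivative f (at x) v + frechet_derivative g (at x) v)"
      using Suc.prems by (intro Suc.IH) auto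
    moreover have "frechet_derivative (\<lambda>x. f x + g x) (at x) v
        = frechet_derivative f (at x) v + frechet_derivative g (at x) v" if "x \<in> S" for x
      using Suc.prems that
      by (intro frechet_derivativeI has_derivative_add has_derivative_frechet) auto
    ultimately show ?thesis
      by (rule Ck_on_transform[OF assms(1)])
  qed
  with Suc.prems show ?case by auto
qed

lemma Ck_on_bounded_linear:
  assumes "open S" "bounded_linear L" "Ck_on k S f"
  shows "Ck_on k S (\<lambda>x. L (f x))"
  using assms(3)
proof (induction k arbitrary: f)
  case 0
  then show ?case by (auto intro: bounded_linear.continuous_on[OF assms(2)])
next
  case (Suc k)
  have D: "((\<lambda>x. L (f x)) has_derivative (\<lambda>v. L (frechet_derivative f (at x) v))) (at x)"
    if "x \<in> S" for x
    using Suc.prems that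
    by (intro bounded_linear.has_derivative[OF assms(2)] has_derivative_frechet) auto
  have "Ck_on k S (\<lambda>x. frechet_derivative (\<lambda>x. L (f x)) (at x) v)" for v
  proof -
    have "Ck_on k S (\<lambda>x. L (frechet_derivative f (at x) v))"
      using Suc.prems by (intro Suc.IH) auto
    then show ?thesis
      by (rule Ck_on_transform[OF assms(1)]) (simp add: frechet_derivativeI[OF D])
  qed
  with D show ?case by (auto simp: differentiable_def)
qed

lemma Ck_on_linear: "bounded_linear L \<Longrightarrow> Ck_on k S L"
proof (cases k)
  case 0
  assume "bounded_linear L"
  then show ?thesis
    by (simp add: 0 linear_continuous_on)
next
  case (Suc m)
  assume L: "bounded_linear L"
  have "frechet_derivative L (at x) v = L v" for x v
    by (rule frechet_derivativeI[OF bounded_linear.has_derivative[OF L has_derivative_ident]])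
  then show ?thesis
    using L by (simp add: Suc Ck_on_const bounded_linear_imp_differentiable)
qed

lemma Ck_on_bilinear:
  assumes "open S" "bounded_bilinear P" "Ck_on k S f" "Ck_on k S g"
  shows "Ck_on k S (\<lambda>x. P (f x) (g x))"
  using assms(3,4)
proof (induction k arbitrary: f g)
  case 0
  then show ?case by (auto intro: bounded_bilinear.continuous_on[OF assms(2)])
next
  case (Suc k)
  have D: "((\<lambda>x. P (f x) (g x)) has_derivative (\<lambda>v. P (f x) (frechet_derivative g (at x) v)
      + P (frechet_derivative f (at x) v) (g x))) (at x)"
    if "x \<in> S" for x
    using Suc.prems that
    by (intro bounded_bilinear.FDERIV[OF assms(2)] has_derivative_frechet) auto
  have "Ck_on k S (\<lambda>x. frechet_derivative (\<lambda>x. P (f x) (g x)) (at x) v)" for v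
  proof -
    have "Ck_on k S (\<lambda>x. P (f x) (frechet_derivative g (at x) v) + P (frechet_derivative f (at x) v) (g x))"
      using Suc.prems Ck_on_SucD[OF Suc.prems(1)] Ck_on_SucD[OF Suc.prems(2)]
      by (intro Ck_on_add[OF assms(1)] Suc.IH) auto
    then show ?thesis
      by (rule Ck_on_transform[OF assms(1)]) (simp add: frechet_derivativeI[OF D])
  qed
  with D show ?case by (auto simp: differentiable_def)
qed

text \<open>The derivative of \<open>1/|x|\<close> in direction \<open>v\<close> is
  \<open>-(x . v) / |x|^3\<close>, again a product of a linear function and powers of
  \<open>1/|x|\<close>, so the induction closes under \<open>Ck_on_bilinear\<close>. This yields
  smoothness of \<open>sgn\<close>.\<close>

lemma Ck_on_inverse_norm: "Ck_on k (- {0}) (\<lambda>x :: 'a::real_inner. inverse (norm x))"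
proof (induction k)
  case 0
  then show ?case by (auto intro!: continuous_intros)
next
  case (Suc k)
  have op: "open (- {0 :: 'a})" by auto
  have D: "((\<lambda>x. inverse (norm x)) has_derivative
      (\<lambda>v. (x \<bullet> v) * - (inverse (norm x) * (inverse (norm x) * inverse (norm x))))) (at x)"
    if "x \<noteq> 0" for x :: 'a
  proof -
    have "((\<lambda>x. inverse (norm x)) has_derivative
        (\<lambda>v. - (inverse (norm x) * (v \<bullet> sgn x) * inverse (norm x)))) (at x)"
      using that by (intro Deriv.has_derivative_inverse has_derivative_norm) auto
    then show ?thesis
      by (rule has_derivative_eq_rhs) (simp add: fun_eq_iff sgn_div_norm inner_commute divide_inverse)
  qed
  have "Ck_on k (- {0}) (\<lambda>x. frechet_derivative (\<lambda>x. inverse (norm x)) (at x) v)" for v :: 'a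
  proof -
    have "Ck_on k (- {0}) (\<lambda>x. (x \<bullet> v) * - (inverse (norm x) * (inverse (norm x) * inverse (norm x))))"
      by (intro Ck_on_bilinear[OF op bounded_bilinear_mult] Suc.IH Ck_on_linear bounded_linear_intros
          Ck_on_bounded_linear[OF op bounded_linear_minus[OF bounded_linear_ident]])
    then show ?thesis
      by (rule Ck_on_transform[OF op]) (simp add: frechet_derivativeI[OF D])
  qed
  with D show ?case by (auto simp: differentiable_def)
qed

lemma smooth_on_const: "smooth_on S (\<lambda>x. c)"
  by (simp add: smooth_on_def Ck_on_const)

lemma smooth_on_add:
  "open S \<Longrightarrow> smooth_on S f \<Longrightarrow> smooth_on S g \<Longrightarrow> smooth_on S (\<lambda>x. f x + g x)"
  by (simp add: smooth_on_def Ck_on_add)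

lemma smooth_on_bounded_linear:
  "open S \<Longrightarrow> bounded_linear L \<Longrightarrow> smooth_on S f \<Longrightarrow> smooth_on S (\<lambda>x. L (f x))"
  by (simp add: smooth_on_def Ck_on_bounded_linear)

lemma smooth_on_linear: "bounded_linear L \<Longrightarrow> smooth_on S L"
  by (simp add: smooth_on_def Ck_on_linear)

lemma smooth_on_bilinear:
  "open S \<Longrightarrow> bounded_bilinear P \<Longrightarrow> smooth_on S f \<Longrightarrow> smooth_on S g \<Longrightarrow> smooth_on S (\<lambda>x. P (f x) (g x))"
  by (simp add: smooth_on_def Ck_on_bilinear)

lemma smooth_on_diff:
  "open S \<Longrightarrow> smooth_on S f \<Longrightarrow> smooth_on S g \<Longrightarrow> smooth_on S (\<lambda>x. f x - g x)"
  using smooth_on_add[of S f "\<lambda>x. - g x"]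
    smooth_on_bounded_linear[OF _ bounded_linear_minus[OF bounded_linear_ident], of S g]
  by simp

lemma smooth_on_cong:
  "open S \<Longrightarrow> (\<And>x. x \<in> S \<Longrightarrow> f x = g x) \<Longrightarrow> smooth_on S f \<longleftrightarrow> smooth_on S g"
  unfolding smooth_on_def using Ck_on_cong by metis

lemma smooth_on_differentiable: "smooth_on S f \<Longrightarrow> x \<in> S \<Longrightarrow> f differentiable (at x)"
  unfolding smooth_on_def using Ck_on.simps(2) by metis

lemma smooth_on_frechet: "smooth_on S f \<Longrightarrow> smooth_on S (\<lambda>x. frechet_derivative f (at x) v)"
  unfolding smooth_on_def using Ck_on.simps(2) by metis

lemma smooth_on_continuous_on: "smooth_on S f \<Longrightarrow> continuous_on S f"
  unfolding smooth_on_def using Ck_on.simps(1) by metis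

lemma smooth_on_sgn: "smooth_on (- {0}) (sgn :: 'a::real_inner \<Rightarrow> 'a)"
proof -
  have "smooth_on (- {0}) (\<lambda>x :: 'a. inverse (norm x) *\<^sub>R x)"
    by (rule smooth_on_bilinear[OF _ bounded_bilinear_scaleR _ smooth_on_linear[OF bounded_linear_ident]])
       (auto simp: smooth_on_def Ck_on_inverse_norm)
  then show ?thesis
    by (simp add: sgn_div_norm[abs_def] divide_inverse)
qed

section \<open>Symmetry of second derivatives\<close>

lemma second_difference_mvt:
  fixes g :: "'a::real_normed_vector \<Rightarrow> real"
  assumes g: "smooth_on UNIV g" and h: "h > 0"
  shows "\<exists>t s. 0 < t \<and> t < h \<and> 0 < s \<and> s < h \<and>
     g (z + h *\<^sub>R v + h *\<^sub>R w) - g (z + h *\<^sub>R v) - g (z + h *\<^sub>R w) + g z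
      = h * (h * frechet_derivative (\<lambda>x. frechet_derivative g (at x) v) (at (z + t *\<^sub>R v + s *\<^sub>R w)) w)"
proof -
  define gv where "gv x = frechet_derivative g (at x) v" for x
  have dg: "(g has_derivative frechet_derivative g (at x)) (at x)" for x
    using smooth_on_differentiable[OF g] by (simp add: has_derivative_frechet)
  have dgv: "(gv has_derivative frechet_derivative gv (at x)) (at x)" for x
    unfolding gv_def
    using smooth_on_differentiable[OF smooth_on_frechet[OF g]] by (simp add: has_derivative_frechet)
  have D: "((\<lambda>t. k (a + t *\<^sub>R b)) has_real_derivative frechet_derivative k (at (a + t *\<^sub>R b)) b) (at t)"
    if "\<And>x. (k has_derivative frechet_derivative k (at x)) (at x)" for k :: "'a \<Rightarrow> real" and a b t
  proof -
    have "((\<lambda>t. a + t *\<^sub>R b) has_derivative (\<lambda>r. r *\<^sub>R b)) (at t)"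
      by (auto intro!: derivative_eq_intros)
    from has_derivative_compose[OF this that]
    have "((\<lambda>t. k (a + t *\<^sub>R b)) has_derivative (\<lambda>r. frechet_derivative k (at (a + t *\<^sub>R b)) (r *\<^sub>R b))) (at t)" .
    moreover have "frechet_derivative k (at (a + t *\<^sub>R b)) (r *\<^sub>R b)
        = frechet_derivative k (at (a + t *\<^sub>R b)) b * r" for r
      using linear_cmul[OF has_derivative_linear[OF that]] by simp
    ultimately show ?thesis
      by (simp add: has_field_derivative_def mult_commute_abs)
  qed
  \<comment> \<open>The mean value theorem is applied to the difference of \<open>g\<close> along
    two parallel segments in direction \<open>v\<close>, then to the resulting increment of
    \<open>gv\<close> in direction \<open>w\<close>. Exchanging \<open>v\<close> and
    \<open>w\<close> expresses the same second difference by the other mixed derivative at a nearby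
    point.\<close>
  have "((\<lambda>t. g (z + h *\<^sub>R w + t *\<^sub>R v) - g (z + t *\<^sub>R v)) has_real_derivative
      gv (z + h *\<^sub>R w + t *\<^sub>R v) - gv (z + t *\<^sub>R v)) (at t)" for t
    unfolding gv_def by (intro DERIV_diff D dg)
  from MVT2[OF h this] obtain t where t: "0 < t" "t < h" and
    1: "(g (z + h *\<^sub>R w + h *\<^sub>R v) - g (z + h *\<^sub>R v)) - (g (z + h *\<^sub>R w + 0 *\<^sub>R v) - g (z + 0 *\<^sub>R v))
       = (h - 0) * (gv (z + h *\<^sub>R w + t *\<^sub>R v) - gv (z + t *\<^sub>R v))"
    by blast
  have "((\<lambda>s. gv (z + t *\<^sub>R v + s *\<^sub>R w)) has_real_derivative
      frechet_derivative gv (at (z + t *\<^sub>R v + s *\<^sub>R w)) w) (at s)" for s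
    by (intro D dgv)
  from MVT2[OF h this] obtain s where s: "0 < s" "s < h" and
    2: "gv (z + t *\<^sub>R v + h *\<^sub>R w) - gv (z + t *\<^sub>R v + 0 *\<^sub>R w)
       = (h - 0) * frechet_derivative gv (at (z + t *\<^sub>R v + s *\<^sub>R w)) w"
    by blast
  have "g (z + h *\<^sub>R v + h *\<^sub>R w) - g (z + h *\<^sub>R v) - g (z + h *\<^sub>R w) + g z
      = h * (h * frechet_derivative gv (at (z + t *\<^sub>R v + s *\<^sub>R w)) w)"
    using 1 2 by (simp add: algebra_simps)
  with t s show ?thesis
    unfolding gv_def by blast
qed

lemma mixed_partials_commute_real:
  fixes g :: "'a::real_normed_vector \<Rightarrow> real"
  assumes g: "smooth_on UNIV g"
  shows "frechet_derivative (\<lambda>x. frechet_derivative g (at x) v) (at z) w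
       = frechet_derivative (\<lambda>x. frechet_derivative g (at x) w) (at z) v"
proof (rule ccontr)
  define P where "P x = frechet_derivative (\<lambda>x. frechet_derivative g (at x) v) (at x) w" for x
  define Q where "Q x = frechet_derivative (\<lambda>x. frechet_derivative g (at x) w) (at x) v" for x
  assume "\<not> ?thesis"
  then have ne: "dist (P z) (Q z) / 2 > 0" by (simp add: P_def Q_def)
  have cont: "isCont P z" "isCont Q z"
    using smooth_on_continuous_on[OF smooth_on_frechet[OF smooth_on_frechet[OF g]]]
    by (auto simp: P_def[abs_def] Q_def[abs_def] continuous_on_eq_continuous_at)
  obtain d1 where d1: "d1 > 0" "\<And>x. dist x z < d1 \<Longrightarrow> dist (P x) (P z) < dist (P z) (Q z) / 2"
    using cont(1) ne unfolding continuous_at_eps_delta by blast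
  obtain d2 where d2: "d2 > 0" "\<And>x. dist x z < d2 \<Longrightarrow> dist (Q x) (Q z) < dist (P z) (Q z) / 2"
    using cont(2) ne unfolding continuous_at_eps_delta by blast
  \<comment> \<open>With this \<open>h\<close> the parallelogram spanned by \<open>h v\<close> and
    \<open>h w\<close> stays in the ball of radius \<open>min d1 d2\<close>; the summand 1 avoids
    division by zero and makes the inclusion strict.\<close>
  define h where "h = min d1 d2 / (norm v + norm w + 1)"
  have nn: "norm v + norm w + 1 > 0"
    by (simp add: add_nonneg_pos)
  have h: "h > 0" using d1 d2 nn by (simp add: h_def)
  have hh: "h * (norm v + norm w + 1) = min d1 d2"
    unfolding h_def using nn by simp
  have close: "dist (z + t *\<^sub>R v + s *\<^sub>R w) z < min d1 d2"
    if "0 < t" "t < h" "0 < s" "s < h" for t s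
  proof -
    have "dist (z + t *\<^sub>R v + s *\<^sub>R w) z \<le> t * norm v + s * norm w"
      using norm_triangle_ineq[of "t *\<^sub>R v" "s *\<^sub>R w"] that by (simp add: dist_norm add.assoc)
    also have "\<dots> \<le> h * norm v + h * norm w"
      using that by (intro add_mono mult_right_mono) auto
    also have "\<dots> = min d1 d2 - h"
      using hh by (simp only: distrib_left mult_1_right flip: hh)
    also have "\<dots> < min d1 d2"
      using h by linarith
    finally show ?thesis .
  qed
  obtain t s where ts: "0 < t" "t < h" "0 < s" "s < h"
    "g (z + h *\<^sub>R v + h *\<^sub>R w) - g (z + h *\<^sub>R v) - g (z + h *\<^sub>R w) + g z
      = h * (h * P (z + t *\<^sub>R v + s *\<^sub>R w))"
    using second_difference_mvt[OF g h, of z v w] unfolding P_def by blast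
  obtain t' s' where ts': "0 < t'" "t' < h" "0 < s'" "s' < h"
    "g (z + h *\<^sub>R w + h *\<^sub>R v) - g (z + h *\<^sub>R w) - g (z + h *\<^sub>R v) + g z
      = h * (h * Q (z + t' *\<^sub>R w + s' *\<^sub>R v))"
    using second_difference_mvt[OF g h, of z w v] unfolding Q_def by blast
  have "g (z + h *\<^sub>R w + h *\<^sub>R v) = g (z + h *\<^sub>R v + h *\<^sub>R w)"
    by (simp add: add_ac)
  then have "h * (h * P (z + t *\<^sub>R v + s *\<^sub>R w)) = h * (h * Q (z + t' *\<^sub>R w + s' *\<^sub>R v))"
    using ts(5) ts'(5) by linarith
  then have eq: "P (z + t *\<^sub>R v + s *\<^sub>R w) = Q (z + s' *\<^sub>R v + t' *\<^sub>R w)"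
    using h by (simp add: add_ac)
  have "dist (P (z + t *\<^sub>R v + s *\<^sub>R w)) (P z) < dist (P z) (Q z) / 2"
    using close[OF ts(1-4)] by (intro d1) simp
  moreover have "dist (P (z + t *\<^sub>R v + s *\<^sub>R w)) (Q z) < dist (P z) (Q z) / 2"
    unfolding eq using close[OF ts'(3,4,1,2)] by (intro d2) simp
  ultimately show False
    using dist_triangle_half_r[of "P (z + t *\<^sub>R v + s *\<^sub>R w)" "P z" "dist (P z) (Q z)" "Q z"]
    by simp
qed

lemma mixed_partials_commute:
  fixes f :: "'a::real_normed_vector \<Rightarrow> 'b::real_inner"
  assumes f: "smooth_on UNIV f"
  shows "frechet_derivative (\<lambda>x. frechet_derivative f (at x) v) (at z) w
       = frechet_derivative (\<lambda>x. frechet_derivative f (at x) w) (at z) v"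
proof -
  have inner: "frechet_derivative (\<lambda>x. k x \<bullet> b) (at x) v = frechet_derivative k (at x) v \<bullet> b"
    if "smooth_on UNIV k" for k :: "'a \<Rightarrow> 'b" and b x v
    by (intro frechet_derivativeI has_derivative_inner_left has_derivative_frechet
        smooth_on_differentiable[OF that] UNIV_I)
  have "frechet_derivative (\<lambda>x. frechet_derivative f (at x) v) (at z) w \<bullet> b
       = frechet_derivative (\<lambda>x. frechet_derivative f (at x) w) (at z) v \<bullet> b" for b
  proof -
    have "smooth_on UNIV (\<lambda>x. f x \<bullet> b)"
      using f by (rule smooth_on_bounded_linear[OF open_UNIV bounded_linear_inner_left])
    from mixed_partials_commute_real[OF this, of v z w] show ?thesis
      by (simp add: inner f smooth_on_frechet[OF f])
  qed
  then have "\<forall>b. b \<bullet> frechet_derivative (\<lambda>x. frechet_derivative f (at x) v) (at z) w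
      = b \<bullet> frechet_derivative (\<lambda>x. frechet_derivative f (at x) w) (at z) v"
    by (simp only: inner_commute) simp
  then show ?thesis
    unfolding vector_eq_ldot .
qed

section \<open>The linearized operator\<close>

lemma sgn_has_derivative_tproj:
  assumes "x \<in> S6"
  shows "(sgn has_derivative tproj x) (at x)"
proof -
  have x: "norm x = 1" "x \<noteq> 0" using assms by (auto simp: S6_def)
  have i: "((\<lambda>y. inverse (norm y)) has_derivative
        (\<lambda>v. - (inverse (norm x) * (v \<bullet> sgn x) * inverse (norm x)))) (at x)"
    by (rule Deriv.has_derivative_inverse[OF _ has_derivative_norm]) (use x in auto)
  have sx: "sgn x = x" by (simp only: sgn_div_norm x inverse_1 scaleR_one)
  have "((\<lambda>y. inverse (norm y) *\<^sub>R y) has_derivative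
        (\<lambda>v. inverse (norm x) *\<^sub>R v + (- (inverse (norm x) * (v \<bullet> sgn x) * inverse (norm x))) *\<^sub>R x)) (at x)"
    by (rule bounded_bilinear.FDERIV[OF bounded_bilinear_scaleR i has_derivative_ident])
  also have "(\<lambda>v. inverse (norm x) *\<^sub>R v + (- (inverse (norm x) * (v \<bullet> sgn x) * inverse (norm x))) *\<^sub>R x)
      = tproj x"
    by (rule ext) (simp only: sx x tproj_def inverse_1 mult_1_left mult_1_right scaleR_one
        scaleR_minus_left add_uminus_conv_diff)
  also have "(\<lambda>y :: imoct. inverse (norm y) *\<^sub>R y) = sgn"
    by (rule ext) (rule sgn_div_norm[symmetric])
  finally show ?thesis .
qed

lemma S6_sgn: "x \<in> S6 \<Longrightarrow> sgn x = x"
  by (simp only: S6_def mem_sphere_0 sgn_div_norm inverse_1 scaleR_one)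

text \<open>Extending along \<open>sgn\<close> composes the derivative with the tangential
  projection, which fixes \<open>v\<close>; so an ambient derivative, when there is one, computes
  \<open>dS6\<close>.\<close>

lemma dS6_eq:
  assumes "x \<in> S6" "v \<in> TS6 x" "(f has_derivative f') (at x)"
  shows "dS6 f x v = f' v"
proof -
  have "((\<lambda>y. f (sgn y)) has_derivative (\<lambda>v. f' (tproj x v))) (at x)"
    using has_derivative_compose[OF sgn_has_derivative_tproj[OF assms(1)], of f f'] assms
    by (simp add: S6_sgn)
  then show ?thesis
    using assms(2) unfolding dS6_def by (simp add: frechet_derivativeI TS6_def)
qed

lemma smooth_S6_const: "smooth_S6 (\<lambda>y. c)"
  by (simp add: smooth_S6_def smooth_on_const)

lemma smooth_S6_ident: "smooth_S6 (\<lambda>y. y)"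
  by (simp add: smooth_S6_def smooth_on_sgn)

lemma smooth_S6_add: "smooth_S6 f \<Longrightarrow> smooth_S6 g \<Longrightarrow> smooth_S6 (\<lambda>y. f y + g y)"
  by (simp add: smooth_S6_def smooth_on_add open_Compl)

lemma smooth_S6_diff: "smooth_S6 f \<Longrightarrow> smooth_S6 g \<Longrightarrow> smooth_S6 (\<lambda>y. f y - g y)"
  by (simp add: smooth_S6_def smooth_on_diff open_Compl)

lemma smooth_S6_bilinear:
  "bounded_bilinear P \<Longrightarrow> smooth_S6 f \<Longrightarrow> smooth_S6 g \<Longrightarrow> smooth_S6 (\<lambda>y. P (f y) (g y))"
  unfolding smooth_S6_def by (rule smooth_on_bilinear) auto

lemma smooth_S6_tproj: "smooth_S6 (\<lambda>y. tproj y b)"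
  unfolding tproj_def
  by (intro smooth_S6_diff smooth_S6_const smooth_S6_bilinear[OF bounded_bilinear_scaleR]
      smooth_S6_bilinear[OF bounded_bilinear_inner] smooth_S6_ident)

lemma sgn_S6: "y \<noteq> 0 \<Longrightarrow> sgn y \<in> S6"
  by (simp add: S6_def norm_sgn)

lemma smooth_S6_cong: "(\<And>x. x \<in> S6 \<Longrightarrow> f x = g x) \<Longrightarrow> smooth_S6 f \<longleftrightarrow> smooth_S6 g"
  unfolding smooth_S6_def by (rule smooth_on_cong) (auto simp: sgn_S6)

lemma dS6_inner:
  assumes "smooth_S6 X" "x \<in> S6"
  shows "dS6 (\<lambda>y. X y \<bullet> b) x v = dS6 X x v \<bullet> b"
proof -
  have "(\<lambda>y. X (sgn y)) differentiable (at x)"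
    using assms by (auto simp: smooth_S6_def S6_def intro: smooth_on_differentiable)
  then show ?thesis
    unfolding dS6_def
    by (intro frechet_derivativeI has_derivative_inner_left has_derivative_frechet)
qed

lemma vector_field_tproj: "vector_field (\<lambda>y. tproj y b)"
  by (simp add: vector_field_def smooth_S6_tproj TS6_def S6_iff)

lemma vector_field_add: "vector_field X \<Longrightarrow> vector_field Y \<Longrightarrow> vector_field (\<lambda>y. X y + Y y)"
  by (simp add: vector_field_def smooth_S6_add TS6_def inner_simps)

lemma vector_field_scale:
  "smooth_S6 f \<Longrightarrow> vector_field X \<Longrightarrow> vector_field (\<lambda>y. f y *\<^sub>R X y)"
  by (simp add: vector_field_def smooth_S6_bilinear[OF bounded_bilinear_scaleR] TS6_def)

lemma vector_field_0: "vector_field (\<lambda>y. 0)"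
  by (simp add: vector_field_def smooth_S6_const TS6_def)

lemma vector_field_J0: "vector_field X \<Longrightarrow> vector_field (\<lambda>y. J0 y (X y))"
  unfolding vector_field_def J0_def
  by (simp add: smooth_S6_bilinear[OF bounded_bilinear_oct_cross smooth_S6_ident] TS6_def)

lemma vector_field_sum:
  "finite B \<Longrightarrow> (\<And>b. b \<in> B \<Longrightarrow> vector_field (X b)) \<Longrightarrow> vector_field (\<lambda>y. \<Sum>b\<in>B. X b y)"
  by (induction B rule: finite_induct) (auto simp: vector_field_0 intro: vector_field_add)

text \<open>The projected basis vectors play the part of a frame of the tangent bundle: redundant,
  but global and given by a formula.\<close>

lemma tproj_expand: "tproj x a = (\<Sum>b\<in>Basis. (a \<bullet> b) *\<^sub>R tproj x b)"
proof -
  have "tproj x a = tproj x (\<Sum>b\<in>Basis. (a \<bullet> b) *\<^sub>R b)"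
    by (simp add: euclidean_representation)
  then show ?thesis
    by (simp add: linear_sum[OF tproj_linear] linear_cmul[OF tproj_linear])
qed

section \<open>Connections preserving the almost complex structure\<close>

locale J0_connection =
  fixes nabla :: connection
  assumes connection: "is_connection nabla" and J0_parallel: "preserves_J0 nabla"
begin

lemma nabla_add:
  assumes "vector_field X" "vector_field Y" "x \<in> S6" "v \<in> TS6 x"
  shows "nabla (\<lambda>y. X y + Y y) x v = nabla X x v + nabla Y x v"
proof -
  from connection have "\<forall>X Y. vector_field X \<longrightarrow> vector_field Y \<longrightarrow> (\<forall>x\<in>S6. \<forall>v\<in>TS6 x.
        nabla (\<lambda>y. X y + Y y) x v = nabla X x v + nabla Y x v)"
    unfolding is_connection_def by (elim conjE)
  with assms show ?thesis by simp
qed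

lemma nabla_Leibniz:
  assumes "smooth_S6 (f :: imoct \<Rightarrow> real)" "vector_field X" "x \<in> S6" "v \<in> TS6 x"
  shows "nabla (\<lambda>y. f y *\<^sub>R X y) x v = dS6 f x v *\<^sub>R X x + f x *\<^sub>R nabla X x v"
proof -
  from connection have "\<forall>(f :: imoct \<Rightarrow> real) X. smooth_S6 f \<longrightarrow> vector_field X \<longrightarrow>
      (\<forall>x\<in>S6. \<forall>v\<in>TS6 x. nabla (\<lambda>y. f y *\<^sub>R X y) x v = dS6 f x v *\<^sub>R X x + f x *\<^sub>R nabla X x v)"
    unfolding is_connection_def by (elim conjE)
  with assms show ?thesis by simp
qed

lemma nabla_0: "x \<in> S6 \<Longrightarrow> v \<in> TS6 x \<Longrightarrow> nabla (\<lambda>y. 0) x v = 0"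
  using nabla_add[OF vector_field_0 vector_field_0] by simp

text \<open>A covariant derivative depends only on the values on the sphere: multiply by the indicator
  function of \<open>S6\<close>, which is smooth because only its restriction to \<open>S6\<close> counts.\<close>

lemma nabla_cong:
  assumes X: "vector_field X" "vector_field Y" and eq: "\<And>y. y \<in> S6 \<Longrightarrow> X y = Y y"
    and x: "x \<in> S6" "v \<in> TS6 x"
  shows "nabla X x v = nabla Y x v"
proof -
  define f :: "imoct \<Rightarrow> real" where "f y = (if y \<in> S6 then 1 else 0)" for y
  have f: "smooth_S6 f"
    by (rule iffD2[OF smooth_S6_cong smooth_S6_const[of 1]]) (simp add: f_def)
  have *: "nabla (\<lambda>y. f y *\<^sub>R Z y) x v = nabla Z x v" if "vector_field Z" for Z
  proof -
    have "f (sgn y) = 1" if "y \<in> - {0}" for y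
      using that by (simp add: f_def sgn_S6)
    have "((\<lambda>y. f (sgn y)) has_derivative (\<lambda>v. 0)) (at x)"
      by (rule has_derivative_transform_within_open[where f = "\<lambda>y. 1" and s = "- {0}"])
        (use x in \<open>auto simp: S6_def \<open>\<And>y. y \<in> - {0} \<Longrightarrow> f (sgn y) = 1\<close>\<close>)
    then have "dS6 f x v = 0"
      by (simp add: dS6_def frechet_derivativeI)
    then show ?thesis
      using nabla_Leibniz[OF f that x] x by (simp add: f_def)
  qed
  have "(\<lambda>y. f y *\<^sub>R X y) = (\<lambda>y. f y *\<^sub>R Y y)"
    using eq by (auto simp: f_def)
  then show ?thesis
    using *[OF X(1)] *[OF X(2)] by simp
qed

lemma nabla_sum:
  assumes "finite B" "\<And>b. b \<in> B \<Longrightarrow> vector_field (X b)" "x \<in> S6" "v \<in> TS6 x"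
  shows "nabla (\<lambda>y. \<Sum>b\<in>B. X b y) x v = (\<Sum>b\<in>B. nabla (X b) x v)"
  using assms
proof (induction B rule: finite_induct)
  case empty
  then show ?case by (simp add: nabla_0)
next
  case (insert b B)
  then show ?case
    by (simp add: nabla_add vector_field_sum)
qed

text \<open>The Leibniz rule on the expansion into projected basis fields: every connection is the
  projected derivative plus a term that sees only the value \<open>X x\<close>. Hence all
  connections agree on fields that vanish at \<open>x\<close>.\<close>

lemma nabla_expand:
  assumes X: "vector_field X" and x: "x \<in> S6" "v \<in> TS6 x"
  shows "nabla X x v = tproj x (dS6 X x v)
    + (\<Sum>b\<in>Basis. (X x \<bullet> b) *\<^sub>R nabla (\<lambda>y. tproj y b) x v)"
proof -
  have sm: "smooth_S6 X" using X by (simp add: vector_field_def)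
  have smb: "smooth_S6 (\<lambda>y. X y \<bullet> b)" for b
    by (rule smooth_S6_bilinear[OF bounded_bilinear_inner sm smooth_S6_const])
  have vf: "vector_field (\<lambda>y. (X y \<bullet> b) *\<^sub>R tproj y b)" for b
    by (intro vector_field_scale smb vector_field_tproj)
  have "nabla X x v = nabla (\<lambda>y. \<Sum>b\<in>Basis. (X y \<bullet> b) *\<^sub>R tproj y b) x v"
  proof (rule nabla_cong[OF X _ _ x])
    show "vector_field (\<lambda>y. \<Sum>b\<in>Basis. (X y \<bullet> b) *\<^sub>R tproj y b)"
      by (intro vector_field_sum vf) auto
    show "X y = (\<Sum>b\<in>Basis. (X y \<bullet> b) *\<^sub>R tproj y b)" if "y \<in> S6" for y
      using X that unfolding tproj_expand[symmetric] by (simp add: vector_field_def TS6_def)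
  qed
  also have "\<dots> = (\<Sum>b\<in>Basis. (dS6 X x v \<bullet> b) *\<^sub>R tproj x b + (X x \<bullet> b) *\<^sub>R nabla (\<lambda>y. tproj y b) x v)"
    by (subst nabla_sum[OF finite_Basis vf x])
       (simp add: nabla_Leibniz[OF smb vector_field_tproj x] dS6_inner[OF sm x(1)])
  finally show ?thesis
    by (simp add: sum.distrib flip: tproj_expand)
qed

lemma nabla_tproj_expand:
  assumes x: "x \<in> S6" "v \<in> TS6 x"
  shows "nabla (\<lambda>y. tproj y a) x v = (\<Sum>b\<in>Basis. (a \<bullet> b) *\<^sub>R nabla (\<lambda>y. tproj y b) x v)"
proof -
  have "nabla (\<lambda>y. tproj y a) x v = nabla (\<lambda>y. \<Sum>b\<in>Basis. (a \<bullet> b) *\<^sub>R tproj y b) x v"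
    by (simp flip: tproj_expand)
  also have "\<dots> = (\<Sum>b\<in>Basis. nabla (\<lambda>y. (a \<bullet> b) *\<^sub>R tproj y b) x v)"
    by (intro nabla_sum vector_field_scale smooth_S6_const vector_field_tproj x finite_Basis)
  also have "\<dots> = (\<Sum>b\<in>Basis. (a \<bullet> b) *\<^sub>R nabla (\<lambda>y. tproj y b) x v)"
    by (intro sum.cong refl)
       (subst nabla_Leibniz[OF smooth_S6_const vector_field_tproj x], simp add: dS6_def)
  finally show ?thesis .
qed

lemma nabla_vanishing:
  assumes "vector_field X" "x \<in> S6" "v \<in> TS6 x" "X x = 0"
  shows "nabla X x v = tproj x (dS6 X x v)"
  using nabla_expand[OF assms(1-3)] assms(4) by simp

lemma nabla_J0:
  "vector_field X \<Longrightarrow> x \<in> S6 \<Longrightarrow> v \<in> TS6 x \<Longrightarrow> nabla (\<lambda>y. J0 y (X y)) x v = J0 x (nabla X x v)"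
  using J0_parallel by (simp add: preserves_J0_def)

text \<open>For tangent \<open>c\<close> the derivative of \<open>tproj y c\<close> at
  \<open>x\<close> in a tangent direction \<open>v\<close> is \<open>-(c . v) x\<close>, which is
  symmetric in \<open>c\<close> and \<open>v\<close>. The torsion thus reduces to two covariant
  derivatives.\<close>

lemma lie_bracket_tproj:
  assumes "x \<in> S6" "a \<in> TS6 x" "b \<in> TS6 x"
  shows "lie_bracket (\<lambda>y. tproj y a) (\<lambda>y. tproj y b) x = 0"
proof -
  have D: "((\<lambda>y. tproj y c) has_derivative (\<lambda>v. - ((c \<bullet> x) *\<^sub>R v + (c \<bullet> v) *\<^sub>R x))) (at x)" for c
    unfolding tproj_def by (auto intro!: derivative_eq_intros)
  show ?thesis
    using assms by (simp add: lie_bracket_def dS6_eq[OF _ _ D] TS6_def) (simp add: inner_commute)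
qed

text \<open>The field \<open>tproj y U + J0 y (tproj y (x \<otimes> U))\<close> vanishes at
  \<open>x\<close> because \<open>J0 x\<close> squares to -1 on tangent vectors. Its covariant
  derivative is therefore a projected ordinary derivative, to which only the dependence of
  \<open>J0 y\<close> on \<open>y\<close> contributes.\<close>

lemma nabla_J0_derivative:
  assumes x: "x \<in> S6" and a: "a \<in> TS6 x" and U: "U \<in> TS6 x"
  shows "nabla (\<lambda>y. tproj y U) x a + J0 x (nabla (\<lambda>y. tproj y (x \<otimes> U)) x a)
    = tproj x (a \<otimes> (x \<otimes> U))"
proof -
  define V where "V = x \<otimes> U"
  have V: "V \<in> TS6 x" by (simp add: V_def TS6_def)
  have vf: "vector_field (\<lambda>y. tproj y U)" "vector_field (\<lambda>y. J0 y (tproj y V))"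
    by (intro vector_field_tproj vector_field_J0)+
  have "nabla (\<lambda>y. tproj y U) x a + J0 x (nabla (\<lambda>y. tproj y V) x a)
      = nabla (\<lambda>y. tproj y U + J0 y (tproj y V)) x a"
    by (simp add: nabla_add[OF vf x a] nabla_J0[OF vector_field_tproj x a])
  also have "\<dots> = tproj x (dS6 (\<lambda>y. tproj y U + J0 y (tproj y V)) x a)"
  proof (rule nabla_vanishing[OF vector_field_add[OF vf] x a])
    show "tproj x U + J0 x (tproj x V) = 0"
      using x U by (simp add: J0_def V_def oct_cross_unit S6_iff TS6_def inner_commute)
  qed
  also have "dS6 (\<lambda>y. tproj y U + J0 y (tproj y V)) x a = - ((U \<bullet> x) *\<^sub>R a + (U \<bullet> a) *\<^sub>R x) + a \<otimes> V"
  proof (rule dS6_eq[OF x a])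
    show "((\<lambda>y. tproj y U + J0 y (tproj y V)) has_derivative
        (\<lambda>a. - ((U \<bullet> x) *\<^sub>R a + (U \<bullet> a) *\<^sub>R x) + a \<otimes> V)) (at x)"
      unfolding J0_def oct_cross_tproj unfolding tproj_def
      by (auto intro!: derivative_eq_intros bounded_linear.has_derivative[OF oct_cross.bounded_linear_left])
  qed
  also have "tproj x (- ((U \<bullet> x) *\<^sub>R a + (U \<bullet> a) *\<^sub>R x) + a \<otimes> V) = tproj x (a \<otimes> V)"
    using x U by (simp add: tproj_def TS6_def S6_iff inner_simps algebra_simps)
  finally show ?thesis unfolding V_def .
qed

lemma torsion_eq:
  assumes "x \<in> S6" "a \<in> TS6 x" "b \<in> TS6 x"
  shows "torsion nabla x a b = nabla (\<lambda>y. tproj y b) x a - nabla (\<lambda>y. tproj y a) x b"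
  by (simp add: torsion_def lie_bracket_tproj[OF assms])

text \<open>The sum over the basis reassembles: its first half is the projected derivative, its
  second half is \<open>nabla\<close> applied to the single field that extends the value of
  \<open>\<xi>\<close> at the point.\<close>

lemma pullback_connection_eq:
  assumes \<xi>: "(\<lambda>w. \<xi> (\<phi> w)) differentiable (at z)"
    and x: "u (\<phi> z) \<in> S6" "dCP1 u \<phi> z Y \<in> TS6 (u (\<phi> z))"
  shows "pullback_connection nabla u \<xi> \<phi> z Y = tproj (u (\<phi> z)) (dCP1 \<xi> \<phi> z Y)
    + nabla (\<lambda>y. tproj y (\<xi> (\<phi> z))) (u (\<phi> z)) (dCP1 u \<phi> z Y)"
proof -
  have "dCP1 (\<lambda>p. \<xi> p \<bullet> b) \<phi> z Y = dCP1 \<xi> \<phi> z Y \<bullet> b" for b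
    unfolding dCP1_def
    by (intro frechet_derivativeI has_derivative_inner_left has_derivative_frechet \<xi>)
  then show ?thesis
    by (simp add: pullback_connection_def sum.distrib nabla_tproj_expand[OF x, of "\<xi> (\<phi> z)"]
        flip: tproj_expand)
qed

text \<open>The connection terms in \<open>D\<close> cancel against the torsion, except for the derivative of a field
  \<open>U + J\<^sub>0 (J\<^sub>0 U)\<close> vanishing at \<open>x\<close>; there any connection is the projected derivative. Hence \<open>D\<close>
  does not depend on the connection.\<close>

lemma D_op_eq:
  assumes \<xi>: "(\<lambda>w. \<xi> (\<phi> w)) differentiable (at z)" "\<xi> (\<phi> z) \<in> TS6 (u (\<phi> z))"
    and x: "u (\<phi> z) \<in> S6" "dCP1 u \<phi> z Y \<in> TS6 (u (\<phi> z))"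
    and J: "dCP1 u \<phi> z (\<i> * Y) = u (\<phi> z) \<otimes> dCP1 u \<phi> z Y"
  shows "D_op nabla u \<xi> \<phi> z Y = (1/2) *\<^sub>R (tproj (u (\<phi> z)) (dCP1 \<xi> \<phi> z Y)
    + u (\<phi> z) \<otimes> dCP1 \<xi> \<phi> z (\<i> * Y)
    + tproj (u (\<phi> z)) (\<xi> (\<phi> z) \<otimes> dCP1 u \<phi> z (\<i> * Y)))"
proof -
  define x where "x = u (\<phi> z)"
  define a where "a = \<xi> (\<phi> z)"
  define U where "U = dCP1 u \<phi> z Y"
  define V where "V = x \<otimes> U"
  have V: "V \<in> TS6 x" by (simp add: V_def TS6_def)
  have xa: "x \<in> S6" "a \<in> TS6 x" "U \<in> TS6 x"
    using \<xi> x by (simp_all add: x_def a_def U_def)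
  have JV: "dCP1 u \<phi> z (\<i> * Y) = V" using J by (simp add: V_def U_def x_def)
  have "pullback_connection nabla u \<xi> \<phi> z Y = tproj x (dCP1 \<xi> \<phi> z Y) + nabla (\<lambda>y. tproj y a) x U"
    using pullback_connection_eq[OF \<xi>(1) x] by (simp add: x_def a_def U_def)
  moreover have "pullback_connection nabla u \<xi> \<phi> z (\<i> * Y)
      = tproj x (dCP1 \<xi> \<phi> z (\<i> * Y)) + nabla (\<lambda>y. tproj y a) x V"
    using pullback_connection_eq[where u = u and Y = "\<i> * Y", OF \<xi>(1) x(1)] JV V
    by (simp add: x_def a_def)
  moreover have "nabla (\<lambda>y. tproj y U) x a + x \<otimes> nabla (\<lambda>y. tproj y V) x a = tproj x (a \<otimes> V)"
    using nabla_J0_derivative[OF xa] by (simp add: V_def J0_def)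
  ultimately have "D_op nabla u \<xi> \<phi> z Y = (1/2) *\<^sub>R (tproj x (dCP1 \<xi> \<phi> z Y)
      + x \<otimes> dCP1 \<xi> \<phi> z (\<i> * Y) + tproj x (a \<otimes> V))"
    using V
    by (simp add: D_op_def Let_def x_def[symmetric] a_def[symmetric] U_def[symmetric] J0_def
        V_def[symmetric] torsion_eq xa oct_cross_simps flip: scaleR_add_right)
  then show ?thesis
    by (simp add: JV x_def a_def)
qed

end

section \<open>The projective line and the normal operator\<close>

definition chart0 :: "complex \<Rightarrow> CP1" where "chart0 z = line (vector [1, z])"
definition chart1 :: "complex \<Rightarrow> CP1" where "chart1 z = line (vector [z, 1])"

lemma CP1_charts_eq: "CP1_charts = {chart0, chart1}"
  by (simp add: CP1_charts_def chart0_def[abs_def] chart1_def[abs_def])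

lemma Rep_line: "v \<noteq> 0 \<Longrightarrow> Rep_CP1 (line v) = range (\<lambda>k. k *s v)"
  unfolding line_def by (subst Abs_CP1_inverse) (auto simp: vec.span_singleton)

lemma chart_vec_nonzero: "vector [1, z] \<noteq> (0 :: complex^2)" "vector [z, 1] \<noteq> (0 :: complex^2)"
  by (auto simp: vec_eq_iff forall_2)

lemma line_eq_iff:
  assumes "v \<noteq> 0" "w \<noteq> 0"
  shows "line v = line w \<longleftrightarrow> (\<exists>k. w = k *s v)"
proof
  assume "line v = line w"
  then have "w \<in> range (\<lambda>k. k *s v)"
    using Rep_line[OF assms(1)] Rep_line[OF assms(2)] by (metis rangeI vector_smult_lid)
  then show "\<exists>k. w = k *s v" by auto
next
  assume "\<exists>k. w = k *s v"
  then obtain k where k: "w = k *s v" by blast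
  with assms have k0: "k \<noteq> 0" by auto
  have "range (\<lambda>a. a *s v) = range (\<lambda>a. a *s w)"
  proof (intro equalityI subsetI)
    fix x assume "x \<in> range (\<lambda>a. a *s v)"
    then obtain a where "x = a *s v" by blast
    then have "x = (a / k) *s w"
      using k0 unfolding k by (simp add: vector_smult_assoc)
    then show "x \<in> range (\<lambda>a. a *s w)" by blast
  qed (auto simp: k vector_smult_assoc)
  then have "Rep_CP1 (line v) = Rep_CP1 (line w)"
    using assms by (simp add: Rep_line)
  then show "line v = line w" by (simp add: Rep_CP1_inject)
qed

lemma chart0_eq_chart1: "chart0 z = chart1 w \<longleftrightarrow> z * w = 1"
  unfolding chart0_def chart1_def
  by (subst line_eq_iff) (auto simp: chart_vec_nonzero vec_eq_iff forall_2 mult.commute)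

lemma inj_chart0: "chart0 z = chart0 w \<longleftrightarrow> z = w"
  unfolding chart0_def by (subst line_eq_iff) (auto simp: chart_vec_nonzero vec_eq_iff forall_2)

lemma inj_chart1: "chart1 z = chart1 w \<longleftrightarrow> z = w"
  unfolding chart1_def by (subst line_eq_iff) (auto simp: chart_vec_nonzero vec_eq_iff forall_2)

lemma CP1_exhaust:
  obtains z where "p = chart0 z" | "p = chart1 0"
proof -
  obtain v :: "complex^2" where v: "v \<noteq> 0" "p = line v"
    by (cases p) (auto simp: line_def)
  show ?thesis
  proof (cases "v $ 1 = 0")
    case True
    then have "p = chart1 0"
      using v unfolding chart1_def v(2)
      by (subst line_eq_iff)
        (auto simp: chart_vec_nonzero vec_eq_iff forall_2 intro!: exI[of _ "1 / v$2"])
    then show ?thesis by (rule that)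
  next
    case False
    then have "p = chart0 (v $ 2 / v $ 1)"
      using v unfolding chart0_def v(2)
      by (subst line_eq_iff)
        (auto simp: chart_vec_nonzero vec_eq_iff forall_2 intro!: exI[of _ "1 / v$1"])
    then show ?thesis by (rule that)
  qed
qed

text \<open>The two affine charts in either order: a fact proved for \<open>\<phi>\<close> holds for
  both, and \<open>\<psi> 0\<close> is the one point that \<open>\<phi>\<close> misses.\<close>

locale chart_pair =
  fixes \<phi> \<psi> :: "complex \<Rightarrow> CP1"
  assumes charts: "\<phi> = chart0 \<and> \<psi> = chart1 \<or> \<phi> = chart1 \<and> \<psi> = chart0"
begin

lemma chart_in [simp]: "\<phi> \<in> CP1_charts" "\<psi> \<in> CP1_charts"
  and charts_eq: "CP1_charts = {\<phi>, \<psi>}"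
  using charts by (auto simp: CP1_charts_eq)

lemma charts_meet: "\<phi> z = \<psi> w \<longleftrightarrow> z * w = 1"
  using charts chart0_eq_chart1 by (metis mult.commute)

lemma chart_inj [simp]: "\<phi> z = \<phi> w \<longleftrightarrow> z = w" "\<psi> z = \<psi> w \<longleftrightarrow> z = w"
  using charts by (auto simp: inj_chart0 inj_chart1)

lemma chart_transition: "w \<noteq> 0 \<Longrightarrow> \<psi> w = \<phi> (1 / w)" "w \<noteq> 0 \<Longrightarrow> \<phi> w = \<psi> (1 / w)"
  using charts_meet[of "1 / w" w] charts_meet[of w "1 / w"] by auto

lemma point_cases:
  obtains z where "p = \<phi> z" | "p = \<psi> 0"
proof -
  have "(\<exists>z. p = \<phi> z) \<or> p = \<psi> 0"
  proof (cases rule: CP1_exhaust[of p])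
    case (1 z)
    show ?thesis
    proof (cases "\<phi> = chart0")
      case False
      then have c: "\<phi> = chart1" "\<psi> = chart0" using charts by auto
      show ?thesis
        using 1 chart0_eq_chart1[of z "1 / z"] by (cases "z = 0") (auto simp: c)
    qed (use 1 in auto)
  next
    case 2
    then show ?thesis using charts by auto
  qed
  then show ?thesis using that by blast
qed

lemma smooth_CP1_iff:
  "smooth_CP1 f \<longleftrightarrow> smooth_on UNIV (\<lambda>z. f (\<phi> z)) \<and> smooth_on UNIV (\<lambda>z. f (\<psi> z))"
  by (simp add: smooth_CP1_def charts_eq)

lemma dCP1_transition:
  assumes f: "(\<lambda>z. f (\<phi> z)) differentiable (at (1 / w))" and w: "w \<noteq> 0"
  shows "((\<lambda>w. f (\<psi> w)) has_derivative (\<lambda>Y. dCP1 f \<phi> (1 / w) (- (Y / w\<^sup>2)))) (at w)"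
proof -
  have "(inverse has_derivative (\<lambda>Y. - (inverse w ^ Suc (Suc 0)) * Y)) (at w)"
    using DERIV_inverse[OF w] by (simp only: has_field_derivative_def)
  moreover have "(\<lambda>Y. - (inverse w ^ Suc (Suc 0)) * Y) = (\<lambda>Y. - (Y / w\<^sup>2))"
    by (simp add: power2_eq_square divide_inverse fun_eq_iff)
  moreover have "inverse = (\<lambda>w :: complex. 1 / w)"
    by (simp add: fun_eq_iff divide_inverse)
  ultimately have "((\<lambda>w. 1 / w) has_derivative (\<lambda>Y. - (Y / w\<^sup>2))) (at w)"
    by simp
  from has_derivative_compose[OF this has_derivative_frechet[OF f]]
  have "((\<lambda>w. f (\<phi> (1 / w))) has_derivative (\<lambda>Y. dCP1 f \<phi> (1 / w) (- (Y / w\<^sup>2)))) (at w)"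
    by (simp add: dCP1_def)
  then show ?thesis
    by (rule has_derivative_transform_within_open[where s = "- {0}"])
      (use w in \<open>simp_all add: chart_transition(1) open_Compl\<close>)
qed

end

lemma chart_pair_sym: "chart_pair \<phi> \<psi> \<Longrightarrow> chart_pair \<psi> \<phi>"
  by (auto simp: chart_pair_def)

lemma chart_pair_exists: "\<phi> \<in> CP1_charts \<Longrightarrow> \<exists>\<psi>. chart_pair \<phi> \<psi>"
  by (auto simp: chart_pair_def CP1_charts_eq)

lemma chart_pair_01: "chart_pair chart0 chart1"
  by (simp add: chart_pair_def)

lemma frechet_derivative_complex:
  fixes f :: "complex \<Rightarrow> 'b::real_normed_vector"
  assumes "f differentiable (at z)"
  shows "frechet_derivative f (at z) Y
    = Re Y *\<^sub>R frechet_derivative f (at z) 1 + Im Y *\<^sub>R frechet_derivative f (at z) \<i>"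
proof -
  have L: "linear (frechet_derivative f (at z))"
    using assms by (rule linear_frechet_derivative)
  have "Y = Re Y *\<^sub>R 1 + Im Y *\<^sub>R \<i>"
    by (simp add: complex_eq_iff)
  then have "frechet_derivative f (at z) Y = frechet_derivative f (at z) (Re Y *\<^sub>R 1 + Im Y *\<^sub>R \<i>)"
    by (rule arg_cong)
  then show ?thesis
    by (simp add: linear_add[OF L] linear_cmul[OF L])
qed

section \<open>Immersed pseudoholomorphic spheres and the fibres of the normal bundle\<close>

locale holo_immersion =
  fixes u :: "CP1 \<Rightarrow> imoct"
  assumes ph: "pseudoholomorphic u" and imm: "immersed u"
begin

lemma u_S6 [simp]: "u p \<in> S6" "u p \<bullet> u p = 1"
  using ph by (simp_all add: pseudoholomorphic_def smooth_map_S6_def flip: S6_iff)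

lemma smooth_u: "smooth_CP1 u"
  using ph by (simp add: pseudoholomorphic_def smooth_map_S6_def)

context
  fixes \<phi> assumes \<phi>: "\<phi> \<in> CP1_charts"
begin

lemma u_smooth_on: "smooth_on UNIV (\<lambda>z. u (\<phi> z))"
  using smooth_u \<phi> by (simp add: smooth_CP1_def)

lemma u_differentiable: "(\<lambda>z. u (\<phi> z)) differentiable (at z)"
  using smooth_on_differentiable[OF u_smooth_on] by simp

lemma du_smooth_on: "smooth_on UNIV (\<lambda>z. dCP1 u \<phi> z Y)"
  unfolding dCP1_def by (rule smooth_on_frechet[OF u_smooth_on])

lemma du_differentiable: "(\<lambda>z. dCP1 u \<phi> z Y) differentiable (at z)"
  using smooth_on_differentiable[OF du_smooth_on] by simp

lemma u_has_derivative: "((\<lambda>z. u (\<phi> z)) has_derivative dCP1 u \<phi> z) (at z)"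
  using has_derivative_frechet[OF u_differentiable] by (simp add: dCP1_def[abs_def])

lemma du_linear: "linear (dCP1 u \<phi> z)"
  using u_has_derivative by (rule has_derivative_linear)

lemma du_complex: "dCP1 u \<phi> z Y = Re Y *\<^sub>R dCP1 u \<phi> z 1 + Im Y *\<^sub>R dCP1 u \<phi> z \<i>"
  unfolding dCP1_def by (rule frechet_derivative_complex[OF u_differentiable])

lemma u_du [simp]: "u (\<phi> z) \<bullet> dCP1 u \<phi> z Y = 0" "dCP1 u \<phi> z Y \<bullet> u (\<phi> z) = 0"
proof -
  have "((\<lambda>z. u (\<phi> z) \<bullet> u (\<phi> z)) has_derivative
      (\<lambda>Y. u (\<phi> z) \<bullet> dCP1 u \<phi> z Y + dCP1 u \<phi> z Y \<bullet> u (\<phi> z))) (at z)"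
    by (intro has_derivative_inner u_has_derivative)
  then have "((\<lambda>z. 1 :: real) has_derivative
      (\<lambda>Y. u (\<phi> z) \<bullet> dCP1 u \<phi> z Y + dCP1 u \<phi> z Y \<bullet> u (\<phi> z))) (at z)"
    by simp
  then have "(\<lambda>Y. u (\<phi> z) \<bullet> dCP1 u \<phi> z Y + dCP1 u \<phi> z Y \<bullet> u (\<phi> z)) = (\<lambda>Y. 0)"
    using has_derivative_const has_derivative_unique by blast
  then have "u (\<phi> z) \<bullet> dCP1 u \<phi> z Y + dCP1 u \<phi> z Y \<bullet> u (\<phi> z) = 0"
    by (rule fun_cong)
  then show "u (\<phi> z) \<bullet> dCP1 u \<phi> z Y = 0" "dCP1 u \<phi> z Y \<bullet> u (\<phi> z) = 0"
    by (simp_all add: inner_commute)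
qed

lemma CR_equation: "dCP1 u \<phi> z Y + u (\<phi> z) \<otimes> dCP1 u \<phi> z (\<i> * Y) = 0"
  using ph \<phi> by (auto simp: pseudoholomorphic_def dbar_J0_def J0_def)

lemma du_i: "dCP1 u \<phi> z (\<i> * Y) = u (\<phi> z) \<otimes> dCP1 u \<phi> z Y"
proof -
  have "u (\<phi> z) \<otimes> (dCP1 u \<phi> z Y + u (\<phi> z) \<otimes> dCP1 u \<phi> z (\<i> * Y)) = 0"
    by (simp add: CR_equation oct_cross_simps)
  then show ?thesis
    by (simp add: oct_cross_simps oct_cross_unit)
qed

lemma du_t: "dCP1 u \<phi> z \<i> = u (\<phi> z) \<otimes> dCP1 u \<phi> z 1"
  using du_i[of z 1] by simp

lemma du_nonzero: "dCP1 u \<phi> z 1 \<noteq> 0"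
proof
  assume "dCP1 u \<phi> z 1 = 0"
  then have "dCP1 u \<phi> z 1 = dCP1 u \<phi> z 0"
    by (simp add: linear_0[OF du_linear])
  then show False
    using imm \<phi> unfolding immersed_def inj_def by (metis zero_neq_one)
qed

text \<open>\<open>tangent_image\<close> collects velocity vectors from every chart through the
  point. The other chart adds nothing, since the chain rule for the transition map carries its
  vectors to this one.\<close>

lemma tangent_image_eq: "tangent_image u (\<phi> z) = range (dCP1 u \<phi> z)"
proof (intro equalityI subsetI)
  fix v assume "v \<in> tangent_image u (\<phi> z)"
  then obtain \<phi>' z' Y where v: "v = dCP1 u \<phi>' z' Y" "\<phi>' \<in> CP1_charts" "\<phi>' z' = \<phi> z"
    by (auto simp: tangent_image_def)
  obtain \<psi> where "chart_pair \<phi> \<psi>" using chart_pair_exists[OF \<phi>] by blast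
  then interpret chart_pair \<phi> \<psi> .
  consider "\<phi>' = \<phi>" | "\<phi>' = \<psi>" using v(2) charts_eq by blast
  then show "v \<in> range (dCP1 u \<phi> z)"
  proof cases
    case 1
    with v show ?thesis by auto
  next
    case 2
    with v have "z * z' = 1" using charts_meet by metis
    then have z: "z = 1 / z'" "z' \<noteq> 0" by (auto simp: eq_divide_eq)
    have "((\<lambda>w. u (\<psi> w)) has_derivative (\<lambda>Y. dCP1 u \<phi> (1 / z') (- (Y / z'\<^sup>2)))) (at z')"
      by (rule dCP1_transition[OF u_differentiable z(2)])
    then have "v = dCP1 u \<phi> z (- (Y / z'\<^sup>2))"
      unfolding v(1) 2 dCP1_def[of u \<psi>] z(1) by (rule frechet_derivativeI)
    then show ?thesis by blast
  qed
qed (use \<phi> in \<open>auto simp: tangent_image_def\<close>)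

end

lemma point_chart: obtains \<phi> z where "\<phi> \<in> CP1_charts" "p = \<phi> z"
  by (cases rule: CP1_exhaust[of p]) (auto simp: CP1_charts_eq)

lemma subspace_tangent_image: "subspace (tangent_image u p)"
proof -
  obtain \<phi> z where \<phi>: "\<phi> \<in> CP1_charts" "p = \<phi> z" by (rule point_chart)
  show ?thesis
    unfolding \<phi>(2) tangent_image_eq[OF \<phi>(1)]
    by (rule linear_subspace_image[OF du_linear[OF \<phi>(1)] subspace_UNIV])
qed

lemma tangent_image_J: "v \<in> tangent_image u p \<Longrightarrow> u p \<otimes> v \<in> tangent_image u p"
proof -
  obtain \<phi> z where \<phi>: "\<phi> \<in> CP1_charts" "p = \<phi> z" by (rule point_chart)
  show "v \<in> tangent_image u p \<Longrightarrow> u p \<otimes> v \<in> tangent_image u p"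
    unfolding \<phi>(2) tangent_image_eq[OF \<phi>(1)] by (auto simp flip: du_i[OF \<phi>(1)])
qed

lemma du_tangent: "\<phi> \<in> CP1_charts \<Longrightarrow> dCP1 u \<phi> z Y \<in> tangent_image u (\<phi> z)"
  by (simp add: tangent_image_eq)

lemmas tangent_image_intros = subspace_add[OF subspace_tangent_image]
  subspace_diff[OF subspace_tangent_image] subspace_scale[OF subspace_tangent_image]
  subspace_0[OF subspace_tangent_image] tangent_image_J subspace_neg[OF subspace_tangent_image]

lemma quot_proj_self: "v \<in> quot_proj u p v"
proof -
  have "v = v + 0" "0 \<in> tangent_image u p"
    by (simp_all add: subspace_0[OF subspace_tangent_image])
  then show ?thesis unfolding quot_proj_def by blast
qed

lemma quot_proj_eq_iff: "quot_proj u p v = quot_proj u p w \<longleftrightarrow> v - w \<in> tangent_image u p"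
proof
  assume "quot_proj u p v = quot_proj u p w"
  moreover have "v \<in> quot_proj u p v"
    by (rule quot_proj_self)
  ultimately obtain t where "v = w + t" "t \<in> tangent_image u p"
    by (auto simp: quot_proj_def)
  then show "v - w \<in> tangent_image u p" by simp
next
  have *: "quot_proj u p v \<subseteq> quot_proj u p w" if d: "v - w \<in> tangent_image u p" for v w
  proof
    fix a assume "a \<in> quot_proj u p v"
    then obtain t where t: "a = v + t" "t \<in> tangent_image u p" by (auto simp: quot_proj_def)
    then have "a = w + ((v - w) + t)" "(v - w) + t \<in> tangent_image u p"
      using d by (auto intro: tangent_image_intros)
    then show "a \<in> quot_proj u p w" unfolding quot_proj_def by blast
  qed
  assume d: "v - w \<in> tangent_image u p"
  then have "w - v \<in> tangent_image u p"
    using subspace_neg[OF subspace_tangent_image] by fastforce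
  with d show "quot_proj u p v = quot_proj u p w"
    using *[of v w] *[of w v] by blast
qed

lemma quot_proj_mem: "w \<in> quot_proj u p v \<longleftrightarrow> w - v \<in> tangent_image u p"
proof
  assume "w \<in> quot_proj u p v"
  then obtain t where "w = v + t" "t \<in> tangent_image u p"
    unfolding quot_proj_def by blast
  then show "w - v \<in> tangent_image u p" by simp
next
  assume "w - v \<in> tangent_image u p"
  moreover have "w = v + (w - v)" by simp
  ultimately show "w \<in> quot_proj u p v"
    unfolding quot_proj_def by blast
qed

lemma normal_add_quot: "normal_add (quot_proj u p v) (quot_proj u p w) = quot_proj u p (v + w)"
proof (intro equalityI subsetI)
  fix a assume "a \<in> normal_add (quot_proj u p v) (quot_proj u p w)"
  then obtain b c where a: "a = b + c" "b - v \<in> tangent_image u p" "c - w \<in> tangent_image u p"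
    unfolding normal_add_def mem_Collect_eq quot_proj_mem by (elim exE conjE)
  have "a - (v + w) = (b - v) + (c - w)" using a by simp
  then show "a \<in> quot_proj u p (v + w)"
    unfolding quot_proj_mem using a(2,3) by (simp only: tangent_image_intros)
next
  fix a assume "a \<in> quot_proj u p (v + w)"
  then have "a - w \<in> quot_proj u p v" "a = (a - w) + w"
    by (simp_all add: quot_proj_mem algebra_simps)
  with quot_proj_self[of w p] show "a \<in> normal_add (quot_proj u p v) (quot_proj u p w)"
    unfolding normal_add_def mem_Collect_eq by (intro exI conjI)
qed

lemma normal_scale_quot:
  "normal_scale u p c (quot_proj u p v) = quot_proj u p (Re c *\<^sub>R v + Im c *\<^sub>R (u p \<otimes> v))"
proof (intro equalityI subsetI)
  fix a assume "a \<in> normal_scale u p c (quot_proj u p v)"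
  then obtain b t where a: "a = Re c *\<^sub>R b + Im c *\<^sub>R (u p \<otimes> b) + t" and b: "b - v \<in> tangent_image u p"
    "t \<in> tangent_image u p"
    unfolding normal_scale_def mem_Collect_eq quot_proj_mem J0_def by (elim exE conjE)
  have "a - (Re c *\<^sub>R v + Im c *\<^sub>R (u p \<otimes> v)) = Re c *\<^sub>R (b - v) + Im c *\<^sub>R (u p \<otimes> (b - v)) + t"
    unfolding a by (simp add: oct_cross_simps algebra_simps)
  moreover have "Re c *\<^sub>R (b - v) + Im c *\<^sub>R (u p \<otimes> (b - v)) + t \<in> tangent_image u p"
    using b by (simp only: tangent_image_intros)
  ultimately show "a \<in> quot_proj u p (Re c *\<^sub>R v + Im c *\<^sub>R (u p \<otimes> v))"
    by (simp add: quot_proj_mem)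
next
  fix a assume "a \<in> quot_proj u p (Re c *\<^sub>R v + Im c *\<^sub>R (u p \<otimes> v))"
  then obtain t where "a = Re c *\<^sub>R v + Im c *\<^sub>R (u p \<otimes> v) + t" "t \<in> tangent_image u p"
    unfolding quot_proj_def mem_Collect_eq by (elim exE conjE)
  with quot_proj_self[of v p] show "a \<in> normal_scale u p c (quot_proj u p v)"
    unfolding normal_scale_def J0_def mem_Collect_eq by (intro exI conjI)
qed

end

section \<open>The operator on the normal bundle and its complex-linear part\<close>

locale J0_connection_sphere = J0_connection nabla + holo_immersion u
  for nabla :: connection and u :: "CP1 \<Rightarrow> imoct"
begin

lemma u_TS6: "u p \<otimes> v \<in> TS6 (u p)" "\<phi> \<in> CP1_charts \<Longrightarrow> dCP1 u \<phi> z Y \<in> TS6 (u (\<phi> z))"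
  by (simp_all add: TS6_def)

lemma pullback_section_differentiable:
  "pullback_section u \<xi> \<Longrightarrow> \<phi> \<in> CP1_charts \<Longrightarrow> (\<lambda>w. \<xi> (\<phi> w)) differentiable (at z)"
  by (auto simp: pullback_section_def smooth_CP1_def intro: smooth_on_differentiable)

lemma D_op_section:
  assumes "pullback_section u \<xi>" "\<phi> \<in> CP1_charts"
  shows "D_op nabla u \<xi> \<phi> z Y = (1/2) *\<^sub>R (tproj (u (\<phi> z)) (dCP1 \<xi> \<phi> z Y)
    + u (\<phi> z) \<otimes> dCP1 \<xi> \<phi> z (\<i> * Y)
    + tproj (u (\<phi> z)) (\<xi> (\<phi> z) \<otimes> dCP1 u \<phi> z (\<i> * Y)))"
  by (rule D_op_eq[OF pullback_section_differentiable[OF assms] _ u_S6(1) u_TS6(2)[OF assms(2)]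
        du_i[OF assms(2)]])
    (use assms(1) in \<open>simp add: pullback_section_def\<close>)

text \<open>Differentiating the Cauchy--Riemann equation in a direction \<open>V\<close> that is constant in the chart
  says that \<open>D\<close> kills \<open>du(V)\<close>.\<close>

lemma CR_derivative:
  assumes \<phi>: "\<phi> \<in> CP1_charts"
  shows "frechet_derivative (\<lambda>w. dCP1 u \<phi> w V) (at z) Y
    + u (\<phi> z) \<otimes> frechet_derivative (\<lambda>w. dCP1 u \<phi> w V) (at z) (\<i> * Y)
    + dCP1 u \<phi> z V \<otimes> dCP1 u \<phi> z (\<i> * Y) = 0"
proof -
  note d = has_derivative_frechet[OF du_differentiable[OF \<phi>]]
  have "((\<lambda>z. dCP1 u \<phi> z Y + u (\<phi> z) \<otimes> dCP1 u \<phi> z (\<i> * Y)) has_derivative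
     (\<lambda>V. frechet_derivative (\<lambda>w. dCP1 u \<phi> w Y) (at z) V
        + (u (\<phi> z) \<otimes> frechet_derivative (\<lambda>w. dCP1 u \<phi> w (\<i> * Y)) (at z) V
           + dCP1 u \<phi> z V \<otimes> dCP1 u \<phi> z (\<i> * Y)))) (at z)"
    by (intro has_derivative_add oct_cross.FDERIV d u_has_derivative[OF \<phi>])
  then have "((\<lambda>z. 0) has_derivative
     (\<lambda>V. frechet_derivative (\<lambda>w. dCP1 u \<phi> w Y) (at z) V
        + (u (\<phi> z) \<otimes> frechet_derivative (\<lambda>w. dCP1 u \<phi> w (\<i> * Y)) (at z) V
           + dCP1 u \<phi> z V \<otimes> dCP1 u \<phi> z (\<i> * Y)))) (at z)"
    by (simp add: CR_equation[OF \<phi>])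
  then have "frechet_derivative (\<lambda>w. dCP1 u \<phi> w Y) (at z) V
        + (u (\<phi> z) \<otimes> frechet_derivative (\<lambda>w. dCP1 u \<phi> w (\<i> * Y)) (at z) V
           + dCP1 u \<phi> z V \<otimes> dCP1 u \<phi> z (\<i> * Y)) = 0"
    by (rule fun_cong[OF has_derivative_unique[OF _ has_derivative_const]])
  moreover have sw: "frechet_derivative (\<lambda>w. dCP1 u \<phi> w V) (at z) Y = frechet_derivative (\<lambda>w. dCP1 u \<phi> w Y) (at z) V"
    for Y
    unfolding dCP1_def by (rule mixed_partials_commute[OF u_smooth_on[OF \<phi>]])
  ultimately show ?thesis
    unfolding sw[of Y] sw[of "\<i> * Y"] by (simp only: add.assoc)
qed

text \<open>This makes the normal operator well defined. By \<open>CR_derivative\<close> the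
  operator annihilates the frame \<open>us\<close>, \<open>ut\<close>; what remains are derivatives
  of the coefficients times the frame, and the tangent plane is invariant under
  \<open>J0\<close>.\<close>

lemma D_op_tangent:
  assumes \<xi>: "pullback_section u \<xi>" "\<And>p. \<xi> p \<in> tangent_image u p" and \<phi>: "\<phi> \<in> CP1_charts"
  shows "D_op nabla u \<xi> \<phi> z Y \<in> tangent_image u (\<phi> z)"
proof -
  define us where "us w = dCP1 u \<phi> w 1" for w
  define ut where "ut w = dCP1 u \<phi> w \<i>" for w
  \<comment> \<open>The coefficients are written with inner products so that they are visibly
    differentiable. Both are divided by the same length because \<open>ut\<close> is the image of
    \<open>us\<close> under \<open>J0\<close>.\<close>
  define a where "a w = (\<xi> (\<phi> w) \<bullet> us w) / (us w \<bullet> us w)" for w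
  define b where "b w = (\<xi> (\<phi> w) \<bullet> ut w) / (us w \<bullet> us w)" for w
  define x where "x = u (\<phi> z)"
  have ut: "ut w = u (\<phi> w) \<otimes> us w" for w
    unfolding ut_def us_def by (rule du_t[OF \<phi>])
  have us0: "us w \<bullet> us w \<noteq> 0" for w
    using du_nonzero[OF \<phi>] by (simp add: us_def)
  have orth: "us w \<bullet> ut w = 0" "ut w \<bullet> us w = 0" for w
    by (simp_all add: ut)
  have ut2: "ut w \<bullet> ut w = us w \<bullet> us w" for w
  proof -
    have "(u (\<phi> w) \<otimes> us w) \<bullet> ut w = - ((u (\<phi> w) \<otimes> ut w) \<bullet> us w)"
      by (rule oct_cross_triple)
    also have "u (\<phi> w) \<otimes> ut w = - us w"
      unfolding ut by (rule oct_cross_unit) (simp_all add: us_def u_du[OF \<phi>])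
    finally show ?thesis by (simp add: ut)
  qed
  have ab: "\<xi> (\<phi> w) = a w *\<^sub>R us w + b w *\<^sub>R ut w" for w
  proof -
    obtain V where V: "\<xi> (\<phi> w) = dCP1 u \<phi> w V"
      using \<xi>(2)[of "\<phi> w"] tangent_image_eq[OF \<phi>, of w] by blast
    then have "\<xi> (\<phi> w) = Re V *\<^sub>R us w + Im V *\<^sub>R ut w"
      unfolding us_def ut_def by (simp only: du_complex[OF \<phi>, of w V])
    then show ?thesis
      using us0[of w] by (simp add: a_def b_def inner_simps orth ut2)
  qed
  have d\<xi>: "(\<lambda>w. \<xi> (\<phi> w)) differentiable (at z)"
    by (rule pullback_section_differentiable[OF \<xi>(1) \<phi>])
  have dus: "us differentiable (at z)" "ut differentiable (at z)"
    unfolding us_def ut_def by (rule du_differentiable[OF \<phi>])+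
  have "a differentiable (at z)" "b differentiable (at z)"
    unfolding a_def b_def
    using us0[of z] by (auto intro!: differentiable_divide differentiable_inner d\<xi> dus)
  then obtain a' b' where ab': "(a has_derivative a') (at z)" "(b has_derivative b') (at z)"
    by (auto simp: differentiable_def)
  have D: "dCP1 \<xi> \<phi> z Y = (a z *\<^sub>R frechet_derivative us (at z) Y + a' Y *\<^sub>R us z)
      + (b z *\<^sub>R frechet_derivative ut (at z) Y + b' Y *\<^sub>R ut z)" for Y
    unfolding dCP1_def ab
    by (intro frechet_derivativeI has_derivative_add bounded_bilinear.FDERIV[OF bounded_bilinear_scaleR]
       ab' has_derivative_frechet dus)
  define S where "S c = tproj x (frechet_derivative c (at z) Y) + x \<otimes> frechet_derivative c (at z) (\<i> * Y)
      + tproj x (c z \<otimes> dCP1 u \<phi> z (\<i> * Y))" for c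
  have S0: "S us = 0" "S ut = 0"
  proof -
    have "S (\<lambda>w. dCP1 u \<phi> w V) = tproj x (frechet_derivative (\<lambda>w. dCP1 u \<phi> w V) (at z) Y
    + u (\<phi> z) \<otimes> frechet_derivative (\<lambda>w. dCP1 u \<phi> w V) (at z) (\<i> * Y)
    + dCP1 u \<phi> z V \<otimes> dCP1 u \<phi> z (\<i> * Y))" for V
      by (simp add: S_def x_def linear_add[OF tproj_linear])
    then have "S (\<lambda>w. dCP1 u \<phi> w V) = 0" for V
      by (simp add: CR_derivative[OF \<phi>] linear_0[OF tproj_linear])
    then show "S us = 0" "S ut = 0"
      by (simp_all add: us_def[abs_def] ut_def[abs_def])
  qed
  have tp: "tproj x (us z) = us z" "tproj x (ut z) = ut z"
    by (simp_all add: x_def us_def ut_def u_du[OF \<phi>])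
  have "tproj x (dCP1 \<xi> \<phi> z Y) + x \<otimes> dCP1 \<xi> \<phi> z (\<i> * Y) + tproj x (\<xi> (\<phi> z) \<otimes> dCP1 u \<phi> z (\<i> * Y))
     = a z *\<^sub>R S us + b z *\<^sub>R S ut + (a' Y *\<^sub>R us z + b' Y *\<^sub>R ut z)
       + x \<otimes> (a' (\<i> * Y) *\<^sub>R us z + b' (\<i> * Y) *\<^sub>R ut z)"
    by (simp add: D S_def ab oct_cross_simps linear_add[OF tproj_linear] linear_cmul[OF tproj_linear] tp
        algebra_simps)
  also have "\<dots> = (a' Y *\<^sub>R us z + b' Y *\<^sub>R ut z) + u (\<phi> z) \<otimes> (a' (\<i> * Y) *\<^sub>R us z + b' (\<i> * Y) *\<^sub>R ut z)"
    by (simp add: S0 x_def)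
  also have "\<dots> \<in> tangent_image u (\<phi> z)"
    unfolding us_def ut_def by (simp only: tangent_image_intros du_tangent[OF \<phi>])
  finally show ?thesis
    unfolding D_op_section[OF \<xi>(1) \<phi>] x_def by (simp only: tangent_image_intros)
qed

lemma pullback_section_diff:
  "pullback_section u \<xi> \<Longrightarrow> pullback_section u \<eta> \<Longrightarrow> pullback_section u (\<lambda>p. \<xi> p - \<eta> p)"
  by (simp add: pullback_section_def smooth_CP1_def smooth_on_diff TS6_def inner_simps)

lemma pullback_section_J:
  assumes "pullback_section u \<xi>" shows "pullback_section u (\<lambda>p. u p \<otimes> \<xi> p)"
  using assms smooth_u
  by (simp add: pullback_section_def smooth_CP1_def TS6_def smooth_on_bilinear[OF _ bounded_bilinear_oct_cross])

lemma D_op_diff: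
  assumes \<xi>: "pullback_section u \<xi>" "pullback_section u \<eta>" and \<phi>: "\<phi> \<in> CP1_charts"
  shows "D_op nabla u (\<lambda>p. \<xi> p - \<eta> p) \<phi> z Y = D_op nabla u \<xi> \<phi> z Y - D_op nabla u \<eta> \<phi> z Y"
proof -
  have d: "dCP1 (\<lambda>p. \<xi> p - \<eta> p) \<phi> z Y = dCP1 \<xi> \<phi> z Y - dCP1 \<eta> \<phi> z Y" for Y
    unfolding dCP1_def
    by (intro frechet_derivativeI has_derivative_diff has_derivative_frechet
        pullback_section_differentiable \<xi> \<phi>)
  show ?thesis
    unfolding D_op_section[OF pullback_section_diff[OF \<xi>] \<phi>] D_op_section[OF \<xi>(1) \<phi>]
      D_op_section[OF \<xi>(2) \<phi>] d
    by (simp add: linear_diff[OF tproj_linear] oct_cross_simps algebra_simps)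
qed

text \<open>Two lifts differ by a section of the tangent image, which \<open>D_op\<close> preserves;
  so the lift picked by \<open>SOME\<close> may be replaced by any other.\<close>

lemma DN_op_lift:
  assumes s: "is_lift u s \<xi>" and \<phi>: "\<phi> \<in> CP1_charts"
  shows "DN_op nabla u s \<phi> z Y = quot_proj u (\<phi> z) (D_op nabla u \<xi> \<phi> z Y)"
proof -
  define \<eta> where "\<eta> = (SOME \<xi>. is_lift u s \<xi>)"
  have \<eta>: "is_lift u s \<eta>" unfolding \<eta>_def using s by (rule someI[of "is_lift u s"])
  then have ps: "pullback_section u \<xi>" "pullback_section u \<eta>" using s by (auto simp: is_lift_def)
  have "\<eta> p - \<xi> p \<in> tangent_image u p" for p
    using s \<eta> quot_proj_eq_iff by (metis is_lift_def)
  then have "D_op nabla u \<eta> \<phi> z Y - D_op nabla u \<xi> \<phi> z Y \<in> tangent_image u (\<phi> z)"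
    using D_op_tangent[OF pullback_section_diff[OF ps(2,1)] _ \<phi>] D_op_diff[OF ps(2,1) \<phi>] by simp
  then show ?thesis
    unfolding DN_op_def \<eta>_def[symmetric] by (simp add: quot_proj_eq_iff)
qed

lemma is_lift_J:
  assumes "is_lift u s \<xi>"
  shows "is_lift u (\<lambda>p. normal_scale u p \<i> (s p)) (\<lambda>p. u p \<otimes> \<xi> p)"
  using assms by (simp add: is_lift_def pullback_section_J normal_scale_quot)

lemma dbar_N_lift:
  assumes s: "is_lift u s \<xi>" and \<phi>: "\<phi> \<in> CP1_charts"
  shows "dbar_N nabla u s \<phi> z Y = quot_proj u (\<phi> z) ((1/2) *\<^sub>R (tproj (u (\<phi> z)) (dCP1 \<xi> \<phi> z Y)
     + u (\<phi> z) \<otimes> dCP1 \<xi> \<phi> z (\<i> * Y) - u (\<phi> z) \<otimes> (dCP1 u \<phi> z Y \<otimes> \<xi> (\<phi> z))))"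
proof -
  define x where "x = u (\<phi> z)"
  define U where "U = dCP1 u \<phi> z Y"
  define a where "a = \<xi> (\<phi> z)"
  define c where "c = dCP1 \<xi> \<phi> z Y"
  define d where "d = dCP1 \<xi> \<phi> z (\<i> * Y)"
  have \<xi>: "pullback_section u \<xi>" using s by (simp add: is_lift_def)
  have xx: "x \<bullet> x = 1" "x \<bullet> a = 0" "x \<bullet> U = 0"
    using \<xi> by (simp_all add: x_def a_def U_def pullback_section_def TS6_def u_du[OF \<phi>] inner_commute)
  have iU: "dCP1 u \<phi> z (\<i> * Y) = x \<otimes> U"
    unfolding x_def U_def by (rule du_i[OF \<phi>])
  have tp: "x \<otimes> (x \<otimes> v) = - tproj x v" for v
    by (simp add: oct_cross_cross_self xx tproj_def inner_commute)
  have dJ: "dCP1 (\<lambda>p. u p \<otimes> \<xi> p) \<phi> z Y = u (\<phi> z) \<otimes> dCP1 \<xi> \<phi> z Y + dCP1 u \<phi> z Y \<otimes> \<xi> (\<phi> z)" for Y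
    unfolding dCP1_def[of "\<lambda>p. u p \<otimes> \<xi> p"] dCP1_def[of \<xi>]
    by (intro frechet_derivativeI oct_cross.FDERIV u_has_derivative[OF \<phi>] has_derivative_frechet
        pullback_section_differentiable \<xi> \<phi>)
  have D1: "D_op nabla u \<xi> \<phi> z Y = (1/2) *\<^sub>R (tproj x c + x \<otimes> d + tproj x (a \<otimes> (x \<otimes> U)))"
    using D_op_section[OF \<xi> \<phi>] by (simp add: x_def a_def c_def d_def iU[unfolded x_def])
  have D2: "D_op nabla u (\<lambda>p. u p \<otimes> \<xi> p) \<phi> z Y = (1/2) *\<^sub>R (tproj x (x \<otimes> c + U \<otimes> a)
      + x \<otimes> (x \<otimes> d + (x \<otimes> U) \<otimes> a) + tproj x ((x \<otimes> a) \<otimes> (x \<otimes> U)))"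
    unfolding D_op_section[OF pullback_section_J[OF \<xi>] \<phi>] dJ iU
    by (simp add: x_def a_def c_def d_def U_def)
  \<comment> \<open>Moving the factors \<open>x\<close> outward by antilinearity reduces this
    torsion term to \<open>x \<otimes> (U \<otimes> a)\<close>, the product that also arises from
    differentiating \<open>J0\<close> along \<open>u\<close>.\<close>
  have k1: "x \<otimes> ((x \<otimes> a) \<otimes> (x \<otimes> U)) = x \<otimes> (U \<otimes> a)"
  proof -
    have "x \<otimes> ((x \<otimes> a) \<otimes> (x \<otimes> U)) = tproj x (a \<otimes> (x \<otimes> U))"
      using oct_cross_antilinear(1)[of x a "x \<otimes> U"] xx by (simp add: oct_cross_simps tp)
    also have "a \<otimes> (x \<otimes> U) = x \<otimes> (U \<otimes> a) + (a \<bullet> U) *\<^sub>R x"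
      using oct_cross_antilinear(2)[of x a U] xx oct_cross_skew[of a U]
      by (simp add: oct_cross_simps)
    also have "tproj x \<dots> = x \<otimes> (U \<otimes> a)"
      by (simp add: tproj_def inner_simps xx)
    finally show ?thesis .
  qed
  have k2: "a \<otimes> (x \<otimes> U) = - ((x \<otimes> U) \<otimes> a)" by (rule oct_cross_skew)
  have sum: "D_op nabla u \<xi> \<phi> z Y - x \<otimes> D_op nabla u (\<lambda>p. u p \<otimes> \<xi> p) \<phi> z Y
      = tproj x c + x \<otimes> d - x \<otimes> (U \<otimes> a)"
    unfolding D1 D2
    by (simp add: oct_cross_simps tp k1 k2 linear_neg[OF tproj_linear] linear_add[OF tproj_linear]
        scaleR_right_distrib flip: scaleR_add_left) (simp add: algebra_simps flip: scaleR_add_left)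
  have "dbar_N nabla u s \<phi> z Y = quot_proj u (\<phi> z) ((1/2) *\<^sub>R
      (D_op nabla u \<xi> \<phi> z Y - x \<otimes> D_op nabla u (\<lambda>p. u p \<otimes> \<xi> p) \<phi> z Y))"
    by (simp add: dbar_N_def DN_op_lift[OF s \<phi>] DN_op_lift[OF is_lift_J[OF s] \<phi>]
        normal_scale_quot normal_add_quot x_def)
  then show ?thesis
    unfolding sum by (simp add: x_def c_def d_def U_def a_def)
qed

end

section \<open>The second fundamental form as a holomorphic section\<close>

lemma holomorphic_CR:
  fixes g :: "complex \<Rightarrow> complex"
  assumes d: "\<And>z. g differentiable (at z)"
    and CR: "\<And>z. frechet_derivative g (at z) 1 + \<i> * frechet_derivative g (at z) \<i> = 0"
  shows "g holomorphic_on UNIV"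
proof -
  have "(g has_field_derivative frechet_derivative g (at z) 1) (at z)" for z
  proof -
    have "frechet_derivative g (at z) \<i> = \<i> * frechet_derivative g (at z) 1"
      using arg_cong[OF CR[of z], of "\<lambda>a. - \<i> * a"] by (simp add: algebra_simps)
    then have "frechet_derivative g (at z) Y = frechet_derivative g (at z) 1 * Y" for Y
      by (subst frechet_derivative_complex[OF d]) (simp add: complex_eq_iff algebra_simps)
    then have "frechet_derivative g (at z) = (*) (frechet_derivative g (at z) 1)"
      by (rule ext)
    then show ?thesis
      unfolding has_field_derivative_def using has_derivative_frechet[OF d, of z] by simp
  qed
  then show ?thesis
    by (auto simp: holomorphic_on_def field_differentiable_def)
qed

lemma tendsto_inverse_chart:
  fixes g :: "complex \<Rightarrow> 'a::topological_space"
  assumes "isCont h 0" "\<And>z. z \<noteq> 0 \<Longrightarrow> g z = h (1 / z)"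
  shows "(g \<longlongrightarrow> h 0) at_infinity"
proof -
  have "((\<lambda>z. h (inverse z)) \<longlongrightarrow> h 0) at_infinity"
    using assms(1) tendsto_inverse_0 by (rule isCont_tendsto_compose)
  moreover have "eventually (\<lambda>z. h (inverse z) = g z) at_infinity"
    unfolding eventually_at_infinity
  proof (intro exI allI impI)
    fix z :: complex assume "1 \<le> norm z"
    then have "z \<noteq> 0" by auto
    from assms(2)[OF this] show "h (inverse z) = g z" by (simp add: inverse_eq_divide)
  qed
  ultimately show ?thesis
    by (rule Lim_transform_eventually)
qed

context chart_pair
begin

text \<open>The derivative along the global holomorphic vector field \<open>d/dz\<close>, which extends by zero to the
  point missing from the chart; in the other chart it is \<open>- w\<^sup>2 d/dw\<close>.\<close>

definition vderiv :: "(CP1 \<Rightarrow> 'b::real_normed_vector) \<Rightarrow> CP1 \<Rightarrow> 'b" where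
  "vderiv f p = (if p = \<psi> 0 then 0 else dCP1 f \<phi> (THE z. p = \<phi> z) 1)"

lemma vderiv_\<phi>: "vderiv f (\<phi> z) = dCP1 f \<phi> z 1"
  using charts_meet[of z 0] by (simp add: vderiv_def)

lemma vderiv_\<psi>:
  assumes "smooth_CP1 f"
  shows "vderiv f (\<psi> w) = dCP1 f \<psi> w (- (w\<^sup>2))"
proof (cases "w = 0")
  case True
  have "linear (frechet_derivative (\<lambda>w. f (\<psi> w)) (at 0))"
    using assms by (auto intro!: linear_frechet_derivative smooth_on_differentiable simp: smooth_CP1_iff)
  then show ?thesis
    by (simp add: True vderiv_def dCP1_def linear_0)
next
  case False
  have "((\<lambda>w. f (\<psi> w)) has_derivative (\<lambda>Y. dCP1 f \<phi> (1 / w) (- (Y / w\<^sup>2)))) (at w)"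
    using assms by (auto intro!: dCP1_transition False smooth_on_differentiable simp: smooth_CP1_iff)
  then have "dCP1 f \<psi> w (- (w\<^sup>2)) = dCP1 f \<phi> (1 / w) (- (- (w\<^sup>2) / w\<^sup>2))"
    unfolding dCP1_def[of f \<psi>] by (rule frechet_derivativeI)
  then show ?thesis
    using False by (simp add: chart_transition(1) vderiv_\<phi>)
qed

lemma smooth_vderiv:
  assumes f: "smooth_CP1 f"
  shows "smooth_CP1 (vderiv f)"
proof -
  have sf: "smooth_on UNIV (\<lambda>z. f (\<phi> z))" "smooth_on UNIV (\<lambda>z. f (\<psi> z))"
    using f by (auto simp: smooth_CP1_iff)
  have sq: "smooth_on UNIV (\<lambda>w :: complex. - (w\<^sup>2))"
    unfolding power2_eq_square
    by (rule smooth_on_bounded_linear[OF open_UNIV bounded_linear_minus[OF bounded_linear_ident]])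
      (rule smooth_on_bilinear[OF open_UNIV bounded_bilinear_mult smooth_on_linear smooth_on_linear];
        rule bounded_linear_ident)
  have "dCP1 f \<psi> w (- (w\<^sup>2)) = Re (- (w\<^sup>2)) *\<^sub>R frechet_derivative (\<lambda>w. f (\<psi> w)) (at w) 1
      + Im (- (w\<^sup>2)) *\<^sub>R frechet_derivative (\<lambda>w. f (\<psi> w)) (at w) \<i>" for w
    unfolding dCP1_def
    by (rule frechet_derivative_complex) (use sf(2) in \<open>auto intro: smooth_on_differentiable\<close>)
  moreover have "smooth_on UNIV (\<lambda>w. Re (- (w\<^sup>2)) *\<^sub>R frechet_derivative (\<lambda>w. f (\<psi> w)) (at w) 1
      + Im (- (w\<^sup>2)) *\<^sub>R frechet_derivative (\<lambda>w. f (\<psi> w)) (at w) \<i>)"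
    by (rule smooth_on_add[OF open_UNIV];
      rule smooth_on_bilinear[OF open_UNIV bounded_bilinear_scaleR _ smooth_on_frechet[OF sf(2)]];
      rule smooth_on_bounded_linear[OF open_UNIV _ sq])
      (rule bounded_linear_Re bounded_linear_Im)+
  ultimately have "smooth_on UNIV (\<lambda>w. vderiv f (\<psi> w))"
    by (simp only: vderiv_\<psi>[OF f])
  moreover have "smooth_on UNIV (\<lambda>z. vderiv f (\<phi> z))"
    unfolding vderiv_\<phi> dCP1_def by (rule smooth_on_frechet[OF sf(1)])
  ultimately show ?thesis by (simp add: smooth_CP1_iff)
qed

end

context holo_immersion
begin

context
  fixes \<phi> assumes \<phi>: "\<phi> \<in> CP1_charts"
begin

definition "us w = dCP1 u \<phi> w 1"
definition "ut w = dCP1 u \<phi> w \<i>"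
definition "lam w = us w \<bullet> us w"

lemma ut_eq: "ut w = u (\<phi> w) \<otimes> us w"
  unfolding us_def ut_def by (rule du_t[OF \<phi>])

lemma smooth_us: "smooth_on UNIV us" "smooth_on UNIV ut"
  unfolding us_def ut_def by (rule du_smooth_on[OF \<phi>])+

lemma us_differentiable: "us differentiable (at z)" "ut differentiable (at z)"
  using smooth_us by (auto intro: smooth_on_differentiable)

lemma us_perp: "u (\<phi> w) \<bullet> us w = 0" "us w \<bullet> u (\<phi> w) = 0" "u (\<phi> w) \<bullet> ut w = 0" "ut w \<bullet> u (\<phi> w) = 0"
  "us w \<bullet> ut w = 0" "ut w \<bullet> us w = 0"
  by (simp_all add: us_def u_du[OF \<phi>] ut_eq)

lemma u_ut: "u (\<phi> w) \<otimes> ut w = - us w"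
  unfolding ut_eq by (simp add: oct_cross_unit us_perp)

lemma lam_ut: "ut w \<bullet> ut w = lam w"
  using oct_cross_triple[of "u (\<phi> w)" "us w" "ut w"] unfolding u_ut by (simp add: lam_def flip: ut_eq)

lemma lam_nonzero: "lam w \<noteq> 0" "lam w > 0"
  using du_nonzero[OF \<phi>] by (simp_all add: us_def lam_def)

text \<open>This closes the multiplication table of \<open>u\<close>, \<open>us\<close>,
  \<open>ut\<close>: they span an associative three-space.\<close>

lemma us_ut: "us w \<otimes> ut w = lam w *\<^sub>R u (\<phi> w)"
  unfolding ut_eq lam_def using oct_cross_antilinear(2)[of "u (\<phi> w)" "us w" "us w"]
  by (simp add: us_perp oct_cross.zero_right)

lemma du_us_ut: "dCP1 u \<phi> w Y = Re Y *\<^sub>R us w + Im Y *\<^sub>R ut w"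
  unfolding us_def ut_def by (rule du_complex[OF \<phi>])

lemma us_tangent: "us w \<in> tangent_image u (\<phi> w)" "ut w \<in> tangent_image u (\<phi> w)"
  by (simp_all add: us_def ut_def du_tangent \<phi>)

lemma ut_derivative: "frechet_derivative ut (at z) 1 = frechet_derivative us (at z) \<i>"
  unfolding us_def[abs_def] ut_def[abs_def] dCP1_def
  by (rule mixed_partials_commute[OF u_smooth_on[OF \<phi>]])

text \<open>The \<open>s\<close> derivative of \<open>us_ut\<close>. It lets
  \<open>CR_second\<close> trade the product of \<open>us\<close> with the mixed second derivative
  for the product of the pure one with \<open>ut\<close>.\<close>

lemma lam_derivative:
  "frechet_derivative us (at z) 1 \<otimes> ut z + us z \<otimes> frechet_derivative us (at z) \<i>
    = frechet_derivative lam (at z) 1 *\<^sub>R u (\<phi> z) + lam z *\<^sub>R us z"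
proof -
  have dl: "lam differentiable (at z)"
    unfolding lam_def by (intro differentiable_inner us_differentiable)
  have "((\<lambda>w. us w \<otimes> ut w) has_derivative (\<lambda>Y. us z \<otimes> frechet_derivative ut (at z) Y
      + frechet_derivative us (at z) Y \<otimes> ut z)) (at z)"
    by (intro oct_cross.FDERIV has_derivative_frechet us_differentiable)
  moreover have "((\<lambda>w. us w \<otimes> ut w) has_derivative (\<lambda>Y. lam z *\<^sub>R dCP1 u \<phi> z Y
      + frechet_derivative lam (at z) Y *\<^sub>R u (\<phi> z))) (at z)"
    unfolding us_ut
    by (intro bounded_bilinear.FDERIV[OF bounded_bilinear_scaleR] has_derivative_frechet dl
        u_has_derivative[OF \<phi>])
  ultimately have "us z \<otimes> frechet_derivative ut (at z) 1 + frechet_derivative us (at z) 1 \<otimes> ut z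
      = lam z *\<^sub>R dCP1 u \<phi> z 1 + frechet_derivative lam (at z) 1 *\<^sub>R u (\<phi> z)"
    by (rule fun_cong[OF has_derivative_unique])
  then show ?thesis
    by (simp add: ut_derivative us_def add.commute)
qed

end

end

context J0_connection_sphere
begin

context
  fixes \<phi> assumes \<phi>: "\<phi> \<in> CP1_charts"
begin

abbreviation "fs \<equiv> us \<phi>"
abbreviation "ft \<equiv> ut \<phi>"
abbreviation "fss z \<equiv> frechet_derivative fs (at z) 1"
abbreviation "fst' z \<equiv> frechet_derivative fs (at z) \<i>"

lemma smooth_fss: "smooth_on UNIV fss" "smooth_on UNIV fst'"
  by (intro smooth_on_frechet smooth_us \<phi>)+

lemma second_derivative_mixed: "frechet_derivative fst' (at z) 1 = frechet_derivative fss (at z) \<i>"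
  by (rule mixed_partials_commute[OF smooth_us(1)[OF \<phi>]])

lemma fss_differentiable: "fss differentiable (at z)" "fst' differentiable (at z)"
  using smooth_fss by (auto intro: smooth_on_differentiable)

text \<open>\<open>CR_derivative\<close> differentiated once more along \<open>s\<close>. The
  product of \<open>fss\<close> with \<open>ft\<close> enters with coefficient -1 and that of
  \<open>fs\<close> with \<open>fst'\<close> with coefficient -2; \<open>lam_derivative\<close>
  turns the latter into minus the former up to tangential and radial terms, so the total coefficient
  is +1.\<close>

lemma CR_second:
  "tproj (u (\<phi> z)) (frechet_derivative fss (at z) 1 + u (\<phi> z) \<otimes> frechet_derivative fss (at z) \<i>)
     = tproj (u (\<phi> z)) (fss z \<otimes> ft z) - (2 * lam \<phi> z) *\<^sub>R fs z"
proof -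
  define x where "x = u (\<phi> z)"
  have CR: "fss w + u (\<phi> w) \<otimes> fst' w + fs w \<otimes> ft w = 0" for w
    using CR_derivative[OF \<phi>, of 1 w 1] by (simp add: us_def[OF \<phi>, abs_def] ut_def[OF \<phi>, abs_def])
  have "((\<lambda>w. fss w + u (\<phi> w) \<otimes> fst' w + fs w \<otimes> ft w) has_derivative
     (\<lambda>Y. frechet_derivative fss (at z) Y + (u (\<phi> z) \<otimes> frechet_derivative fst' (at z) Y + dCP1 u \<phi> z Y \<otimes> fst' z)
        + (fs z \<otimes> frechet_derivative ft (at z) Y + frechet_derivative fs (at z) Y \<otimes> ft z))) (at z)"
    by (intro has_derivative_add oct_cross.FDERIV has_derivative_frechet fss_differentiable
        us_differentiable[OF \<phi>] u_has_derivative[OF \<phi>])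
  then have "((\<lambda>w. 0) has_derivative
     (\<lambda>Y. frechet_derivative fss (at z) Y + (u (\<phi> z) \<otimes> frechet_derivative fst' (at z) Y + dCP1 u \<phi> z Y \<otimes> fst' z)
        + (fs z \<otimes> frechet_derivative ft (at z) Y + frechet_derivative fs (at z) Y \<otimes> ft z))) (at z)"
    by (simp only: CR)
  then have "frechet_derivative fss (at z) 1 + (u (\<phi> z) \<otimes> frechet_derivative fst' (at z) 1 + dCP1 u \<phi> z 1 \<otimes> fst' z)
        + (fs z \<otimes> frechet_derivative ft (at z) 1 + fss z \<otimes> ft z) = 0"
    by (rule fun_cong[OF has_derivative_unique[OF _ has_derivative_const]])
  then have "frechet_derivative fss (at z) 1 + x \<otimes> frechet_derivative fss (at z) \<i>
      = - 2 *\<^sub>R (fs z \<otimes> fst' z) - fss z \<otimes> ft z"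
    unfolding second_derivative_mixed ut_derivative[OF \<phi>] us_def[OF \<phi>, symmetric] x_def
    by (simp add: algebra_simps add_eq_0_iff2 scaleR_2)
  also have "fs z \<otimes> fst' z = frechet_derivative (lam \<phi>) (at z) 1 *\<^sub>R x + lam \<phi> z *\<^sub>R fs z - fss z \<otimes> ft z"
    using lam_derivative[OF \<phi>, of z] by (simp add: x_def algebra_simps)
  finally have "frechet_derivative fss (at z) 1 + x \<otimes> frechet_derivative fss (at z) \<i>
     = fss z \<otimes> ft z - (2 * lam \<phi> z) *\<^sub>R fs z - (2 * frechet_derivative (lam \<phi>) (at z) 1) *\<^sub>R x"
    by (simp add: algebra_simps scaleR_2)
  moreover have "tproj x x = 0" "tproj x (fs z) = fs z"
    by (simp_all add: x_def tproj_def us_perp[OF \<phi>])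
  ultimately show ?thesis
    unfolding x_def[symmetric]
    by (simp add: linear_diff[OF tproj_linear] linear_cmul[OF tproj_linear])
qed

text \<open>By \<open>CR_second\<close> the derivative terms leave the product of \<open>fss\<close>
  and \<open>ft\<close>, and by antilinearity the zero-order term subtracts the same product. Only
  multiples of \<open>fs\<close> survive, which vanish in the quotient.\<close>

lemma dbar_second_derivative:
  assumes s: "is_lift u s \<xi>" and \<xi>: "\<And>z. \<xi> (\<phi> z) = tproj (u (\<phi> z)) (fss z)"
  shows "dbar_N nabla u s \<phi> z 1 = quot_proj u (\<phi> z) 0"
proof -
  define x where "x = u (\<phi> z)"
  define k where "k w = fss w \<bullet> u (\<phi> w)" for w
  have x1: "x \<bullet> x = 1" by (simp add: x_def)
  have \<xi>k: "\<xi> (\<phi> w) = fss w - k w *\<^sub>R u (\<phi> w)" for w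
    by (simp add: \<xi> tproj_def k_def)
  have kd: "k differentiable (at z)"
    unfolding k_def by (intro differentiable_inner fss_differentiable u_differentiable[OF \<phi>])
  have D: "dCP1 \<xi> \<phi> z Y = frechet_derivative fss (at z) Y
      - (k z *\<^sub>R dCP1 u \<phi> z Y + frechet_derivative k (at z) Y *\<^sub>R x)" for Y
    unfolding dCP1_def[of \<xi>] \<xi>k x_def
    by (intro frechet_derivativeI has_derivative_diff bounded_bilinear.FDERIV[OF bounded_bilinear_scaleR]
      has_derivative_frechet fss_differentiable kd u_has_derivative[OF \<phi>])
  have du: "dCP1 u \<phi> z 1 = fs z" "dCP1 u \<phi> z \<i> = ft z"
    by (simp_all add: us_def[OF \<phi>] ut_def[OF \<phi>])
  have t: "tproj x x = 0" "tproj x (fs z) = fs z" "\<And>v. tproj x (x \<otimes> v) = x \<otimes> v"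
    by (simp_all add: x_def tproj_def us_perp[OF \<phi>])
  have p: "x \<bullet> fs z = 0" "x \<bullet> \<xi> (\<phi> z) = 0"
    using tproj_inner[of x "fss z"] x1
    by (simp_all add: x_def us_perp[OF \<phi>] \<xi> inner_commute[of "u (\<phi> z)" "tproj _ _"])
  have "tproj x (dCP1 \<xi> \<phi> z 1) + x \<otimes> dCP1 \<xi> \<phi> z \<i>
      = tproj x (frechet_derivative fss (at z) 1 + x \<otimes> frechet_derivative fss (at z) \<i>)"
    unfolding D du
    by (simp add: t oct_cross_simps linear_diff[OF tproj_linear] linear_cmul[OF tproj_linear]
        linear_add[OF tproj_linear] u_ut[OF \<phi>, of z, folded x_def])
  also have "\<dots> = tproj x (fss z \<otimes> ft z) - (2 * lam \<phi> z) *\<^sub>R fs z"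
    unfolding x_def by (rule CR_second)
  finally have 1: "tproj x (dCP1 \<xi> \<phi> z 1) + x \<otimes> dCP1 \<xi> \<phi> z \<i>
    = tproj x (fss z \<otimes> ft z) - (2 * lam \<phi> z) *\<^sub>R fs z" .
  have "x \<otimes> (fs z \<otimes> \<xi> (\<phi> z)) = - ((x \<otimes> fs z) \<otimes> \<xi> (\<phi> z)) - (fs z \<bullet> \<xi> (\<phi> z)) *\<^sub>R x"
    using oct_cross_antilinear(1)[OF p] by simp
  also have "x \<otimes> fs z = ft z"
    by (simp add: x_def ut_eq[OF \<phi>])
  finally have "tproj x (x \<otimes> (fs z \<otimes> \<xi> (\<phi> z))) = - tproj x (ft z \<otimes> \<xi> (\<phi> z))"
    by (simp add: linear_diff[OF tproj_linear] linear_cmul[OF tproj_linear] linear_neg[OF tproj_linear] t(1))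
  then have "x \<otimes> (fs z \<otimes> \<xi> (\<phi> z)) = - tproj x (ft z \<otimes> \<xi> (\<phi> z))"
    by (simp add: t(3))
  also have "ft z \<otimes> \<xi> (\<phi> z) = ft z \<otimes> fss z - k z *\<^sub>R fs z"
    unfolding \<xi>k using u_ut[OF \<phi>, of z] oct_cross_skew[of "ft z" "u (\<phi> z)"] by (simp add: oct_cross_simps)
  also have "tproj x \<dots> = - tproj x (fss z \<otimes> ft z) - k z *\<^sub>R fs z"
    by (simp add: linear_diff[OF tproj_linear] linear_cmul[OF tproj_linear] t(2)
        oct_cross_skew[of "ft z" "fss z"] linear_neg[OF tproj_linear])
  finally have 2: "x \<otimes> (fs z \<otimes> \<xi> (\<phi> z)) = tproj x (fss z \<otimes> ft z) + k z *\<^sub>R fs z"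
    by simp
  have "dbar_N nabla u s \<phi> z 1 = quot_proj u (\<phi> z) ((1/2) *\<^sub>R (tproj x (dCP1 \<xi> \<phi> z 1)
     + x \<otimes> dCP1 \<xi> \<phi> z \<i> - x \<otimes> (fs z \<otimes> \<xi> (\<phi> z))))"
    using dbar_N_lift[OF s \<phi>, of z 1] by (simp add: x_def du)
  also have "\<dots> = quot_proj u (\<phi> z) ((1/2) *\<^sub>R (- (2 * lam \<phi> z) *\<^sub>R fs z - k z *\<^sub>R fs z))"
    unfolding 1 2 by simp
  also have "\<dots> = quot_proj u (\<phi> z) 0"
    unfolding quot_proj_eq_iff diff_0_right by (simp only: tangent_image_intros us_tangent[OF \<phi>])
  finally show ?thesis .
qed

text \<open>After projection, the differentiated Cauchy-Riemann equation makes each \<open>t\<close>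
  derivative \<open>J0\<close> times the corresponding \<open>s\<close> derivative. So all second
  derivatives arise from \<open>fss\<close> by applying \<open>J0\<close>, which preserves the
  tangent plane.\<close>

lemma second_derivatives_tangent:
  assumes "tproj (u (\<phi> z)) (fss z) \<in> tangent_image u (\<phi> z)"
  shows "tproj (u (\<phi> z)) (frechet_derivative (\<lambda>w. dCP1 u \<phi> w Z) (at z) Y) \<in> tangent_image u (\<phi> z)"
proof -
  define x where "x = u (\<phi> z)"
  define T where "T = tangent_image u (\<phi> z)"
  have sw: "tproj x (frechet_derivative (\<lambda>w. dCP1 u \<phi> w V) (at z) \<i>)
       = x \<otimes> tproj x (frechet_derivative (\<lambda>w. dCP1 u \<phi> w V) (at z) 1)" for V
  proof -
    have "x \<otimes> (dCP1 u \<phi> z V \<otimes> ft z) = 0"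
      by (simp add: du_us_ut[OF \<phi>] oct_cross_simps us_ut[OF \<phi>] x_def)
    then have "x \<otimes> (frechet_derivative (\<lambda>w. dCP1 u \<phi> w V) (at z) 1
      + x \<otimes> frechet_derivative (\<lambda>w. dCP1 u \<phi> w V) (at z) \<i>) = 0"
      using arg_cong[OF CR_derivative[OF \<phi>, of V z 1], of "(\<otimes>) x"]
      by (simp add: x_def oct_cross_simps ut_def[OF \<phi>])
    then show ?thesis
      by (simp add: oct_cross_simps oct_cross_cross_self tproj_def x_def inner_commute algebra_simps)
  qed
  have J: "v \<in> T \<Longrightarrow> x \<otimes> v \<in> T" for v
    unfolding T_def x_def by (rule tangent_image_J)
  have ss: "tproj x (fss z) \<in> T" using assms by (simp add: x_def T_def)
  have st: "tproj x (fst' z) \<in> T"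
    using sw[of 1] J[OF ss] by (simp add: us_def[OF \<phi>, abs_def])
  have tt: "tproj x (frechet_derivative ft (at z) \<i>) \<in> T"
    using sw[of \<i>] J[OF st] by (simp add: ut_def[OF \<phi>, abs_def, symmetric] ut_derivative[OF \<phi>])
  have ts: "tproj x (frechet_derivative ft (at z) 1) \<in> T"
    using st by (simp add: ut_derivative[OF \<phi>])
  have "frechet_derivative (\<lambda>w. dCP1 u \<phi> w Z) (at z) Y
      = Re Z *\<^sub>R frechet_derivative fs (at z) Y + Im Z *\<^sub>R frechet_derivative ft (at z) Y"
    unfolding du_us_ut[OF \<phi>]
    by (intro frechet_derivativeI has_derivative_add has_derivative_scaleR_right has_derivative_frechet
        us_differentiable[OF \<phi>])
  also have "\<dots> = Re Z *\<^sub>R (Re Y *\<^sub>R fss z + Im Y *\<^sub>R fst' z)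
      + Im Z *\<^sub>R (Re Y *\<^sub>R frechet_derivative ft (at z) 1 + Im Y *\<^sub>R frechet_derivative ft (at z) \<i>)"
    by (simp only: frechet_derivative_complex[OF us_differentiable(1)[OF \<phi>], of _ Y]
        frechet_derivative_complex[OF us_differentiable(2)[OF \<phi>], of _ Y])
  finally have "tproj x (frechet_derivative (\<lambda>w. dCP1 u \<phi> w Z) (at z) Y)
     = Re Z *\<^sub>R (Re Y *\<^sub>R tproj x (fss z) + Im Y *\<^sub>R tproj x (fst' z))
      + Im Z *\<^sub>R (Re Y *\<^sub>R tproj x (frechet_derivative ft (at z) 1) + Im Y *\<^sub>R tproj x (frechet_derivative ft (at z) \<i>))"
    by (simp only: linear_add[OF tproj_linear] linear_cmul[OF tproj_linear])
  also have "\<dots> \<in> T"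
    unfolding T_def
    by (simp only: tangent_image_intros ss[unfolded T_def] st[unfolded T_def] ts[unfolded T_def] tt[unfolded T_def])
  finally show ?thesis by (simp only: x_def T_def)
qed

end

lemma second_fundamental_form_eq_0_iff:
  "second_fundamental_form u \<phi> z Y Z = 0 \<longleftrightarrow>
     tproj (u (\<phi> z)) (frechet_derivative (\<lambda>w. dCP1 u \<phi> w Z) (at z) Y) \<in> tangent_image u (\<phi> z)"
proof -
  have "closed (tangent_image u p)" "tangent_image u p \<noteq> {}" for p
    using closed_subspace[OF subspace_tangent_image, of p] subspace_0[OF subspace_tangent_image, of p] by blast+
  then have "a - closest_point (tangent_image u p) a = 0 \<longleftrightarrow> a \<in> tangent_image u p" for a p
    using closest_point_in_set closest_point_self by (metis eq_iff_diff_eq_0)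
  then show ?thesis
    by (simp add: second_fundamental_form_def Let_def)
qed

lemma quot_0_fibre: "quot_proj u p 0 \<in> normal_fibre u p"
  by (simp add: normal_fibre_def TS6_def)

lemma quot_proj_fibre: "v \<in> TS6 (u p) \<Longrightarrow> quot_proj u p v \<in> normal_fibre u p"
  by (simp add: normal_fibre_def)

text \<open>The second derivative of \<open>u\<close> along \<open>d/dz\<close> represents a holomorphic section of the normal bundle
  that vanishes at infinity. A holomorphic embedding of the normal bundle into a trivial bundle, such
  as the one given by the tautological bundle, turns it into a bounded entire function.\<close>

lemma iso_imp_tangent:
  assumes iso: "holomorphic_iso nabla u \<Phi>" and pair: "chart_pair \<phi> \<psi>"
  shows "tproj (u (\<phi> z)) (frechet_derivative (us \<phi>) (at z) 1) \<in> tangent_image u (\<phi> z)"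
proof -
  interpret chart_pair \<phi> \<psi> by (rule pair)
  \<comment> \<open>Two derivatives along \<open>d/dz\<close>: in the chart this is the projected
    pure second derivative, and \<open>smooth_vderiv\<close> makes it smooth across the missing
    point, where it is zero.\<close>
  define \<xi> where "\<xi> p = tproj (u p) (vderiv (vderiv u) p)" for p
  define s where "s p = quot_proj u p (\<xi> p)" for p
  define F where "F p = \<Phi> p (s p)" for p
  have \<xi>\<phi>: "\<xi> (\<phi> z) = tproj (u (\<phi> z)) (frechet_derivative (us \<phi>) (at z) 1)" for z
    unfolding \<xi>_def vderiv_\<phi> dCP1_def[of "vderiv u"] us_def[OF chart_in(1), abs_def] ..
  have \<xi>_inf: "\<xi> (\<psi> 0) = 0"
    by (simp add: \<xi>_def vderiv_def tproj_def)
  have ps: "pullback_section u \<xi>"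
    unfolding pullback_section_def smooth_CP1_def
  proof (intro conjI ballI allI)
    fix \<kappa> assume \<kappa>: "\<kappa> \<in> CP1_charts"
    have v: "smooth_on UNIV (\<lambda>z. vderiv (vderiv u) (\<kappa> z))"
      using smooth_vderiv[OF smooth_vderiv[OF smooth_u]] \<kappa> by (simp add: smooth_CP1_def)
    show "smooth_on UNIV (\<lambda>z. \<xi> (\<kappa> z))"
      unfolding \<xi>_def tproj_def
      by (intro smooth_on_diff smooth_on_bilinear[OF _ bounded_bilinear_scaleR]
          smooth_on_bilinear[OF _ bounded_bilinear_inner] v u_smooth_on \<kappa> open_UNIV)
  qed (simp add: \<xi>_def TS6_def)
  have lift: "is_lift u s \<xi>"
    by (simp add: is_lift_def ps s_def)
  then have sec: "normal_section u s" by (auto simp: normal_section_def)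
  have add: "\<Phi> p (normal_add A B) = \<Phi> p A + \<Phi> p B" if "A \<in> normal_fibre u p" "B \<in> normal_fibre u p" for p A B
    using iso that by (simp add: holomorphic_iso_def)
  have \<Phi>0: "\<Phi> p (quot_proj u p 0) = 0" for p
    using add[OF quot_0_fibre quot_0_fibre, of p] by (simp add: normal_add_quot)
  have smF: "smooth_CP1 F"
    using iso sec unfolding holomorphic_iso_def F_def by blast
  then have smF': "smooth_on UNIV (\<lambda>z. F (\<phi> z))" "smooth_on UNIV (\<lambda>z. F (\<psi> z))"
    by (auto simp: smooth_CP1_iff)
  have "dbar_taut2 F \<phi> z 1 = 0" for z
  proof -
    have "\<Phi> (\<phi> z) (dbar_N nabla u s \<phi> z 1) = dbar_taut2 F \<phi> z 1"
      using iso sec chart_in(1) unfolding holomorphic_iso_def F_def by blast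
    then show ?thesis
      by (simp add: dbar_second_derivative[OF chart_in(1) lift \<xi>\<phi>] \<Phi>0)
  qed
  then have CR: "frechet_derivative (\<lambda>z. F (\<phi> z)) (at z) 1
      + cscale2 \<i> (frechet_derivative (\<lambda>z. F (\<phi> z)) (at z) \<i>) = 0" for z
    by (simp add: dbar_taut2_def dCP1_def)
  \<comment> \<open>\<open>L\<close> will be one of the four coordinates of the trivial bundle.
    Applied to \<open>F\<close> it is entire with limit \<open>L (F (\<psi> 0)) = 0\<close> at
    infinity, hence zero.\<close>
  have L0: "L (F (\<phi> z)) = 0" if L: "bounded_linear L" "\<And>c a. L (cscale2 c a) = c * L a"
    for L :: "(complex^2) \<times> (complex^2) \<Rightarrow> complex"
  proof (rule Liouville_weak_0[where f = "\<lambda>z. L (F (\<phi> z))"])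
    have D: "((\<lambda>z. L (F (\<phi> z))) has_derivative
        (\<lambda>Y. L (frechet_derivative (\<lambda>z. F (\<phi> z)) (at z) Y))) (at z)" for z
      by (intro bounded_linear.has_derivative[OF L(1)] has_derivative_frechet
          smooth_on_differentiable[OF smF'(1)] UNIV_I)
    show "(\<lambda>z. L (F (\<phi> z))) holomorphic_on UNIV"
    proof (rule holomorphic_CR)
      show "(\<lambda>z. L (F (\<phi> z))) differentiable (at z)" for z
        using D differentiable_def by blast
      show "frechet_derivative (\<lambda>z. L (F (\<phi> z))) (at z) 1
          + \<i> * frechet_derivative (\<lambda>z. L (F (\<phi> z))) (at z) \<i> = 0" for z
        unfolding frechet_derivativeI[OF D] L(2)[symmetric]
        using arg_cong[OF CR[of z], of L]
        by (simp only: linear_add[OF bounded_linear.linear[OF L(1)]] linear_0[OF bounded_linear.linear[OF L(1)]])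
    qed
    have "((\<lambda>z. L (F (\<phi> z))) \<longlongrightarrow> L (F (\<psi> 0))) at_infinity"
    proof (rule tendsto_inverse_chart)
      show "isCont (\<lambda>w. L (F (\<psi> w))) 0"
        using smooth_on_continuous_on[OF smooth_on_bounded_linear[OF open_UNIV L(1) smF'(2)]]
        by (simp add: continuous_on_eq_continuous_at)
    qed (simp add: chart_transition(2))
    moreover have "F (\<psi> 0) = 0"
      by (simp add: F_def s_def \<xi>_inf \<Phi>0)
    ultimately show "((\<lambda>z. L (F (\<phi> z))) \<longlongrightarrow> 0) at_infinity"
      by (simp add: linear_0[OF bounded_linear.linear[OF L(1)]])
  qed
  have bl: "bounded_linear (\<lambda>a :: (complex^2) \<times> (complex^2). fst a $ i)"
    "bounded_linear (\<lambda>a :: (complex^2) \<times> (complex^2). snd a $ i)" for i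
    by (intro bounded_linear_compose[OF bounded_linear_vec_nth] bounded_linear_fst bounded_linear_snd)+
  have "fst (F (\<phi> z)) $ i = 0" "snd (F (\<phi> z)) $ i = 0" for i
    by (rule L0[OF bl(1)], simp add: cscale2_def, rule L0[OF bl(2)], simp add: cscale2_def)
  then have "F (\<phi> z) = 0"
    by (simp add: prod_eq_iff vec_eq_iff)
  then have "\<Phi> (\<phi> z) (s (\<phi> z)) = \<Phi> (\<phi> z) (quot_proj u (\<phi> z) 0)"
    by (simp add: F_def \<Phi>0)
  moreover have "inj_on (\<Phi> (\<phi> z)) (normal_fibre u (\<phi> z))"
    using iso by (auto simp: holomorphic_iso_def bij_betw_def)
  moreover have "s (\<phi> z) \<in> normal_fibre u (\<phi> z)"
    using ps by (simp add: s_def quot_proj_fibre pullback_section_def)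
  ultimately have "s (\<phi> z) = quot_proj u (\<phi> z) 0"
    using quot_0_fibre inj_onD by metis
  then show ?thesis
    by (simp add: s_def quot_proj_eq_iff \<xi>\<phi>)
qed

theorem iso_imp_totally_geodesic:
  assumes "normal_bundle_iso_taut2 nabla u"
  shows "totally_geodesic u"
  unfolding totally_geodesic_def
proof (intro ballI allI)
  fix \<phi> z Y Z assume \<phi>: "\<phi> \<in> CP1_charts"
  obtain \<Phi> where iso: "holomorphic_iso nabla u \<Phi>"
    using assms by (auto simp: normal_bundle_iso_taut2_def)
  obtain \<psi> where pair: "chart_pair \<phi> \<psi>" using chart_pair_exists[OF \<phi>] by blast
  show "second_fundamental_form u \<phi> z Y Z = 0"
    unfolding second_fundamental_form_eq_0_iff
    by (rule second_derivatives_tangent[OF \<phi> iso_imp_tangent[OF iso pair]])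
qed

end

section \<open>Totally geodesic spheres\<close>

text \<open>A pair \<open>(a, b)\<close> stands for \<open>a + i b\<close> in the complexified
  imaginary octonions. \<open>cmul\<close> and \<open>cdot\<close> are complex bilinear; as
  \<open>cdot\<close> is not Hermitian, it has nonzero null vectors.\<close>

definition cscale :: "complex \<Rightarrow> imoct \<times> imoct \<Rightarrow> imoct \<times> imoct" where
  "cscale c X = (Re c *\<^sub>R fst X - Im c *\<^sub>R snd X, Re c *\<^sub>R snd X + Im c *\<^sub>R fst X)"

definition cmul :: "imoct \<times> imoct \<Rightarrow> imoct \<times> imoct \<Rightarrow> imoct \<times> imoct" where
  "cmul X Y = (fst X \<otimes> fst Y - snd X \<otimes> snd Y, fst X \<otimes> snd Y + snd X \<otimes> fst Y)"

definition cdot :: "imoct \<times> imoct \<Rightarrow> imoct \<times> imoct \<Rightarrow> complex" where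
  "cdot X Y = Complex (fst X \<bullet> fst Y - snd X \<bullet> snd Y) (fst X \<bullet> snd Y + snd X \<bullet> fst Y)"

lemma cscale_simps:
  "cscale 1 X = X" "cscale 0 X = 0" "cscale c 0 = 0" "cscale a (cscale b X) = cscale (a * b) X"
  "cscale (- c) X = - cscale c X"
  by (simp_all add: cscale_def prod_eq_iff algebra_simps)

lemma cscale_eq_0_iff: "cscale c X = 0 \<longleftrightarrow> c = 0 \<or> X = 0"
proof
  assume 0: "cscale c X = 0"
  show "c = 0 \<or> X = 0"
  proof (cases "c = 0")
    case False
    have "X = cscale (inverse c) (cscale c X)"
      using False by (simp add: cscale_simps)
    then show ?thesis by (simp add: 0 cscale_simps)
  qed simp
qed (auto simp: cscale_simps)

lemma cmul_linear:
  "cmul (X + Y) Z = cmul X Z + cmul Y Z" "cmul X (Y + Z) = cmul X Y + cmul X Z"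
  "cmul (cscale c X) Y = cscale c (cmul X Y)" "cmul X (cscale c Y) = cscale c (cmul X Y)"
  "cmul (- X) Y = - cmul X Y" "cmul X (- Y) = - cmul X Y" "cmul X 0 = 0" "cmul 0 X = 0"
  by (simp_all add: cmul_def cscale_def prod_eq_iff oct_cross_simps algebra_simps)

lemma cdot_linear:
  "cdot (X + Y) Z = cdot X Z + cdot Y Z" "cdot X (Y + Z) = cdot X Y + cdot X Z"
  "cdot (cscale c X) Y = c * cdot X Y" "cdot X (cscale c Y) = c * cdot X Y"
  "cdot (- X) Y = - cdot X Y" "cdot X (- Y) = - cdot X Y" "cdot X 0 = 0" "cdot 0 X = 0"
  by (simp_all add: cdot_def cscale_def complex_eq_iff inner_simps algebra_simps)

lemma cdot_commute: "cdot X Y = cdot Y X"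
  by (simp add: cdot_def inner_commute)

lemma cdot_cmul_skew: "cdot (cmul X Y) Z = - cdot Y (cmul X Z)"
  using oct_cross_triple[of "fst X" "fst Y" "fst Z"] oct_cross_triple[of "fst X" "fst Y" "snd Z"]
    oct_cross_triple[of "fst X" "snd Y" "fst Z"] oct_cross_triple[of "fst X" "snd Y" "snd Z"]
    oct_cross_triple[of "snd X" "fst Y" "fst Z"] oct_cross_triple[of "snd X" "fst Y" "snd Z"]
    oct_cross_triple[of "snd X" "snd Y" "fst Z"] oct_cross_triple[of "snd X" "snd Y" "snd Z"]
  by (simp add: cdot_def cmul_def complex_eq_iff inner_simps inner_commute)

text \<open>The eight conditions make the real and imaginary parts of \<open>n\<close> orthogonal to
  those of \<open>X\<close> and \<open>Y\<close>, which removes the two extra terms of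
  \<open>oct_cross_clifford\<close>.\<close>

lemma cmul_clifford:
  assumes "fst X \<bullet> fst n = 0" "fst X \<bullet> snd n = 0" "snd X \<bullet> fst n = 0" "snd X \<bullet> snd n = 0"
    "fst Y \<bullet> fst n = 0" "fst Y \<bullet> snd n = 0" "snd Y \<bullet> fst n = 0" "snd Y \<bullet> snd n = 0"
  shows "cmul X (cmul Y n) + cmul Y (cmul X n) = cscale (- 2 * cdot X Y) n"
proof -
  have c: "a \<otimes> (b \<otimes> v) = - (2 * (a \<bullet> b)) *\<^sub>R v - b \<otimes> (a \<otimes> v)" if "a \<bullet> v = 0" "b \<bullet> v = 0" for a b v
    using oct_cross_clifford[of a b v] that by (simp add: algebra_simps)
  show ?thesis
    using c[of "fst X" "fst n" "fst Y"] c[of "fst X" "snd n" "fst Y"]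
      c[of "fst X" "fst n" "snd Y"] c[of "fst X" "snd n" "snd Y"]
      c[of "snd X" "fst n" "fst Y"] c[of "snd X" "snd n" "fst Y"]
      c[of "snd X" "fst n" "snd Y"] c[of "snd X" "snd n" "snd Y"] assms
    by (simp add: cmul_def cdot_def cscale_def prod_eq_iff oct_cross_simps)
       (simp add: algebra_simps)
qed

text \<open>The relation with \<open>h\<close> bounds \<open>f\<close> by a multiple of
  \<open>|z|^2\<close> near infinity, so \<open>f\<close> is a polynomial of degree at most two. The
  limit at infinity identifies the leading coefficient as \<open>- h 0\<close>, and the value at 1
  then gives the middle one.\<close>

lemma quadratic_of_growth:
  fixes f h :: "complex \<Rightarrow> complex"
  assumes f: "f holomorphic_on UNIV" and h: "isCont h 0"
    and fh: "\<And>z. z \<noteq> 0 \<Longrightarrow> f z = - (z\<^sup>2) * h (1 / z)"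
  shows "f z = f 0 + (f 1 - f 0 + h 0) * z - h 0 * z\<^sup>2"
proof -
  have lim: "((\<lambda>z. - f z / z\<^sup>2) \<longlongrightarrow> h 0) at_infinity"
    by (rule tendsto_inverse_chart[OF h]) (simp add: fh)
  then have "((\<lambda>z. norm (- f z / z\<^sup>2)) \<longlongrightarrow> norm (h 0)) at_infinity"
    by (rule tendsto_norm)
  then have "eventually (\<lambda>z. norm (- f z / z\<^sup>2) < norm (h 0) + 1) at_infinity"
    by (rule order_tendstoD) simp
  then obtain R where R: "\<And>z. R \<le> norm z \<Longrightarrow> norm (- f z / z\<^sup>2) < norm (h 0) + 1"
    by (auto simp: eventually_at_infinity)
  have bound: "norm (f z) \<le> (norm (h 0) + 1) * norm z ^ 2" if "max R 1 \<le> norm z" for z :: complex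
  proof -
    have "z \<noteq> 0" using that by auto
    then have "norm (f z) = norm (- f z / z\<^sup>2) * norm z ^ 2"
      by (simp add: norm_divide norm_power)
    also have "\<dots> \<le> (norm (h 0) + 1) * norm z ^ 2"
      using R[of z] that by (intro mult_right_mono) auto
    finally show ?thesis .
  qed
  define a b c where "a = f 0" and "b = deriv f 0" and "c = deriv (deriv f) 0 / 2"
  have abc: "f z = a + b * z + c * z\<^sup>2" for z
  proof -
    have "f z = (\<Sum>k\<le>2. (deriv ^^ k) f 0 / fact k * z ^ k)"
      by (rule Liouville_polynomial[OF f, of "max R 1" "norm (h 0) + 1"]) (rule bound)
    then show ?thesis
      by (simp add: numeral_2_eq_2 a_def b_def c_def)
  qed
  have "((\<lambda>w. - (a * w\<^sup>2 + b * w + c)) \<longlongrightarrow> - (a * 0\<^sup>2 + b * 0 + c)) (at 0)"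
    by (intro tendsto_intros)
  moreover have "eventually (\<lambda>w. - (a * w\<^sup>2 + b * w + c) = h w) (at 0)"
    unfolding eventually_at
  proof (intro exI[of _ 1] conjI ballI impI)
    fix w :: complex assume "w \<noteq> 0 \<and> dist w 0 < 1"
    then have w: "w \<noteq> 0" by simp
    from fh[of "1 / w"] w have "h w = - (w\<^sup>2 * f (1 / w))"
      by (simp add: power2_eq_square field_simps)
    also have "w\<^sup>2 * f (1 / w) = a * w\<^sup>2 + b * w + c"
      using w by (simp add: abc power2_eq_square field_simps)
    finally show "- (a * w\<^sup>2 + b * w + c) = h w" by simp
  qed simp
  ultimately have "(h \<longlongrightarrow> - c) (at 0)"
    by (auto intro: Lim_transform_eventually)
  then have "h 0 = - c"
    using h LIM_unique isCont_def by blast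
  then show ?thesis
    by (simp add: abc algebra_simps)
qed

section \<open>Structure equations and the holomorphic null curve\<close>

locale totally_geodesic_sphere = J0_connection_sphere +
  assumes tg: "totally_geodesic u"
begin

context
  fixes \<phi> assumes \<phi>: "\<phi> \<in> CP1_charts"
begin

text \<open>By \<open>lam_derivatives\<close> these are half the logarithmic derivatives of
  \<open>lam \<phi>\<close>: \<open>cP\<close> the one along \<open>s\<close>, \<open>cQ\<close>
  minus the one along \<open>t\<close>.\<close>

definition "cP z = (frechet_derivative (us \<phi>) (at z) 1 \<bullet> us \<phi> z) / lam \<phi> z"
definition "cQ z = (frechet_derivative (us \<phi>) (at z) 1 \<bullet> ut \<phi> z) / lam \<phi> z"

text \<open>A vanishing second fundamental form leaves only a radial component besides the
  tangential one; differentiating \<open>us . u = 0\<close> identifies its coefficient as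
  \<open>- lam\<close>.\<close>

lemma structure_ss:
  "frechet_derivative (us \<phi>) (at z) 1 = cP z *\<^sub>R us \<phi> z + cQ z *\<^sub>R ut \<phi> z - lam \<phi> z *\<^sub>R u (\<phi> z)"
proof -
  define a where "a = frechet_derivative (us \<phi>) (at z) 1"
  have "second_fundamental_form u \<phi> z 1 1 = 0"
    using tg \<phi> by (simp add: totally_geodesic_def)
  then have "tproj (u (\<phi> z)) a \<in> range (dCP1 u \<phi> z)"
    by (simp add: second_fundamental_form_eq_0_iff tangent_image_eq[OF \<phi>] a_def us_def[OF \<phi>, abs_def])
  then obtain Y where "tproj (u (\<phi> z)) a = Re Y *\<^sub>R us \<phi> z + Im Y *\<^sub>R ut \<phi> z"
    by (auto simp: du_us_ut[OF \<phi>])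
  then have a: "a = Re Y *\<^sub>R us \<phi> z + Im Y *\<^sub>R ut \<phi> z + (a \<bullet> u (\<phi> z)) *\<^sub>R u (\<phi> z)"
    by (simp add: tproj_def algebra_simps)
  have "((\<lambda>w. us \<phi> w \<bullet> u (\<phi> w)) has_derivative (\<lambda>Y. us \<phi> z \<bullet> dCP1 u \<phi> z Y
      + frechet_derivative (us \<phi>) (at z) Y \<bullet> u (\<phi> z))) (at z)"
    by (intro has_derivative_inner has_derivative_frechet us_differentiable u_has_derivative \<phi>)
  then have "((\<lambda>w. 0) has_derivative (\<lambda>Y. us \<phi> z \<bullet> dCP1 u \<phi> z Y
      + frechet_derivative (us \<phi>) (at z) Y \<bullet> u (\<phi> z))) (at z)"
    by (simp only: us_perp[OF \<phi>])
  then have "us \<phi> z \<bullet> dCP1 u \<phi> z 1 + a \<bullet> u (\<phi> z) = 0"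
    unfolding a_def by (rule fun_cong[OF has_derivative_unique[OF _ has_derivative_const]])
  then have au: "a \<bullet> u (\<phi> z) = - lam \<phi> z"
    by (simp add: lam_def[OF \<phi>] us_def[OF \<phi>])
  have "a \<bullet> us \<phi> z = Re Y * lam \<phi> z" "a \<bullet> ut \<phi> z = Im Y * lam \<phi> z"
    by (subst a, simp add: inner_simps us_perp[OF \<phi>] lam_ut[OF \<phi>] lam_def[OF \<phi>])+
  then have "cP z = Re Y" "cQ z = Im Y"
    using lam_nonzero[OF \<phi>, of z] by (simp_all add: cP_def cQ_def flip: a_def)
  with a au show ?thesis by (simp add: a_def)
qed

lemma ut_has_derivative: "frechet_derivative (ut \<phi>) (at z) Y
    = u (\<phi> z) \<otimes> frechet_derivative (us \<phi>) (at z) Y + dCP1 u \<phi> z Y \<otimes> us \<phi> z"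
  unfolding ut_eq[OF \<phi>, abs_def]
  by (intro frechet_derivativeI oct_cross.FDERIV has_derivative_frechet us_differentiable u_has_derivative \<phi>)

lemma structure_st:
  "frechet_derivative (us \<phi>) (at z) \<i> = cP z *\<^sub>R ut \<phi> z - cQ z *\<^sub>R us \<phi> z"
proof -
  have "frechet_derivative (us \<phi>) (at z) \<i> = u (\<phi> z) \<otimes> frechet_derivative (us \<phi>) (at z) 1"
    using ut_has_derivative[of z 1] by (simp add: ut_derivative[OF \<phi>] us_def[OF \<phi>])
  then show ?thesis
    by (simp add: structure_ss oct_cross_simps u_ut[OF \<phi>] flip: ut_eq[OF \<phi>])
qed

lemma structure_tt:
  "frechet_derivative (ut \<phi>) (at z) \<i> = - cP z *\<^sub>R us \<phi> z - cQ z *\<^sub>R ut \<phi> z - lam \<phi> z *\<^sub>R u (\<phi> z)"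
  using ut_has_derivative[of z \<i>] oct_cross_skew[of "ut \<phi> z" "us \<phi> z"]
  by (simp add: structure_st oct_cross_simps u_ut[OF \<phi>] us_ut[OF \<phi>]
      flip: ut_eq[OF \<phi>] ut_def[OF \<phi>])

lemma lam_has_derivative: "(lam \<phi> has_derivative (\<lambda>Y. 2 * (us \<phi> z \<bullet> frechet_derivative (us \<phi>) (at z) Y))) (at z)"
proof -
  have "((\<lambda>w. us \<phi> w \<bullet> us \<phi> w) has_derivative (\<lambda>Y. us \<phi> z \<bullet> frechet_derivative (us \<phi>) (at z) Y
      + frechet_derivative (us \<phi>) (at z) Y \<bullet> us \<phi> z)) (at z)"
    by (intro has_derivative_inner has_derivative_frechet us_differentiable \<phi>)
  then show ?thesis
    by (simp add: lam_def[OF \<phi>, abs_def] inner_commute)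
qed

lemma lam_derivatives:
  "2 * (us \<phi> z \<bullet> frechet_derivative (us \<phi>) (at z) 1) = 2 * lam \<phi> z * cP z"
  "2 * (us \<phi> z \<bullet> frechet_derivative (us \<phi>) (at z) \<i>) = - 2 * lam \<phi> z * cQ z"
  by (simp_all add: structure_ss structure_st inner_simps us_perp[OF \<phi>] flip: lam_def[OF \<phi>])

text \<open>\<open>G\<close> is the complexified vector \<open>(u\<^sub>s + \<i> u\<^sub>t) / |u\<^sub>s|\<^sup>2\<close>. For a totally geodesic sphere it is
  holomorphic; being a section of the square of the hyperplane bundle, it is a quadratic polynomial.\<close>

definition "G z = (us \<phi> z /\<^sub>R lam \<phi> z, ut \<phi> z /\<^sub>R lam \<phi> z)"

lemma inner_div_lam_has_derivative:
  assumes "(g has_derivative g') (at z)"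
  shows "((\<lambda>w. (g w \<bullet> b) / lam \<phi> w) has_derivative (\<lambda>Y. (g' Y \<bullet> b) / lam \<phi> z
     - (g z \<bullet> b) * (2 * (us \<phi> z \<bullet> frechet_derivative (us \<phi>) (at z) Y)) / (lam \<phi> z)\<^sup>2)) (at z)"
proof -
  have "((\<lambda>w. (g w \<bullet> b) / lam \<phi> w) has_derivative
      (\<lambda>Y. ((g' Y \<bullet> b) * lam \<phi> z - (g z \<bullet> b) * (2 * (us \<phi> z \<bullet> frechet_derivative (us \<phi>) (at z) Y))) / (lam \<phi> z * lam \<phi> z))) (at z)"
    by (rule has_derivative_divide'[OF has_derivative_inner_left[OF assms] lam_has_derivative lam_nonzero(1)[OF \<phi>]])
  then show ?thesis
    by (rule has_derivative_eq_rhs)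
      (use lam_nonzero(1)[OF \<phi>, of z] in \<open>simp add: fun_eq_iff field_simps power2_eq_square\<close>)
qed

lemma G_inner: "cdot (G z) (b, 0) = Complex ((us \<phi> z \<bullet> b) / lam \<phi> z) ((ut \<phi> z \<bullet> b) / lam \<phi> z)"
  by (simp add: cdot_def G_def divide_inverse mult.commute)

text \<open>The structure equations read \<open>u_zbarzbar = (cP - i cQ) u_zbar\<close>, and
  \<open>cP - i cQ\<close> is the zbar derivative of \<open>log lam\<close>. Dividing
  \<open>u_zbar\<close> by \<open>lam\<close> therefore makes its zbar derivative zero, and
  \<open>G = 2 u_zbar / lam\<close>.\<close>

lemma G_holomorphic: "(\<lambda>z. cdot (G z) (b, 0)) holomorphic_on UNIV"
proof -
  define k where "k z Y = 2 * (us \<phi> z \<bullet> frechet_derivative (us \<phi>) (at z) Y)" for z Y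
  have D: "((\<lambda>z. cdot (G z) (b, 0)) has_derivative (\<lambda>Y. complex_of_real
       ((frechet_derivative (us \<phi>) (at z) Y \<bullet> b) / lam \<phi> z - (us \<phi> z \<bullet> b) * k z Y / (lam \<phi> z)\<^sup>2)
     + \<i> * complex_of_real ((frechet_derivative (ut \<phi>) (at z) Y \<bullet> b) / lam \<phi> z
        - (ut \<phi> z \<bullet> b) * k z Y / (lam \<phi> z)\<^sup>2))) (at z)" for z
    unfolding G_inner Complex_eq k_def
    by (intro has_derivative_add has_derivative_mult_right has_derivative_of_real
        inner_div_lam_has_derivative has_derivative_frechet us_differentiable \<phi>)
  show ?thesis
  proof (rule holomorphic_CR)
    show "(\<lambda>z. cdot (G z) (b, 0)) differentiable (at z)" for z
      using D differentiable_def by blast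
    show "frechet_derivative (\<lambda>z. cdot (G z) (b, 0)) (at z) 1
        + \<i> * frechet_derivative (\<lambda>z. cdot (G z) (b, 0)) (at z) \<i> = 0" for z
    proof -
      have k: "k z 1 = 2 * lam \<phi> z * cP z" "k z \<i> = - 2 * lam \<phi> z * cQ z"
        unfolding k_def by (rule lam_derivatives)+
      show ?thesis
        unfolding frechet_derivativeI[OF D] k ut_derivative[OF \<phi>] structure_ss structure_st structure_tt
        using lam_nonzero(1)[OF \<phi>, of z]
        by (simp add: complex_eq_iff inner_simps field_simps power2_eq_square)
    qed
  qed
qed

lemma G_isCont: "isCont (\<lambda>z. cdot (G z) (b, 0)) z"
  using holomorphic_on_imp_continuous_on[OF G_holomorphic]
  by (simp add: continuous_on_eq_continuous_at)

text \<open>The squared length of the projection of \<open>b\<close> to the span of \<open>u, u\<^sub>s, u\<^sub>t\<close>; its constancy shows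
  that this three-dimensional space is the same at all points.\<close>

definition "projsq b z = (b \<bullet> u (\<phi> z))\<^sup>2 + ((b \<bullet> us \<phi> z)\<^sup>2 + (b \<bullet> ut \<phi> z)\<^sup>2) / lam \<phi> z"

text \<open>The structure equations express the derivatives of \<open>u\<close>, \<open>us\<close>,
  \<open>ut\<close> in these vectors themselves, so their span does not turn. The derivative is
  computed in the directions 1 and \<open>\<i>\<close> and extended by linearity.\<close>

lemma projsq_constant: "projsq b z = projsq b z0"
proof -
  define k where "k z Y = 2 * (us \<phi> z \<bullet> frechet_derivative (us \<phi>) (at z) Y)" for z Y
  define P' where "P' z Y = 2 * (b \<bullet> u (\<phi> z)) * (b \<bullet> dCP1 u \<phi> z Y)
      + ((2 * (b \<bullet> us \<phi> z) * (b \<bullet> frechet_derivative (us \<phi>) (at z) Y)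
        + 2 * (b \<bullet> ut \<phi> z) * (b \<bullet> frechet_derivative (ut \<phi>) (at z) Y)) * lam \<phi> z
        - ((b \<bullet> us \<phi> z)\<^sup>2 + (b \<bullet> ut \<phi> z)\<^sup>2) * k z Y) / (lam \<phi> z * lam \<phi> z)" for z Y
  have sq: "((\<lambda>w. (b \<bullet> g w)\<^sup>2) has_derivative (\<lambda>Y. 2 * (b \<bullet> g z) * (b \<bullet> g' Y))) (at z)"
    if "(g has_derivative g') (at z)" for g :: "complex \<Rightarrow> imoct" and g' z
    using has_derivative_power[OF has_derivative_inner_right[OF that, of b], of 2]
    by (simp add: mult_ac)
  have D: "(projsq b has_derivative P' z) (at z)" for z
    unfolding projsq_def P'_def k_def
    by (rule has_derivative_add[OF sq[OF u_has_derivative[OF \<phi>]]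
        has_derivative_divide'[OF has_derivative_add[OF sq sq] lam_has_derivative lam_nonzero(1)[OF \<phi>]]])
      (intro has_derivative_frechet us_differentiable \<phi>)+
  have "P' z Y = 0" for z Y
  proof -
    have k: "k z 1 = 2 * lam \<phi> z * cP z" "k z \<i> = - 2 * lam \<phi> z * cQ z"
      unfolding k_def by (rule lam_derivatives)+
    have 1: "P' z 1 = 0" "P' z \<i> = 0"
      unfolding P'_def k ut_derivative[OF \<phi>] structure_ss structure_st structure_tt du_us_ut[OF \<phi>]
      using lam_nonzero(1)[OF \<phi>, of z]
      by (simp_all add: inner_simps field_simps power2_eq_square)
    have "P' z Y = Re Y *\<^sub>R P' z 1 + Im Y *\<^sub>R P' z \<i>"
      using frechet_derivative_complex[OF differentiableI[OF D], of z Y] by (simp add: frechet_derivativeI[OF D])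
    with 1 show ?thesis by simp
  qed
  then have "(projsq b has_derivative (\<lambda>Y. 0)) (at w within UNIV)" for w
    using D[of w] by (simp add: ext[of "P' w" "\<lambda>Y. 0"])
  then obtain c where "\<And>w. projsq b w = c"
    using has_derivative_zero_constant[of UNIV "projsq b"] by auto
  then show ?thesis by simp
qed

end

end

lemma cdot_eqI:
  assumes "\<And>b. cdot X (b, 0) = cdot Y (b, 0)"
  shows "X = Y"
proof (rule prod_eqI)
  have "fst X \<bullet> b = fst Y \<bullet> b" "snd X \<bullet> b = snd Y \<bullet> b" for b
    using assms[of b] by (simp_all add: cdot_def)
  then show "fst X = fst Y" "snd X = snd Y"
    by (metis inner_commute vector_eq_rdot)+
qed

context totally_geodesic_sphere
begin

text \<open>With \<open>c = -1/w^2\<close>, the derivative of the transition map,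
  \<open>us + i ut\<close> is multiplied by the conjugate of \<open>c\<close> and \<open>lam\<close>
  by \<open>|c|^2\<close>; the quotient is multiplied by \<open>1/c = -w^2\<close>.\<close>

lemma G_transition:
  assumes pair: "chart_pair \<phi> \<psi>" and w: "w \<noteq> 0"
  shows "G \<psi> w = cscale (- (w\<^sup>2)) (G \<phi> (1 / w))"
proof -
  interpret chart_pair \<phi> \<psi> by (rule pair)
  define c where "c = - (1 / w\<^sup>2)"
  define d where "d = - (w\<^sup>2)"
  define a where "a = us \<phi> (1 / w)"
  define b where "b = ut \<phi> (1 / w)"
  define n where "n = (Re c)\<^sup>2 + (Im c)\<^sup>2"
  have cd: "c * d = 1" using w by (simp add: c_def d_def)
  then have n: "n \<noteq> 0" unfolding n_def by (auto simp: sum_power2_eq_zero_iff complex_eq_iff)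
  have "d = inverse c" using cd by (metis inverse_unique)
  then have d': "Re d = Re c / n" "Im d = - Im c / n"
    by (simp_all add: n_def)
  have D: "dCP1 u \<psi> w Y = dCP1 u \<phi> (1 / w) (c * Y)" for Y
    unfolding dCP1_def[of u \<psi>] c_def
    using frechet_derivativeI[OF dCP1_transition[OF u_differentiable[OF chart_in(1)] w], of Y] by simp
  have us': "us \<psi> w = Re c *\<^sub>R a + Im c *\<^sub>R b"
    unfolding us_def[OF chart_in(2)] D du_us_ut[OF chart_in(1)] by (simp add: a_def b_def)
  have ut': "ut \<psi> w = - Im c *\<^sub>R a + Re c *\<^sub>R b"
    unfolding ut_def[OF chart_in(2)] D du_us_ut[OF chart_in(1)] by (simp add: a_def b_def)
  have lam': "lam \<psi> w = n * lam \<phi> (1 / w)"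
    unfolding lam_def[OF chart_in(2)] us'
    using us_perp[OF chart_in(1), of "1 / w"] lam_ut[OF chart_in(1), of "1 / w"]
    by (simp add: inner_simps a_def b_def lam_def[OF chart_in(1)] n_def power2_eq_square algebra_simps)
  show ?thesis
    unfolding d_def[symmetric] G_def[OF chart_in(2)] G_def[OF chart_in(1)] us' ut' lam' cscale_def d'
    by (simp add: a_def b_def divide_inverse algebra_simps)
qed

lemma G_quadratic:
  assumes pair: "chart_pair \<phi> \<psi>"
  shows "G \<phi> z = G \<phi> 0 + cscale z (G \<phi> 1 - G \<phi> 0 + G \<psi> 0) + cscale (z\<^sup>2) (- G \<psi> 0)"
proof (rule cdot_eqI)
  fix b :: imoct
  note c = chart_pair.chart_in[OF pair]
  have "cdot (G \<phi> z) (b, 0) = cdot (G \<phi> 0) (b, 0)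
     + (cdot (G \<phi> 1) (b, 0) - cdot (G \<phi> 0) (b, 0) + cdot (G \<psi> 0) (b, 0)) * z - cdot (G \<psi> 0) (b, 0) * z\<^sup>2"
    by (rule quadratic_of_growth[OF G_holomorphic[OF c(1)] G_isCont[OF c(2)]])
      (simp add: G_transition[OF chart_pair_sym[OF pair]] cdot_linear)
  then show "cdot (G \<phi> z) (b, 0) = cdot (G \<phi> 0 + cscale z (G \<phi> 1 - G \<phi> 0 + G \<psi> 0) + cscale (z\<^sup>2) (- G \<psi> 0)) (b, 0)"
    by (simp only: cdot_linear diff_conv_add_uminus) (simp add: algebra_simps)
qed

lemma G_null: "\<phi> \<in> CP1_charts \<Longrightarrow> cdot (G \<phi> z) (G \<phi> z) = 0"
  using lam_ut[of \<phi> z] us_perp[of \<phi> z]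
  by (simp add: cdot_def G_def complex_eq_iff flip: lam_def)

section \<open>The three-space of the sphere and its orthogonal complement\<close>

definition "Wr = {b. \<forall>p. b \<bullet> u p = 0}"
definition "Vr = {v. \<forall>b\<in>Wr. v \<bullet> b = 0}"

lemma subspace_Wr: "subspace Wr" and subspace_Vr: "subspace Vr"
  by (auto simp: subspace_def Wr_def Vr_def inner_simps)

lemma Wr_perp:
  assumes "b \<in> Wr" "\<phi> \<in> CP1_charts"
  shows "b \<bullet> u p = 0" "b \<bullet> us \<phi> z = 0" "b \<bullet> ut \<phi> z = 0"
proof -
  have 0: "b \<bullet> u p = 0" for p using assms by (simp add: Wr_def)
  then show "b \<bullet> u p = 0" .
  have "((\<lambda>z. b \<bullet> u (\<phi> z)) has_derivative (\<lambda>Y. b \<bullet> dCP1 u \<phi> z Y)) (at z)"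
    by (intro has_derivative_inner_right u_has_derivative assms)
  then have "((\<lambda>z. 0) has_derivative (\<lambda>Y. b \<bullet> dCP1 u \<phi> z Y)) (at z)"
    by (simp only: 0)
  then have "b \<bullet> dCP1 u \<phi> z Y = 0" for Y
    by (rule fun_cong[OF has_derivative_unique[OF _ has_derivative_const]])
  then show "b \<bullet> us \<phi> z = 0" "b \<bullet> ut \<phi> z = 0"
    by (simp_all add: us_def ut_def assms)
qed

text \<open>One point decides membership: \<open>projsq\<close> is constant and a sum of nonnegative
  terms, so if it vanishes at \<open>z0\<close> then \<open>b\<close> is orthogonal to
  \<open>u\<close> on the whole chart. The missing point follows by continuity.\<close>

lemma WrI:
  assumes \<phi>: "\<phi> \<in> CP1_charts" and b: "b \<bullet> u (\<phi> z0) = 0" "b \<bullet> us \<phi> z0 = 0" "b \<bullet> ut \<phi> z0 = 0"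
  shows "b \<in> Wr"
proof -
  obtain \<psi> where "chart_pair \<phi> \<psi>" using chart_pair_exists[OF \<phi>] by blast
  then interpret chart_pair \<phi> \<psi> .
  have 0: "b \<bullet> u (\<phi> z) = 0" for z
  proof -
    have "projsq \<phi> b z = 0"
      using projsq_constant[OF \<phi>, of b z z0] b by (simp add: projsq_def[OF \<phi>])
    moreover have "((b \<bullet> us \<phi> z)\<^sup>2 + (b \<bullet> ut \<phi> z)\<^sup>2) / lam \<phi> z \<ge> 0"
      using lam_nonzero(2)[OF \<phi>, of z] by simp
    ultimately have "(b \<bullet> u (\<phi> z))\<^sup>2 \<le> 0"
      unfolding projsq_def[OF \<phi>] by linarith
    then show ?thesis by simp
  qed
  have "isCont (\<lambda>w. b \<bullet> u (\<psi> w)) 0"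
    using differentiable_imp_continuous_within[OF u_differentiable[OF chart_in(2)], of 0]
    by (intro continuous_intros)
  then have "((\<lambda>w. b \<bullet> u (\<psi> w)) \<longlongrightarrow> b \<bullet> u (\<psi> 0)) (at 0)"
    by (simp add: isCont_def)
  moreover have "eventually (\<lambda>w. b \<bullet> u (\<psi> w) = 0) (at 0)"
    unfolding eventually_at by (intro exI[of _ 1]) (simp add: chart_transition(1) 0)
  ultimately have "((\<lambda>w. 0) \<longlongrightarrow> b \<bullet> u (\<psi> 0)) (at (0 :: complex))"
    by (rule Lim_transform_eventually)
  then have "b \<bullet> u (\<psi> 0) = 0"
    using tendsto_const_iff[of "at (0 :: complex)" 0] by (metis trivial_limit_at)
  then have "b \<bullet> u p = 0" for p
    by (cases rule: point_cases[of p]) (simp_all add: 0)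
  then show ?thesis by (simp add: Wr_def)
qed

lemma Vr_tangent: "u p \<in> Vr" "\<phi> \<in> CP1_charts \<Longrightarrow> us \<phi> z \<in> Vr" "\<phi> \<in> CP1_charts \<Longrightarrow> ut \<phi> z \<in> Vr"
  using Wr_perp by (auto simp: Vr_def Wr_def inner_commute)

lemma decompose_Wr:
  assumes \<phi>: "\<phi> \<in> CP1_charts" and v: "v \<bullet> u (\<phi> z) = 0"
  shows "v - ((v \<bullet> us \<phi> z) / lam \<phi> z) *\<^sub>R us \<phi> z - ((v \<bullet> ut \<phi> z) / lam \<phi> z) *\<^sub>R ut \<phi> z \<in> Wr"
  using lam_nonzero(1)[OF \<phi>, of z] us_perp[OF \<phi>, of z] v
  by (intro WrI[OF \<phi>, of _ z])
    (simp_all add: inner_simps lam_ut[OF \<phi>] flip: lam_def[OF \<phi>])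

lemma tangent_Wr_decomposition:
  assumes v: "v \<in> TS6 (u p)"
  obtains n t where "v = n + t" "n \<in> Wr" "t \<in> tangent_image u p"
proof -
  obtain \<phi> z where \<phi>: "\<phi> \<in> CP1_charts" "p = \<phi> z" by (rule point_chart)
  define t where "t = ((v \<bullet> us \<phi> z) / lam \<phi> z) *\<^sub>R us \<phi> z + ((v \<bullet> ut \<phi> z) / lam \<phi> z) *\<^sub>R ut \<phi> z"
  have "v - t \<in> Wr"
    using decompose_Wr[OF \<phi>(1), of v z] v by (simp add: t_def TS6_def \<phi>(2) diff_diff_eq)
  moreover have "t \<in> tangent_image u p"
    unfolding t_def \<phi>(2) by (simp only: tangent_image_intros us_tangent[OF \<phi>(1)])
  ultimately show ?thesis using that[of "v - t" t] by simp
qed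

text \<open>The difference of both sides lies in \<open>Vr\<close> and in \<open>Wr\<close>, hence
  is zero. So the moving frame spans the same three-space at every point.\<close>

lemma Vr_expand:
  assumes \<phi>: "\<phi> \<in> CP1_charts" and v: "v \<in> Vr"
  shows "v = (v \<bullet> u (\<phi> z)) *\<^sub>R u (\<phi> z) + ((v \<bullet> us \<phi> z) / lam \<phi> z) *\<^sub>R us \<phi> z
    + ((v \<bullet> ut \<phi> z) / lam \<phi> z) *\<^sub>R ut \<phi> z" (is "v = ?e")
proof -
  have e: "?e \<in> Vr"
    by (intro subspace_add[OF subspace_Vr] subspace_scale[OF subspace_Vr] Vr_tangent \<phi>)
  have "v - ?e \<in> Wr"
    using lam_nonzero(1)[OF \<phi>, of z] us_perp[OF \<phi>, of z]
    by (intro WrI[OF \<phi>, of _ z])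
      (simp_all add: inner_simps lam_ut[OF \<phi>] flip: lam_def[OF \<phi>])
  moreover have "v - ?e \<in> Vr"
    by (rule subspace_diff[OF subspace_Vr v e])
  ultimately have "(v - ?e) \<bullet> (v - ?e) = 0" by (simp only: Vr_def mem_Collect_eq)
  then show ?thesis by simp
qed

text \<open>The product of \<open>v\<close> with \<open>u p\<close> stays in the three-space, by the
  multiplication table of the frame, and the alternating triple product transfers this to the
  orthogonal complement.\<close>

lemma Vr_cross_Wr:
  assumes v: "v \<in> Vr" and n: "n \<in> Wr"
  shows "v \<otimes> n \<in> Wr"
proof -
  have "(v \<otimes> n) \<bullet> u p = 0" for p
  proof -
    obtain \<phi> z where \<phi>: "\<phi> \<in> CP1_charts" "p = \<phi> z" by (rule point_chart)
    have "v \<otimes> u p = ((v \<bullet> us \<phi> z) / lam \<phi> z) *\<^sub>R (us \<phi> z \<otimes> u p) + ((v \<bullet> ut \<phi> z) / lam \<phi> z) *\<^sub>R (ut \<phi> z \<otimes> u p)"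
      by (subst Vr_expand[OF \<phi>(1) v, of z]) (simp add: oct_cross_simps \<phi>(2))
    also have "us \<phi> z \<otimes> u p = - ut \<phi> z"
      using oct_cross_skew[of "us \<phi> z" "u p"] by (simp add: \<phi>(2) flip: ut_eq[OF \<phi>(1)])
    also have "ut \<phi> z \<otimes> u p = us \<phi> z"
      using oct_cross_skew[of "ut \<phi> z" "u p"] by (simp add: \<phi>(2) u_ut[OF \<phi>(1)])
    finally have "(v \<otimes> u p) \<bullet> n = 0"
      using Wr_perp[OF n \<phi>(1)] by (simp add: inner_simps inner_commute)
    then show ?thesis using oct_cross_triple[of v n "u p"] by simp
  qed
  then show ?thesis by (simp add: Wr_def)
qed

definition "Wc = {X. fst X \<in> Wr \<and> snd X \<in> Wr}"
definition "Vc = {X. fst X \<in> Vr \<and> snd X \<in> Vr}"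

lemma Vc_cmul_Wc: "X \<in> Vc \<Longrightarrow> n \<in> Wc \<Longrightarrow> cmul X n \<in> Wc"
  by (simp add: Vc_def Wc_def cmul_def subspace_diff[OF subspace_Wr] subspace_add[OF subspace_Wr] Vr_cross_Wr)

lemma Vc_clifford:
  "X \<in> Vc \<Longrightarrow> Y \<in> Vc \<Longrightarrow> n \<in> Wc \<Longrightarrow> cmul X (cmul Y n) + cmul Y (cmul X n) = cscale (- 2 * cdot X Y) n"
  by (rule cmul_clifford) (auto simp: Vc_def Wc_def Vr_def)

lemma G_Vc: "\<phi> \<in> CP1_charts \<Longrightarrow> G \<phi> z \<in> Vc"
  by (simp add: G_def Vc_def subspace_scale[OF subspace_Vr] Vr_tangent)

lemma Vc_linear: "X \<in> Vc \<Longrightarrow> Y \<in> Vc \<Longrightarrow> X + Y \<in> Vc" "X \<in> Vc \<Longrightarrow> Y \<in> Vc \<Longrightarrow> X - Y \<in> Vc"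
  "X \<in> Vc \<Longrightarrow> - X \<in> Vc"
  by (simp_all add: Vc_def subspace_add[OF subspace_Vr] subspace_diff[OF subspace_Vr] subspace_neg[OF subspace_Vr])

text \<open>Vectors of type (1,0) for the complex structure at \<open>u p\<close>.\<close>

definition w10 :: "CP1 \<Rightarrow> imoct \<Rightarrow> imoct \<times> imoct" where
  "w10 p n = (n, - (u p \<otimes> n))"

lemma w10_Wc: "n \<in> Wr \<Longrightarrow> w10 p n \<in> Wc"
  by (simp add: w10_def Wc_def Vr_cross_Wr Vr_tangent subspace_neg[OF subspace_Wr])

text \<open>Since \<open>ut = u \<otimes> us\<close>, antilinearity gives
  \<open>(us + i ut) y = us \<otimes> (y + i u \<otimes> y)\<close> for \<open>y\<close> in
  \<open>Wc\<close>, and multiplication by \<open>us\<close> is injective there. So the kernel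
  consists of the vectors on which \<open>u\<close> acts as \<open>i\<close>.\<close>

lemma G_kernel_iff:
  assumes \<phi>: "\<phi> \<in> CP1_charts" and y: "y \<in> Wc"
  shows "cmul (G \<phi> z) y = 0 \<longleftrightarrow> y = w10 (\<phi> z) (fst y)"
proof -
  define x where "x = u (\<phi> z)"
  define a where "a = us \<phi> z"
  have xa: "x \<bullet> x = 1" "x \<bullet> a = 0" by (simp_all add: x_def a_def us_perp[OF \<phi>])
  have l: "lam \<phi> z \<noteq> 0" "a \<bullet> a = lam \<phi> z"
    using lam_nonzero(1)[OF \<phi>] by (auto simp: a_def lam_def[OF \<phi>])
  have fy: "fst y \<in> Wr" "snd y \<in> Wr" using y by (auto simp: Wc_def)
  have P: "x \<bullet> n = 0" "a \<bullet> n = 0" if "n \<in> Wr" for n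
    using Wr_perp(1)[OF that \<phi>, of "\<phi> z"] Wr_perp(2)[OF that \<phi>, of z] by (auto simp: x_def a_def inner_commute)
  have ut: "ut \<phi> z = x \<otimes> a" by (simp add: x_def a_def ut_eq[OF \<phi>])
  have T: "(x \<otimes> a) \<otimes> n = a \<otimes> (x \<otimes> n)" if "n \<in> Wr" for n
    using oct_cross_antilinear[of x a n] P[OF that] xa by simp
  have inj: "n = 0" if "a \<otimes> n = 0" "n \<in> Wr" for n
    using oct_cross_cross_self[of a n] that P[OF that(2)] l by (simp add: oct_cross.zero_right)
  have W: "x \<otimes> n \<in> Wr" if "n \<in> Wr" for n
    using that by (simp add: x_def Vr_cross_Wr Vr_tangent)
  have "cmul (G \<phi> z) y = (a \<otimes> (fst y - x \<otimes> snd y) /\<^sub>R lam \<phi> z, a \<otimes> (snd y + x \<otimes> fst y) /\<^sub>R lam \<phi> z)"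
    by (simp add: cmul_def G_def[OF \<phi>] ut T fy oct_cross_simps flip: a_def)
      (simp add: algebra_simps)
  then have "cmul (G \<phi> z) y = 0 \<longleftrightarrow> a \<otimes> (fst y - x \<otimes> snd y) = 0 \<and> a \<otimes> (snd y + x \<otimes> fst y) = 0"
    using l by (simp add: prod_eq_iff)
  also have "\<dots> \<longleftrightarrow> fst y - x \<otimes> snd y = 0 \<and> snd y + x \<otimes> fst y = 0"
    using inj[of "fst y - x \<otimes> snd y"] inj[of "snd y + x \<otimes> fst y"] fy W
    by (auto simp: subspace_diff[OF subspace_Wr] subspace_add[OF subspace_Wr] oct_cross.zero_right)
  also have "\<dots> \<longleftrightarrow> snd y = - (x \<otimes> fst y)"
    using oct_cross_unit(1)[OF xa(1), of "fst y"] P[OF fy(1)]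
    by (auto simp: oct_cross_simps add_eq_0_iff)
  finally show ?thesis
    by (simp add: w10_def prod_eq_iff x_def)
qed

end

lemma dim_insert_orthogonal:
  fixes y :: "'a::euclidean_space"
  assumes "y \<noteq> 0" "\<forall>s\<in>S. y \<bullet> s = 0"
  shows "dim (insert y S) = Suc (dim S)"
proof -
  have "y \<notin> span S"
  proof
    assume "y \<in> span S"
    then have "orthogonal y y"
      by (rule orthogonal_to_span) (use assms(2) in \<open>simp add: orthogonal_def\<close>)
    with assms(1) show False by (simp add: orthogonal_def)
  qed
  then show ?thesis by (simp add: dim_insert)
qed

context totally_geodesic_sphere
begin

section \<open>Coefficients of the curve and coordinates on the tautological line\<close>

definition "cA = G chart0 0"
definition "cC = - G chart1 0"
definition "cB = G chart0 1 - G chart0 0 + G chart1 0"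

lemma chart01 [simp]: "chart0 \<in> CP1_charts" "chart1 \<in> CP1_charts"
  by (simp_all add: CP1_charts_eq)

lemma G_chart0: "G chart0 z = cA + cscale z cB + cscale (z\<^sup>2) cC"
  unfolding cA_def cB_def cC_def by (rule G_quadratic[OF chart_pair_01])

lemma ABC_Vc: "cA \<in> Vc" "cB \<in> Vc" "cC \<in> Vc"
  by (simp_all add: cA_def cB_def cC_def Vc_linear G_Vc)

lemma ABC_relations:
  "cdot cA cA = 0" "cdot cC cC = 0" "cdot cA cB = 0" "cdot cB cC = 0"
  "cdot cB cB = - 2 * cdot cA cC"
proof -
  show AA: "cdot cA cA = 0" by (simp add: cA_def G_null)
  show CC: "cdot cC cC = 0" by (simp add: cC_def cdot_linear G_null)
  \<comment> \<open>Nullity of \<open>G\<close> is a polynomial identity of degree four in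
    \<open>z\<close>. Its first and last coefficients are zero already, and the other three are
    recovered from the points 1, -1 and 2.\<close>
  have *: "2 * z * cdot cA cB + z\<^sup>2 * (cdot cB cB + 2 * cdot cA cC) + 2 * z ^ 3 * cdot cB cC = 0" for z
  proof -
    have "cdot (G chart0 z) (G chart0 z) = 0" by (simp add: G_null)
    then show ?thesis
      unfolding G_chart0
      by (simp add: cdot_linear AA CC cdot_commute[of cB cA] cdot_commute[of cC cA] cdot_commute[of cC cB]
          power2_eq_square power3_eq_cube algebra_simps)
  qed
  have "cdot cB cB + 2 * cdot cA cC = 0" "cdot cA cB = 0" "cdot cB cC = 0"
    using *[of 1] *[of "- 1"] *[of 2] by (simp_all add: algebra_simps) algebra+
  then show "cdot cA cB = 0" "cdot cB cC = 0" "cdot cB cB = - 2 * cdot cA cC"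
    by (simp_all add: add_eq_0_iff)
qed

text \<open>If \<open>A \<bullet> C = 0\<close> then \<open>G \<bullet> C = 0\<close>, so \<open>u \<bullet> C\<close> is a bounded entire function vanishing at infinity,
  and the tangent vectors forming \<open>C\<close> would be orthogonal to the whole sphere.\<close>

lemma AC_nonzero: "cdot cA cC \<noteq> 0"
proof
  assume AC: "cdot cA cC = 0"
  have GC: "cdot (G chart0 z) cC = 0" for z
    unfolding G_chart0 by (simp add: cdot_linear AC ABC_relations)
  define f where "f z = cdot (u (chart0 z), 0) cC" for z
  define h where "h w = cdot (u (chart1 w), 0) cC" for w
  have f_eq: "f z = complex_of_real (u (chart0 z) \<bullet> fst cC) + \<i> * complex_of_real (u (chart0 z) \<bullet> snd cC)" for z
    by (simp add: f_def cdot_def Complex_eq)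
  have h_eq: "h z = complex_of_real (u (chart1 z) \<bullet> fst cC) + \<i> * complex_of_real (u (chart1 z) \<bullet> snd cC)" for z
    by (simp add: h_def cdot_def Complex_eq)
  have D: "(f has_derivative (\<lambda>Y. complex_of_real (dCP1 u chart0 z Y \<bullet> fst cC)
      + \<i> * complex_of_real (dCP1 u chart0 z Y \<bullet> snd cC))) (at z)" for z
    unfolding f_eq
    by (intro has_derivative_add has_derivative_mult_right has_derivative_of_real has_derivative_inner_left
        u_has_derivative chart01)
  have hol: "f holomorphic_on UNIV"
  proof (rule holomorphic_CR)
    show "f differentiable (at z)" for z using D differentiable_def by blast
    show "frechet_derivative f (at z) 1 + \<i> * frechet_derivative f (at z) \<i> = 0" for z
    proof -
      \<comment> \<open>The Cauchy-Riemann defect of \<open>u . C\<close> is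
        \<open>(us + i ut) . C\<close>, that is, \<open>lam\<close> times
        \<open>G . C\<close>.\<close>
      have "frechet_derivative f (at z) 1 + \<i> * frechet_derivative f (at z) \<i>
        = complex_of_real (lam chart0 z) * cdot (G chart0 z) cC"
        unfolding frechet_derivativeI[OF D]
        using lam_nonzero(1)[of chart0 z]
        by (simp add: complex_eq_iff cdot_def G_def right_diff_distrib distrib_left flip: us_def ut_def)
          (simp flip: mult.assoc)
      then show ?thesis by (simp add: GC)
    qed
  qed
  have cont: "isCont h 0"
    unfolding h_eq using differentiable_imp_continuous_within[OF u_differentiable[OF chart01(2)], of 0]
    by (intro continuous_intros)
  have "(f \<longlongrightarrow> h 0) at_infinity"
    by (rule tendsto_inverse_chart[OF cont]) (simp add: f_def h_def chart_pair.chart_transition(2)[OF chart_pair_01])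
  \<comment> \<open>\<open>C\<close> is built from the tangent vectors at \<open>chart1 0\<close>,
    which are orthogonal to \<open>u\<close> there.\<close>
  moreover have h0: "h 0 = 0"
    by (simp add: h_def cdot_def cC_def G_def us_perp complex_eq_iff)
  ultimately have "f z = 0" for z
    using Liouville_weak_0[OF hol] by simp
  then have *: "u p \<bullet> fst cC = 0" for p
    using h0
    by (cases rule: chart_pair.point_cases[OF chart_pair_01, of p])
      (auto simp: f_eq h_eq complex_eq_iff)
  then have "fst cC \<in> Wr"
    by (simp add: Wr_def inner_commute)
  from Wr_perp(2)[OF this chart01(2), of 0] have "us chart1 0 = 0"
    using lam_nonzero(1)[of chart1 0] by (simp add: cC_def G_def flip: lam_def)
  then show False
    using lam_nonzero(1)[of chart1 0] by (simp add: lam_def)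
qed

text \<open>Vectors are embedded by \<open>w10\<close> into the complexification and paired with a
  fixed \<open>m\<close>. The pairing turns \<open>J0\<close> into multiplication by
  \<open>\<i>\<close> (see \<open>ell_J\<close>), so it is a complex-linear coordinate.\<close>

definition ell :: "imoct \<times> imoct \<Rightarrow> CP1 \<Rightarrow> imoct \<Rightarrow> complex" where
  "ell m p v = cdot (w10 p v) m"

lemma w10_linear: "w10 p (v + w) = w10 p v + w10 p w" "w10 p (c *\<^sub>R v) = c *\<^sub>R w10 p v"
  by (simp_all add: w10_def oct_cross_simps)

lemma ell_add: "ell m p (v + w) = ell m p v + ell m p w"
  by (simp add: ell_def w10_linear cdot_linear)

lemma ell_scaleR: "ell m p (c *\<^sub>R v) = c *\<^sub>R ell m p v"
  by (simp add: ell_def w10_def cdot_def complex_eq_iff oct_cross_simps inner_simps algebra_simps)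

lemma ell_J: "v \<in> TS6 (u p) \<Longrightarrow> ell m p (u p \<otimes> v) = \<i> * ell m p v"
  by (simp add: ell_def w10_def cdot_def complex_eq_iff oct_cross_unit TS6_def inner_commute)

text \<open>Tangent vectors and their \<open>J0\<close> images lie in \<open>Vr\<close>, orthogonal
  to both parts of \<open>m\<close>. Hence the functional descends to the normal bundle.\<close>

lemma ell_tangent:
  assumes m: "m \<in> Wc" and t: "t \<in> tangent_image u p"
  shows "ell m p t = 0"
proof -
  obtain \<phi> z where \<phi>: "\<phi> \<in> CP1_charts" "p = \<phi> z" by (rule point_chart)
  have "t \<in> Vr" if "t \<in> tangent_image u p" for t
    using that unfolding \<phi>(2) tangent_image_eq[OF \<phi>(1)]
    by (auto simp: du_us_ut[OF \<phi>(1)] intro!: subspace_add[OF subspace_Vr] subspace_scale[OF subspace_Vr]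
        Vr_tangent \<phi>)
  from this[OF t] this[OF tangent_image_J[OF t]] show ?thesis
    using m by (simp add: ell_def w10_def cdot_def complex_eq_iff Vr_def Wc_def)
qed

text \<open>The functionals \<open>ell (m0 b)\<close> and \<open>ell (m1 b)\<close> are homogeneous coordinates on the tautological
  line: \<open>m1 b - z m0 b = - G(z) (C b)\<close>, and \<open>G(z)\<close> annihilates the vectors of type (1,0) over \<open>z\<close>.\<close>

definition "m0 b = cmul cB (cmul cC (b, 0))"
definition "m1 b = - cmul cA (cmul cC (b, 0))"

lemma real_Wc: "b \<in> Wr \<Longrightarrow> (b, 0) \<in> Wc"
  by (simp add: Wc_def subspace_0[OF subspace_Wr])

lemma m_Wc: "b \<in> Wr \<Longrightarrow> m0 b \<in> Wc" "b \<in> Wr \<Longrightarrow> m1 b \<in> Wc"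
proof -
  have "- X \<in> Wc" if "X \<in> Wc" for X
    using that by (simp add: Wc_def subspace_neg[OF subspace_Wr])
  then show "b \<in> Wr \<Longrightarrow> m0 b \<in> Wc" "b \<in> Wr \<Longrightarrow> m1 b \<in> Wc"
    by (simp_all add: m0_def m1_def Vc_cmul_Wc ABC_Vc real_Wc)
qed

lemma CC_zero:
  assumes "n \<in> Wc"
  shows "cmul cC (cmul cC n) = 0"
proof -
  have "cmul cC (cmul cC n) + cmul cC (cmul cC n) = 0"
    using Vc_clifford[OF ABC_Vc(3,3) assms] by (simp add: ABC_relations cscale_simps)
  then show ?thesis by (simp add: prod_eq_iff flip: scaleR_2)
qed

lemma kernel_C:
  assumes "y \<in> Wc"
  shows "cmul cC y = 0 \<longleftrightarrow> y = w10 (chart1 0) (fst y)"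
  using G_kernel_iff[OF chart01(2) assms, of 0] by (simp add: cC_def cmul_linear)

lemma ell_chart0:
  assumes n: "n \<in> Wr" and b: "b \<in> Wr"
  shows "ell (m1 b) (chart0 z) n = z * ell (m0 b) (chart0 z) n"
proof -
  have Gw: "cmul (G chart0 z) (w10 (chart0 z) n) = 0"
    using G_kernel_iff[OF chart01(1) w10_Wc[OF n], of z "chart0 z"] by (simp add: w10_def)
  have "m1 b + - cscale z (m0 b) = - cmul (G chart0 z) (cmul cC (b, 0))"
    unfolding G_chart0 m0_def m1_def
    by (simp add: cmul_linear CC_zero real_Wc b cscale_simps)
  then have "cdot (w10 (chart0 z) n) (m1 b + - cscale z (m0 b)) = 0"
    using cdot_cmul_skew[of "G chart0 z" "w10 (chart0 z) n" "cmul cC (b, 0)"]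
    by (simp add: Gw cdot_linear)
  then show ?thesis
    by (simp only: cdot_linear ell_def) simp
qed

text \<open>As \<open>B . C = 0\<close>, the products \<open>B C b\<close> and
  \<open>- C B b\<close> agree, and skewness moves \<open>C\<close> onto the (1,0) vector at
  infinity, which it annihilates.\<close>

lemma ell_infinity:
  assumes n: "n \<in> Wr" and b: "b \<in> Wr"
  shows "ell (m0 b) (chart1 0) n = 0"
proof -
  define w where "w = w10 (chart1 0) n"
  have Cw: "cmul cC w = 0"
    using kernel_C[OF w10_Wc[OF n], of "chart1 0"] by (simp add: w_def w10_def)
  have "cmul cB (cmul cC (b, 0)) + cmul cC (cmul cB (b, 0)) = 0"
    using Vc_clifford[OF ABC_Vc(2,3) real_Wc[OF b]] by (simp add: ABC_relations cscale_simps)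
  then have "m0 b = - cmul cC (cmul cB (b, 0))"
    by (simp add: m0_def add_eq_0_iff)
  then have "cdot w (m0 b) = cdot (cmul cC w) (cmul cB (b, 0))"
    by (simp add: cdot_linear cdot_cmul_skew)
  then show ?thesis unfolding ell_def w_def[symmetric] by (simp add: Cw cdot_linear)
qed

lemma cdot_m: "cdot w (m0 b) = cdot (cmul cC (cmul cB w)) (b, 0)"
  "cdot w (m1 b) = - cdot (cmul cC (cmul cA w)) (b, 0)"
  by (simp_all add: m0_def m1_def cdot_linear cdot_cmul_skew)

text \<open>\<open>b1, x b1, b2, x b2\<close>, where \<open>x = u \<infinity>\<close>, is an orthogonal basis of \<open>Wr\<close>.\<close>

definition Wr_frame :: "imoct \<Rightarrow> imoct \<Rightarrow> bool" where
  "Wr_frame b1 b2 \<longleftrightarrow> b1 \<in> Wr \<and> b2 \<in> Wr \<and> b1 \<noteq> 0 \<and> b2 \<noteq> 0 \<and> b1 \<bullet> b2 = 0 \<and> b2 \<bullet> (u (chart1 0) \<otimes> b1) = 0"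

lemma Wr_frame_exists: "\<exists>b1 b2. Wr_frame b1 b2"
proof -
  define x where "x = u (chart1 0)"
  define a where "a = us chart1 0"
  define c where "c = ut chart1 0"
  have DIM: "DIM(imoct) = 7" by simp
  have ex: "\<exists>b. b \<in> Wr \<and> b \<noteq> 0 \<and> (\<forall>s\<in>S. b \<bullet> s = 0)" if S: "finite S" "card S \<le> 2" for S
  proof -
    \<comment> \<open>The three frame vectors at infinity and at most two from \<open>S\<close> span
      fewer than seven dimensions, which leaves a nonzero orthogonal vector.\<close>
    have "dim ({x, a, c} \<union> S) \<le> card ({x, a, c} \<union> S)"
      using S by (intro dim_le_card') auto
    also have "\<dots> \<le> card {x, a, c} + card S" by (rule card_Un_le)
    also have "\<dots> \<le> 3 + 2"
      using S by (intro add_mono) (auto simp: card_insert_if)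
    finally have "dim ({x, a, c} \<union> S) < DIM(imoct)" by (simp add: DIM)
    from orthogonal_to_subspace_exists[OF this] obtain b where b: "b \<noteq> 0"
      "\<And>y. y \<in> span ({x, a, c} \<union> S) \<Longrightarrow> orthogonal b y" by blast
    have *: "b \<bullet> s = 0" if "s \<in> {x, a, c} \<union> S" for s
      using b(2)[OF span_base[OF that]] by (simp add: orthogonal_def)
    have "b \<in> Wr"
      by (rule WrI[OF chart01(2), of _ 0]) (use * in \<open>auto simp: x_def a_def c_def\<close>)
    with b * show ?thesis by (intro exI[of _ b]) auto
  qed
  obtain b1 where b1: "b1 \<in> Wr" "b1 \<noteq> 0" using ex[of "{}"] by auto
  obtain b2 where "b2 \<in> Wr" "b2 \<noteq> 0" "b2 \<bullet> b1 = 0" "b2 \<bullet> (x \<otimes> b1) = 0"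
  proof -
    have "card {b1, x \<otimes> b1} \<le> 2" by (simp add: card_insert_if)
    then show ?thesis using ex[of "{b1, x \<otimes> b1}"] that by blast
  qed
  with b1 have "Wr_frame b1 b2" by (simp add: Wr_frame_def x_def inner_commute)
  then show ?thesis by blast
qed

lemma Wr_frame_orthogonal:
  assumes fr: "Wr_frame b1 b2" and x: "x = u (chart1 0)"
  shows "x \<otimes> b1 \<noteq> 0" "x \<otimes> b2 \<noteq> 0" "(x \<otimes> b1) \<bullet> (x \<otimes> b2) = 0" "b1 \<bullet> (x \<otimes> b2) = 0"
    "x \<otimes> b1 \<in> Wr" "x \<otimes> b2 \<in> Wr"
proof -
  have W: "b1 \<in> Wr" "b2 \<in> Wr" using fr by (auto simp: Wr_frame_def)
  show "x \<otimes> b1 \<in> Wr" "x \<otimes> b2 \<in> Wr"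
    using W by (simp_all add: x Vr_cross_Wr Vr_tangent)
  have xx: "x \<otimes> (x \<otimes> b) = - b" if "b \<in> Wr" for b
    using Wr_perp(1)[OF that chart01(1)] by (simp add: x oct_cross_unit(1) inner_commute)
  show "x \<otimes> b1 \<noteq> 0" "x \<otimes> b2 \<noteq> 0"
    using xx[OF W(1)] xx[OF W(2)] fr by (auto simp: Wr_frame_def oct_cross.zero_right)
  show "(x \<otimes> b1) \<bullet> (x \<otimes> b2) = 0"
    using oct_cross_triple[of x b1 "x \<otimes> b2"] fr by (simp add: xx[OF W(2)] Wr_frame_def inner_commute)
  show "b1 \<bullet> (x \<otimes> b2) = 0"
    using oct_cross_triple[of x b2 b1] fr by (simp add: Wr_frame_def x inner_commute)
qed

text \<open>A nonzero \<open>y\<close> would be the eighth member of an orthogonal system in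
  dimension seven: three vectors at infinity from \<open>Vr\<close>, four from the frame of
  \<open>Wr\<close>, and \<open>y\<close>.\<close>

lemma Wr_frame_complete:
  assumes fr: "Wr_frame b1 b2" and x: "x = u (chart1 0)" and y: "y \<in> Wr"
    and o: "y \<bullet> b1 = 0" "y \<bullet> b2 = 0" "y \<bullet> (x \<otimes> b1) = 0" "y \<bullet> (x \<otimes> b2) = 0"
  shows "y = 0"
proof (rule ccontr)
  assume y0: "y \<noteq> 0"
  define a where "a = us chart1 0"
  define c where "c = ut chart1 0"
  note f = Wr_frame_orthogonal[OF fr x]
  have W: "b1 \<in> Wr" "b2 \<in> Wr" "b1 \<noteq> 0" "b2 \<noteq> 0" "b1 \<bullet> b2 = 0" "b2 \<bullet> (x \<otimes> b1) = 0"
    using fr by (auto simp: Wr_frame_def x)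
  have p: "n \<bullet> x = 0" "n \<bullet> a = 0" "n \<bullet> c = 0" if "n \<in> Wr" for n
    using Wr_perp(1)[OF that chart01(2)] Wr_perp(2,3)[OF that chart01(2), of 0] by (auto simp: x a_def c_def)
  have "x \<noteq> 0"
    unfolding x by (metis u_S6(2) inner_zero_left zero_neq_one)
  then have xac: "x \<noteq> 0" "a \<noteq> 0" "c \<noteq> 0" "x \<bullet> a = 0" "x \<bullet> c = 0" "a \<bullet> c = 0"
    using lam_nonzero(1)[OF chart01(2), of 0] lam_ut[OF chart01(2), of 0]
    by (auto simp: x a_def c_def us_perp lam_def[OF chart01(2)])
  have o': "a \<bullet> x = 0" "c \<bullet> x = 0" "c \<bullet> a = 0" "b2 \<bullet> b1 = 0"
    "(x \<otimes> b2) \<bullet> (x \<otimes> b1) = 0" "(x \<otimes> b2) \<bullet> b1 = 0"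
    using xac W f by (simp_all only: inner_commute)
  have "dim {x} = 1"
    using dim_insert_orthogonal[of x "{}"] xac by simp
  then have "dim {a, x} = 2"
    by (simp add: dim_insert_orthogonal xac o')
  then have "dim {c, a, x} = 3"
    by (simp add: dim_insert_orthogonal xac o')
  then have "dim {b1, c, a, x} = 4"
    by (simp add: dim_insert_orthogonal W p)
  then have "dim {x \<otimes> b1, b1, c, a, x} = 5"
    by (simp add: dim_insert_orthogonal f p)
  then have "dim {b2, x \<otimes> b1, b1, c, a, x} = 6"
    by (simp add: dim_insert_orthogonal W o' p)
  then have "dim {x \<otimes> b2, b2, x \<otimes> b1, b1, c, a, x} = 7"
    by (simp add: dim_insert_orthogonal f o' p)
  then have "dim {y, x \<otimes> b2, b2, x \<otimes> b1, b1, c, a, x} = 8"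
    by (simp add: dim_insert_orthogonal y0 y o p)
  moreover have "dim {y, x \<otimes> b2, b2, x \<otimes> b1, b1, c, a, x} \<le> DIM(imoct)"
    by (rule dim_subset_UNIV)
  ultimately show False by simp
qed

text \<open>The hypotheses force \<open>C B w = C A w = 0\<close>, and the Clifford relations
  recover \<open>w\<close>: \<open>B C w = - C B w = 0\<close> gives \<open>C w = 0\<close>, because
  \<open>B . B\<close> is a nonzero multiple of \<open>A . C\<close>; then
  \<open>A C + C A = -2 A . C\<close> gives \<open>w = 0\<close>.\<close>

lemma ell_injective:
  assumes fr: "Wr_frame b1 b2" and n: "n \<in> Wr"
    and 0: "ell (m0 b1) p n = 0" "ell (m0 b2) p n = 0" "ell (m1 b1) p n = 0" "ell (m1 b2) p n = 0"
  shows "n = 0"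
proof -
  define w where "w = w10 p n"
  have w: "w \<in> Wc" unfolding w_def by (rule w10_Wc[OF n])
  \<comment> \<open>The kernel of \<open>C\<close> consists of (1,0) vectors at infinity, so the
    complex pairing with \<open>b\<close> records the real pairings with \<open>b\<close> and with
    \<open>x \<otimes> b\<close>. Two vectors \<open>b\<close> thus test all four directions of
    \<open>Wr\<close>.\<close>
  have zero: "y = 0" if y: "y \<in> Wc" "cmul cC y = 0" "cdot y (b1, 0) = 0" "cdot y (b2, 0) = 0" for y
  proof -
    define x where "x = u (chart1 0)"
    have "y = w10 (chart1 0) (fst y)"
      by (rule iffD1[OF kernel_C[OF y(1)] y(2)])
    from arg_cong[OF this, of snd] have sy: "snd y = - (x \<otimes> fst y)"
      by (simp add: w10_def x_def)
    have y1: "fst y \<in> Wr" using y(1) by (simp add: Wc_def)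
    have "fst y \<bullet> b = 0 \<and> fst y \<bullet> (x \<otimes> b) = 0" if "cdot y (b, 0) = 0" for b
    proof -
      have "fst y \<bullet> b = 0" "(x \<otimes> fst y) \<bullet> b = 0"
        using that by (simp_all add: cdot_def complex_eq_iff sy)
      then show ?thesis
        using oct_cross_triple[of x "fst y" b] by (simp add: inner_commute)
    qed
    from this[OF y(3)] this[OF y(4)] have "fst y = 0"
      by (intro Wr_frame_complete[OF fr x_def y1]) simp_all
    then show ?thesis
      by (intro prod_eqI) (simp_all add: sy oct_cross.zero_right)
  qed
  have CB: "cmul cC (cmul cB w) = 0"
    by (rule zero; (intro CC_zero Vc_cmul_Wc ABC_Vc w)?)
      (use 0(1,2) in \<open>simp_all add: ell_def cdot_m flip: w_def\<close>)
  have CA: "cmul cC (cmul cA w) = 0"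
    by (rule zero; (intro CC_zero Vc_cmul_Wc ABC_Vc w)?)
      (use 0(3,4) in \<open>simp_all add: ell_def cdot_m flip: w_def\<close>)
  have BCw: "cmul cB (cmul cC w) = 0"
    using Vc_clifford[OF ABC_Vc(2,3) w] by (simp add: CB ABC_relations cscale_simps)
  have "cscale (- 2 * cdot cB cB) (cmul cC w) = 0"
    using Vc_clifford[OF ABC_Vc(2,2) Vc_cmul_Wc[OF ABC_Vc(3) w]] by (simp add: BCw cmul_linear)
  then have Cw: "cmul cC w = 0"
    by (simp add: cscale_eq_0_iff ABC_relations AC_nonzero)
  have "cscale (- 2 * cdot cA cC) w = 0"
    using Vc_clifford[OF ABC_Vc(1,3) w] by (simp add: CA Cw cmul_linear)
  then have "w = 0"
    by (simp add: cscale_eq_0_iff AC_nonzero)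
  then show ?thesis by (simp add: w_def w10_def zero_prod_def)
qed

end

section \<open>The isomorphism with the tautological bundle\<close>

definition pack :: "complex \<Rightarrow> complex \<Rightarrow> complex \<Rightarrow> complex \<Rightarrow> (complex^2) \<times> (complex^2)" where
  "pack a b c d = (vector [a, b], vector [c, d])"

lemma pack_add: "pack a b c d + pack a' b' c' d' = pack (a + a') (b + b') (c + c') (d + d')"
  and pack_scaleR: "r *\<^sub>R pack a b c d = pack (r *\<^sub>R a) (r *\<^sub>R b) (r *\<^sub>R c) (r *\<^sub>R d)"
  and pack_cscale2: "cscale2 k (pack a b c d) = pack (k * a) (k * b) (k * c) (k * d)"
  and pack_eq_0_iff: "pack a b c d = 0 \<longleftrightarrow> a = 0 \<and> b = 0 \<and> c = 0 \<and> d = 0"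
  by (auto simp: pack_def cscale2_def prod_eq_iff vec_eq_iff forall_2)

lemma bounded_linear_pack:
  "bounded_linear (\<lambda>a. pack a 0 0 0)" "bounded_linear (\<lambda>a. pack 0 a 0 0)"
  "bounded_linear (\<lambda>a. pack 0 0 a 0)" "bounded_linear (\<lambda>a. pack 0 0 0 a)"
  by (intro linear_conv_bounded_linear[THEN iffD1]; simp add: linear_iff pack_add pack_scaleR)+

lemma pack_sum: "pack a b c d = pack a 0 0 0 + pack 0 b 0 0 + pack 0 0 c 0 + pack 0 0 0 d"
  by (simp add: pack_add)

lemma smooth_on_pack:
  assumes "smooth_on UNIV f1" "smooth_on UNIV f2" "smooth_on UNIV f3" "smooth_on UNIV f4"
  shows "smooth_on UNIV (\<lambda>z :: 'a::real_normed_vector. pack (f1 z) (f2 z) (f3 z) (f4 z))"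
  by (subst pack_sum)
    (intro smooth_on_add open_UNIV smooth_on_bounded_linear[OF open_UNIV bounded_linear_pack(1)]
      smooth_on_bounded_linear[OF open_UNIV bounded_linear_pack(2)]
      smooth_on_bounded_linear[OF open_UNIV bounded_linear_pack(3)]
      smooth_on_bounded_linear[OF open_UNIV bounded_linear_pack(4)] assms)

lemma pack_has_derivative:
  assumes "(f1 has_derivative f1') (at z)" "(f2 has_derivative f2') (at z)"
    "(f3 has_derivative f3') (at z)" "(f4 has_derivative f4') (at z)"
  shows "((\<lambda>z. pack (f1 z) (f2 z) (f3 z) (f4 z)) has_derivative
    (\<lambda>Y. pack (f1' Y) (f2' Y) (f3' Y) (f4' Y))) (at z)"
  by (subst (1 2) pack_sum)
    (intro has_derivative_add bounded_linear.has_derivative[OF bounded_linear_pack(1)]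
      bounded_linear.has_derivative[OF bounded_linear_pack(2)]
      bounded_linear.has_derivative[OF bounded_linear_pack(3)]
      bounded_linear.has_derivative[OF bounded_linear_pack(4)] assms)

lemma dim_taut2_fibre: "dim (taut2_fibre p) \<le> 4" and subspace_taut2_fibre: "subspace (taut2_fibre p)"
proof -
  obtain v :: "complex^2" where v: "v \<noteq> 0" "p = line v"
    by (cases p) (auto simp: line_def)
  define f where "f ab = (fst ab *s v, snd ab *s v)" for ab :: "complex \<times> complex"
  have f: "linear f"
    by (simp add: linear_iff f_def prod_eq_iff vec_eq_iff algebra_simps)
  have "taut2_fibre p = range f"
    by (auto simp: taut2_fibre_def v(2) Rep_line[OF v(1)] f_def image_iff)
  then show "dim (taut2_fibre p) \<le> 4" "subspace (taut2_fibre p)"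
    using dim_image_le[OF f, of UNIV] linear_subspace_image[OF f subspace_UNIV] by simp_all
qed

context totally_geodesic_sphere
begin

lemma ell_pair: "ell m p v = Complex (v \<bullet> fst m) (- ((u p \<otimes> v) \<bullet> fst m))
    + \<i> * Complex (v \<bullet> snd m) (- ((u p \<otimes> v) \<bullet> snd m))"
  by (simp add: ell_def w10_def cdot_def complex_eq_iff)

lemma ell_section_smooth:
  assumes \<xi>: "pullback_section u \<xi>" and \<phi>: "\<phi> \<in> CP1_charts"
  shows "smooth_on UNIV (\<lambda>z. ell m (\<phi> z) (\<xi> (\<phi> z)))"
proof -
  have s\<xi>: "smooth_on UNIV (\<lambda>z. \<xi> (\<phi> z))"
    using \<xi> \<phi> by (simp add: pullback_section_def smooth_CP1_def)
  have bl: "bounded_linear (\<lambda>a. Complex (a \<bullet> r) 0)" "bounded_linear (\<lambda>a. Complex 0 (- (a \<bullet> r)))" for r :: imoct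
    by (intro linear_conv_bounded_linear[THEN iffD1]; simp add: linear_iff inner_simps complex_eq_iff)+
  have "smooth_on UNIV (\<lambda>z. u (\<phi> z) \<otimes> \<xi> (\<phi> z))"
    by (rule smooth_on_bilinear[OF open_UNIV bounded_bilinear_oct_cross u_smooth_on[OF \<phi>] s\<xi>])
  from smooth_on_bounded_linear[OF open_UNIV bl(1) s\<xi>] smooth_on_bounded_linear[OF open_UNIV bl(2) this]
  have *: "smooth_on UNIV (\<lambda>z. Complex (\<xi> (\<phi> z) \<bullet> r) 0 + Complex 0 (- ((u (\<phi> z) \<otimes> \<xi> (\<phi> z)) \<bullet> r)))" for r
    by (intro smooth_on_add open_UNIV)
  have c: "Complex a 0 + Complex 0 b = Complex a b" for a b
    by (simp add: complex_eq_iff)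
  show ?thesis
    unfolding ell_pair
    by (intro smooth_on_add open_UNIV smooth_on_bounded_linear[OF open_UNIV bounded_linear_mult_right]
        *[unfolded c])
qed

text \<open>The embedding \<open>w10\<close> is holomorphic: differentiating the factor
  \<open>u\<close> in it produces products of \<open>du(Y)\<close> and \<open>du(jY)\<close> with
  \<open>\<xi>\<close>, and antilinearity combines them, modulo \<open>u\<close>, into the (1,0)
  vector of \<open>-u \<otimes> (du(Y) \<otimes> \<xi>)\<close>. This is the zero-order term of
  \<open>dbar_N_lift\<close>.\<close>

lemma ell_dbar:
  assumes \<xi>: "pullback_section u \<xi>" and \<phi>: "\<phi> \<in> CP1_charts" and m: "m \<in> Wc"
  defines "F \<equiv> \<lambda>z. ell m (\<phi> z) (\<xi> (\<phi> z))"
  shows "ell m (\<phi> z) ((1/2) *\<^sub>R (tproj (u (\<phi> z)) (dCP1 \<xi> \<phi> z Y)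
     + u (\<phi> z) \<otimes> dCP1 \<xi> \<phi> z (\<i> * Y) - u (\<phi> z) \<otimes> (dCP1 u \<phi> z Y \<otimes> \<xi> (\<phi> z))))
   = (1/2) *\<^sub>R (frechet_derivative F (at z) Y + \<i> * frechet_derivative F (at z) (\<i> * Y))"
proof -
  define x where "x = u (\<phi> z)"
  define a where "a = \<xi> (\<phi> z)"
  define U where "U = dCP1 u \<phi> z Y"
  define c where "c = dCP1 \<xi> \<phi> z Y"
  define d where "d = dCP1 \<xi> \<phi> z (\<i> * Y)"
  have xx: "x \<bullet> x = 1" "x \<bullet> a = 0" "x \<bullet> U = 0"
    using \<xi> by (simp_all add: x_def a_def U_def pullback_section_def TS6_def u_du[OF \<phi>] inner_commute)
  have iU: "dCP1 u \<phi> z (\<i> * Y) = x \<otimes> U"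
    unfolding x_def U_def by (rule du_i[OF \<phi>])
  define e where "e v r = complex_of_real (v \<bullet> r) - \<i> * complex_of_real ((x \<otimes> v) \<bullet> r)" for v r
  have ell_e: "ell m (\<phi> z) v = e v (fst m) + \<i> * e v (snd m)" for v
    by (simp add: ell_pair e_def x_def complex_eq_iff)
  have F_eq: "F = (\<lambda>w. (complex_of_real (\<xi> (\<phi> w) \<bullet> fst m) - \<i> * complex_of_real ((u (\<phi> w) \<otimes> \<xi> (\<phi> w)) \<bullet> fst m))
     + \<i> * (complex_of_real (\<xi> (\<phi> w) \<bullet> snd m) - \<i> * complex_of_real ((u (\<phi> w) \<otimes> \<xi> (\<phi> w)) \<bullet> snd m)))"
    by (simp add: F_def ell_pair complex_eq_iff fun_eq_iff)
  have d\<xi>: "((\<lambda>w. \<xi> (\<phi> w)) has_derivative dCP1 \<xi> \<phi> z) (at z)"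
    using has_derivative_frechet[OF pullback_section_differentiable[OF \<xi> \<phi>]] by (simp add: dCP1_def[abs_def])
  have "(F has_derivative (\<lambda>Y. (complex_of_real (dCP1 \<xi> \<phi> z Y \<bullet> fst m)
        - \<i> * complex_of_real ((u (\<phi> z) \<otimes> dCP1 \<xi> \<phi> z Y + dCP1 u \<phi> z Y \<otimes> \<xi> (\<phi> z)) \<bullet> fst m))
     + \<i> * (complex_of_real (dCP1 \<xi> \<phi> z Y \<bullet> snd m)
        - \<i> * complex_of_real ((u (\<phi> z) \<otimes> dCP1 \<xi> \<phi> z Y + dCP1 u \<phi> z Y \<otimes> \<xi> (\<phi> z)) \<bullet> snd m)))) (at z)"
    unfolding F_eq
    by (intro has_derivative_add has_derivative_diff has_derivative_mult_right has_derivative_of_real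
        has_derivative_inner_left oct_cross.FDERIV d\<xi> u_has_derivative[OF \<phi>])
  then have F': "frechet_derivative F (at z) Y = (e (dCP1 \<xi> \<phi> z Y) (fst m) - \<i> * complex_of_real ((dCP1 u \<phi> z Y \<otimes> a) \<bullet> fst m))
    + \<i> * (e (dCP1 \<xi> \<phi> z Y) (snd m) - \<i> * complex_of_real ((dCP1 u \<phi> z Y \<otimes> a) \<bullet> snd m))" for Y
    by (subst frechet_derivativeI, assumption) (simp add: e_def x_def a_def inner_simps algebra_simps)
  have key: "e (tproj x c + x \<otimes> d - x \<otimes> (U \<otimes> a)) r
     = (e c r - \<i> * complex_of_real ((U \<otimes> a) \<bullet> r)) + \<i> * (e d r - \<i> * complex_of_real (((x \<otimes> U) \<otimes> a) \<bullet> r))"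
    if r: "r \<in> Wr" for r
  proof -
    have xr: "x \<bullet> r = 0" using Wr_perp(1)[OF r \<phi>] by (simp add: x_def inner_commute)
    have e_add: "e (v + w) r = e v r + e w r" "e (v - w) r = e v r - e w r" for v w
      by (simp_all add: e_def oct_cross_simps inner_simps algebra_simps)
    have eJ: "e (x \<otimes> v) r = \<i> * e v r" for v
      by (simp add: e_def oct_cross_cross_self inner_simps xr xx complex_eq_iff)
    have et: "e (tproj x v) r = e v r" for v
      by (simp add: e_def) (simp add: tproj_def inner_simps xr)
    have "((x \<otimes> U) \<otimes> a) \<bullet> r = - ((x \<otimes> (U \<otimes> a)) \<bullet> r)"
      using oct_cross_antilinear(1)[of x U a] xx by (simp add: inner_simps xr)
    then have ea: "- (\<i> * e (U \<otimes> a) r) = - \<i> * complex_of_real ((U \<otimes> a) \<bullet> r) + complex_of_real (((x \<otimes> U) \<otimes> a) \<bullet> r)"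
      by (simp add: e_def algebra_simps)
    show ?thesis
      using ea by (simp add: e_add eJ et algebra_simps)
  qed
  have mW: "fst m \<in> Wr" "snd m \<in> Wr" using m by (auto simp: Wc_def)
  have "ell m (\<phi> z) (tproj x c + x \<otimes> d - x \<otimes> (U \<otimes> a))
     = frechet_derivative F (at z) Y + \<i> * frechet_derivative F (at z) (\<i> * Y)"
    unfolding ell_e key[OF mW(1)] key[OF mW(2)] F'
    by (simp add: iU flip: U_def c_def d_def) (simp add: algebra_simps)
  then show ?thesis
    by (simp add: ell_scaleR x_def c_def d_def U_def a_def)
qed

context
  fixes b1 b2 :: imoct
  assumes frame: "Wr_frame b1 b2"
begin

definition Lam :: "CP1 \<Rightarrow> imoct \<Rightarrow> (complex^2) \<times> (complex^2)" where
  "Lam p v = pack (ell (m0 b1) p v) (ell (m1 b1) p v) (ell (m0 b2) p v) (ell (m1 b2) p v)"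

lemma bW: "b1 \<in> Wr" "b2 \<in> Wr"
  using frame by (auto simp: Wr_frame_def)

lemma Lam_add: "Lam p (v + w) = Lam p v + Lam p w"
  by (simp add: Lam_def ell_add pack_add)

lemma Lam_scaleR: "Lam p (c *\<^sub>R v) = c *\<^sub>R Lam p v"
  by (simp add: Lam_def ell_scaleR pack_scaleR)

lemma Lam_linear: "linear (Lam p)"
  by (simp add: linear_iff Lam_add Lam_scaleR)

lemma Lam_tangent: "t \<in> tangent_image u p \<Longrightarrow> Lam p t = 0"
  by (simp add: Lam_def ell_tangent m_Wc bW pack_eq_0_iff)

lemma Lam_J: "v \<in> TS6 (u p) \<Longrightarrow> Lam p (u p \<otimes> v) = cscale2 \<i> (Lam p v)"
  by (simp add: Lam_def ell_J pack_cscale2)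

lemma Lam_eq_0_iff:
  assumes "v \<in> TS6 (u p)"
  shows "Lam p v = 0 \<longleftrightarrow> v \<in> tangent_image u p"
proof
  assume 0: "Lam p v = 0"
  obtain n t where v: "v = n + t" "n \<in> Wr" "t \<in> tangent_image u p"
    by (rule tangent_Wr_decomposition[OF assms])
  then have "Lam p n = 0" using 0 by (simp add: Lam_add Lam_tangent)
  then have "n = 0"
    using ell_injective[OF frame v(2), of p] by (simp add: Lam_def pack_eq_0_iff)
  with v show "v \<in> tangent_image u p" by simp
qed (rule Lam_tangent)

lemma Wr_TS6: "n \<in> Wr \<Longrightarrow> n \<in> TS6 (u p)"
  by (simp add: Wr_def TS6_def)

lemma Lam_Wr_in_fibre:
  assumes n: "n \<in> Wr"
  shows "Lam p n \<in> taut2_fibre p"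
proof (cases rule: chart_pair.point_cases[OF chart_pair_01, of p])
  case (1 z)
  have "Rep_CP1 p = range (\<lambda>k. k *s vector [1, z])"
    unfolding 1 chart0_def by (rule Rep_line[OF chart_vec_nonzero(1)])
  moreover have "vector [ell (m0 b) p n, ell (m1 b) p n] = ell (m0 b) p n *s (vector [1, z] :: complex^2)" if "b \<in> Wr" for b
    unfolding 1 using ell_chart0[OF n that, of z] by (simp add: vec_eq_iff forall_2)
  ultimately show ?thesis
    using bW by (auto simp: taut2_fibre_def Lam_def pack_def)
next
  case 2
  have "Rep_CP1 p = range (\<lambda>k. k *s vector [0, 1])"
    unfolding 2 chart1_def by (rule Rep_line[OF chart_vec_nonzero(2)])
  moreover have "vector [ell (m0 b) p n, ell (m1 b) p n] = ell (m1 b) p n *s (vector [0, 1] :: complex^2)" if "b \<in> Wr" for b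
    unfolding 2 using ell_infinity[OF n that] by (simp add: vec_eq_iff forall_2)
  ultimately show ?thesis
    using bW by (auto simp: taut2_fibre_def Lam_def pack_def)
qed

text \<open>A count of real dimensions: \<open>Lam p\<close> is injective on \<open>Wr\<close>,
  which contains four orthogonal nonzero vectors, and the fibre has dimension at most four.\<close>

lemma Lam_image: "Lam p ` Wr = taut2_fibre p"
proof (rule subspace_dim_equal)
  define x where "x = u (chart1 0)"
  note f = Wr_frame_orthogonal[OF frame x_def]
  have W: "b1 \<noteq> 0" "b2 \<noteq> 0" "b1 \<bullet> b2 = 0" "b2 \<bullet> b1 = 0" "b2 \<bullet> (x \<otimes> b1) = 0"
    using frame by (auto simp: Wr_frame_def x_def inner_commute)
  have o: "(x \<otimes> b2) \<bullet> (x \<otimes> b1) = 0" "(x \<otimes> b2) \<bullet> b1 = 0"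
    using f by (simp_all only: inner_commute)
  have "dim {b1} = 1"
    using dim_insert_orthogonal[of b1 "{}"] W by simp
  then have "dim {x \<otimes> b1, b1} = 2"
    by (simp add: dim_insert_orthogonal f)
  then have "dim {b2, x \<otimes> b1, b1} = 3"
    by (simp add: dim_insert_orthogonal W)
  then have "dim {x \<otimes> b2, b2, x \<otimes> b1, b1} = 4"
    by (simp add: dim_insert_orthogonal f o)
  moreover have "dim {x \<otimes> b2, b2, x \<otimes> b1, b1} \<le> dim Wr"
    using f bW by (intro dim_subset) simp
  ultimately have "4 \<le> dim Wr" by simp
  also have "dim Wr = dim (Lam p ` Wr)"
  proof (rule dim_image_eq[OF Lam_linear, symmetric])
    show "inj_on (Lam p) (span Wr)"
    proof (rule inj_onI)
      fix v w assume vw: "v \<in> span Wr" "w \<in> span Wr" "Lam p v = Lam p w"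
      then have d: "v - w \<in> Wr"
        using span_diff[OF vw(1,2)] by (simp only: iffD2[OF span_eq_iff subspace_Wr])
      have "Lam p (v - w) = 0"
        using vw(3) by (simp add: linear_diff[OF Lam_linear])
      then have "v - w = 0"
        using ell_injective[OF frame d, of p] by (simp add: Lam_def pack_eq_0_iff)
      then show "v = w" by simp
    qed
  qed
  finally show "dim (taut2_fibre p) \<le> dim (Lam p ` Wr)"
    using dim_taut2_fibre[of p] by linarith
  show "subspace (Lam p ` Wr)"
    by (rule linear_subspace_image[OF Lam_linear subspace_Wr])
qed (use Lam_Wr_in_fibre subspace_taut2_fibre in auto)

text \<open>The chosen representative is immaterial because \<open>Lam p\<close> kills tangent
  vectors; see \<open>Phi_quot\<close>.\<close>

definition Phi :: "CP1 \<Rightarrow> imoct set \<Rightarrow> (complex^2) \<times> (complex^2)" where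
  "Phi p A = Lam p (SOME v. v \<in> A)"

lemma Phi_quot: "Phi p (quot_proj u p v) = Lam p v"
proof -
  have "(SOME w. w \<in> quot_proj u p v) - v \<in> tangent_image u p"
    using someI[of "\<lambda>w. w \<in> quot_proj u p v", OF quot_proj_self] by (simp add: quot_proj_mem)
  then have "Lam p ((SOME w. w \<in> quot_proj u p v) - v) = 0"
    by (rule Lam_tangent)
  then show ?thesis
    by (simp add: Phi_def linear_diff[OF Lam_linear])
qed

lemma Phi_bij: "bij_betw (Phi p) (normal_fibre u p) (taut2_fibre p)"
  unfolding bij_betw_def
proof
  show "inj_on (Phi p) (normal_fibre u p)"
  proof (rule inj_onI)
    fix A B assume A: "A \<in> normal_fibre u p" and B: "B \<in> normal_fibre u p" and eq: "Phi p A = Phi p B"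
    from A obtain v where v: "A = quot_proj u p v" "v \<in> TS6 (u p)" unfolding normal_fibre_def by blast
    from B obtain w where w: "B = quot_proj u p w" "w \<in> TS6 (u p)" unfolding normal_fibre_def by blast
    have "Lam p (v - w) = 0"
      using eq by (simp add: v w Phi_quot linear_diff[OF Lam_linear])
    moreover have "v - w \<in> TS6 (u p)" using v w by (simp add: TS6_def inner_simps)
    ultimately show "A = B"
      by (simp add: Lam_eq_0_iff v w quot_proj_eq_iff)
  qed
  show "Phi p ` normal_fibre u p = taut2_fibre p"
  proof
    show "Phi p ` normal_fibre u p \<subseteq> taut2_fibre p"
    proof
      fix y assume "y \<in> Phi p ` normal_fibre u p"
      then obtain v where v: "y = Lam p v" "v \<in> TS6 (u p)"
        unfolding normal_fibre_def by (auto simp: Phi_quot simp del: split_paired_All split_paired_Ex)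
      obtain n t where "v = n + t" "n \<in> Wr" "t \<in> tangent_image u p"
        by (rule tangent_Wr_decomposition[OF v(2)])
      then show "y \<in> taut2_fibre p"
        using Lam_Wr_in_fibre by (simp add: v Lam_add Lam_tangent)
    qed
    show "taut2_fibre p \<subseteq> Phi p ` normal_fibre u p"
      unfolding Lam_image[symmetric]
    proof
      fix y assume "y \<in> Lam p ` Wr"
      then obtain n where "n \<in> Wr" "y = Phi p (quot_proj u p n)"
        by (auto simp: Phi_quot simp del: split_paired_All split_paired_Ex)
      then show "y \<in> Phi p ` normal_fibre u p"
        using quot_proj_fibre[OF Wr_TS6] by blast
    qed
  qed
qed

lemma Phi_dbar:
  assumes s: "is_lift u s \<xi>" and \<phi>: "\<phi> \<in> CP1_charts"
  shows "Phi (\<phi> z) (dbar_N nabla u s \<phi> z Y) = dbar_taut2 (\<lambda>p. Phi p (s p)) \<phi> z Y"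
proof -
  have \<xi>: "pullback_section u \<xi>" and s\<xi>: "s p = quot_proj u p (\<xi> p)" for p
    using s by (auto simp: is_lift_def)
  define F where "F m z = ell m (\<phi> z) (\<xi> (\<phi> z))" for m z
  have dF: "(F m has_derivative frechet_derivative (F m) (at z)) (at z)" for m
    unfolding F_def
    by (intro has_derivative_frechet smooth_on_differentiable[OF ell_section_smooth[OF \<xi> \<phi>]] UNIV_I)
  have D: "dCP1 (\<lambda>p. Phi p (s p)) \<phi> z Y = pack (frechet_derivative (F (m0 b1)) (at z) Y)
      (frechet_derivative (F (m1 b1)) (at z) Y) (frechet_derivative (F (m0 b2)) (at z) Y)
      (frechet_derivative (F (m1 b2)) (at z) Y)" for Y
  proof -
    have "(\<lambda>w. Phi (\<phi> w) (s (\<phi> w))) = (\<lambda>w. pack (F (m0 b1) w) (F (m1 b1) w) (F (m0 b2) w) (F (m1 b2) w))"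
      by (simp add: s\<xi> Phi_quot Lam_def F_def)
    then show ?thesis
      unfolding dCP1_def by (simp only:) (intro frechet_derivativeI pack_has_derivative dF)
  qed
  show ?thesis
    unfolding dbar_N_lift[OF s \<phi>] Phi_quot Lam_def dbar_taut2_def D
    by (simp add: ell_dbar[OF \<xi> \<phi>] m_Wc bW pack_add pack_cscale2 pack_scaleR F_def[abs_def])
qed

lemma Phi_iso: "holomorphic_iso nabla u Phi"
  unfolding holomorphic_iso_def
proof (intro conjI allI ballI impI)
  fix p show "bij_betw (Phi p) (normal_fibre u p) (taut2_fibre p)" by (rule Phi_bij)
next
  fix p A B assume A: "A \<in> normal_fibre u p" and B: "B \<in> normal_fibre u p"
  from A obtain v where v: "A = quot_proj u p v" unfolding normal_fibre_def by blast
  from B obtain w where w: "B = quot_proj u p w" unfolding normal_fibre_def by blast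
  show "Phi p (normal_add A B) = Phi p A + Phi p B"
    by (simp add: v w normal_add_quot Phi_quot Lam_add)
next
  fix p A c assume A: "A \<in> normal_fibre u p"
  from A obtain v where v: "A = quot_proj u p v" "v \<in> TS6 (u p)" unfolding normal_fibre_def by blast
  have "Re c *\<^sub>R X + Im c *\<^sub>R cscale2 \<i> X = cscale2 c X" for X
    by (simp add: cscale2_def prod_eq_iff vec_eq_iff complex_eq_iff)
  then show "Phi p (normal_scale u p c A) = cscale2 c (Phi p A)"
    by (simp add: v(1) normal_scale_quot Phi_quot Lam_add Lam_scaleR Lam_J[OF v(2)])
next
  fix s assume "normal_section u s"
  then obtain \<xi> where s: "is_lift u s \<xi>" unfolding normal_section_def by blast
  then show "smooth_CP1 (\<lambda>p. Phi p (s p))"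
    unfolding smooth_CP1_def
    by (auto simp: is_lift_def Phi_quot Lam_def intro!: smooth_on_pack ell_section_smooth)
next
  fix s \<phi> z Y assume "normal_section u s" "\<phi> \<in> CP1_charts"
  then show "Phi (\<phi> z) (dbar_N nabla u s \<phi> z Y) = dbar_taut2 (\<lambda>p. Phi p (s p)) \<phi> z Y"
    unfolding normal_section_def using Phi_dbar by blast
qed

end

theorem totally_geodesic_imp_iso: "normal_bundle_iso_taut2 nabla u"
  using Wr_frame_exists Phi_iso unfolding normal_bundle_iso_taut2_def by blast

end

theorem proposition7p4:
  fixes u :: "CP1 \<Rightarrow> imoct" and nabla :: connection
  assumes "is_connection nabla" and "preserves_J0 nabla"
    and "pseudoholomorphic u" and "immersed u"
  shows "totally_geodesic u \<longleftrightarrow> normal_bundle_iso_taut2 nabla u"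
proof
  interpret J0_connection_sphere nabla u
    using assms by unfold_locales
  show "totally_geodesic u" if "normal_bundle_iso_taut2 nabla u"
    using that by (rule iso_imp_totally_geodesic)
  show "normal_bundle_iso_taut2 nabla u" if "totally_geodesic u"
  proof -
    interpret totally_geodesic_sphere nabla u
      using that by unfold_locales
    show ?thesis by (rule totally_geodesic_imp_iso)
  qed
qed

end
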